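(* Let $\mathbf N$ be a $\Sigma$-algebra and assume that $\Gamma$ satisfies (L), (M) and (D) relative to $\mathbf N$. Assume that $\underset{\sim}{\mathbf N}=(N;G,R,\mathscr T)$ yields a duality on $\mathscr B=\mathbb{ISP}(\mathbf N)=\mathbb V(\mathbf N)$ with dual category $\mathscr Y=\mathbb{IS}_{\mathrm c}\mathbb P^+(\underset{\sim}{\mathbf N})$. Let $\mathcal M=\{\mathbf N\odot_\Gamma\mathbf T,\ \mathbf T\odot_\Gamma\mathbf N\}$, where $\mathbf T$ is the trivial $\Sigma$-algebra, and let $\underset{\sim}{\mathcal M}=\underset{\sim}{\mathbf N}\uplus\underset{\sim}{\mathbf N}$. Then $\underset{\sim}{\mathcal M}$ yields a multisorted duality for $\mathscr A=\mathbb{ISP}(\mathcal M)=\mathbb V(\{\mathbf P\odot_\Gamma\mathbf Q\mid\mathbf P,\mathbf Q\in\mathbb V(\mathbf N)\})$ for which the dual category is $\mathscr X\cong\mathscr Y\times\mathscr Y$. If the duality for $\mathscr B$ is full, respectively strong, then the same is true of that for $\mathscr A$.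
   Context: $\mathbb V(\mathcal K)=\mathbb{HSP}(\mathcal K)$ is the variety generated by $\mathcal K$; $\mathbb{ISP}(\mathcal K)$ is the class of isomorphic images of subalgebras of products of members of $\mathcal K$; classes of algebras are categories with all homomorphisms. **Conditions on $\Gamma$.** $\Gamma$ is a set of pairs of $\Sigma$-terms such that for $(t_1,t_2)\in\Gamma$ the terms have common even arity $2n_{(t_1,t_2)}$; $\Gamma$ is viewed as a language in which $(t_1,t_2)$, written $[t_1,t_2]$, has arity $n_{(t_1,t_2)}$. $\mathsf P_\Gamma(\mathbf N)$ is the $\Gamma$-algebra on $N\times N$ with, for $n=n_{(t_1,t_2)}$, $[t_1,t_2]((a_1,b_1),\dots,(a_n,b_n))=(t_1^{\mathbf N}(a_1,b_1,\dots,a_n,b_n),t_2^{\mathbf N}(a_1,b_1,\dots,a_n,b_n))$. Let $\delta^N(x)=(x,x)$ and $\pi_i^N\colon N\times N\to N$ be the projections. (L) For each $n$-ary $f\in\Sigma$ and $i\in\{1,2\}$ there is an $n$-ary $\Gamma$-term $t$ with $\pi_i^N\circ t^{\mathsf P_\Gamma(\mathbf N)}\circ(\delta^N)^n=f^{\mathbf N}$. (M) There is a binary $\Gamma$-term $v$ with $v^{\mathsf P_\Gamma(\mathbf N)}((a,b),(c,d))=(a,d)$ for all $a,b,c,d\in N$. (D) For $(t_1,t_2)\in\Gamma$ with $n_{(t_1,t_2)}=n$ there exist $n$-ary $\Sigma$-terms $r_1,r_2$ such that $t_1(x_1,\dots,x_{2n})=r_1(x_1,x_3,\dots,x_{2n-1})$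 and $t_2(x_1,\dots,x_{2n})=r_2(x_2,x_4,\dots,x_{2n})$. For $\mathbf P,\mathbf Q\in\mathbb V(\mathbf N)$, $\mathbf P\odot_\Gamma\mathbf Q$ is the $\Gamma$-algebra with universe $P\times Q$ and operations $[t_1,t_2]((a_1,b_1),\dots,(a_n,b_n))=(r_1^{\mathbf P}(a_1,\dots,a_n),r_2^{\mathbf Q}(b_1,\dots,b_n))$. **Single-sorted dualities.** $\mathbf N$ carries a compact Hausdorff topology $\mathscr T$ making it a topological algebra (discrete if $N$ is finite). $\underset{\sim}{\mathbf N}=(N;G,R,\mathscr T)$ is an alter ego: each $n$-ary $g\in G$ ($n\ge1$) is a continuous homomorphism $\mathbf N^n\to\mathbf N$, each nullary operation in $G$ is an element forming a one-element subalgebra, and each $n$-ary $r\in R$ ($n\ge1$) is a topologically closed subalgebra of $\mathbf N^n$. $\mathbb{IS}_{\mathrm c}\mathbb P^+(\underset{\sim}{\mathbf N})$ is the category of isomorphic copies of closed substructures of non-empty powers of $\underset{\sim}{\mathbf N}$ (product topology, pointwise structure), with the empty structure included (when there are no nullary operations), and with continuous structure-preserving maps as morphisms. The contravariant hom-functors are $\mathsf D(\mathbf A)=\mathscr B(\mathbf A,\mathbf N)$, a closed substructure of $\underset{\sim}{\mathbf N}^A$, and $\mathsf E(\mathbf X)=\mathscr Y(\mathbf X,\underset{\sim}{\mathbf N})$, a subalgebra of $\mathbf N^X$, acting on morphisms by precomposition. The alter ego yields a duality, with dual category $\mathscr Y$, if every evaluation map $e_{\mathbf A}\colon\mathbf A\to\mathsf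 E\mathsf D(\mathbf A)$, $e_{\mathbf A}(a)(x)=x(a)$, is an isomorphism; the duality is full if moreover every evaluation map $\varepsilon_{\mathbf X}\colon\mathbf X\to\mathsf D\mathsf E(\mathbf X)$, $\varepsilon_{\mathbf X}(x)(\alpha)=\alpha(x)$, is an isomorphism; it is strong if it is full and the alter ego is injective in the dual category (with respect to embeddings). **The two-sorted version.** $\underset{\sim}{\mathbf N}\uplus\underset{\sim}{\mathbf N}=(N_1\,\dot\cup\,N_2;G_1,G_2,R_1,R_2,\mathscr T)$ is the two-sorted topological structure based on disjoint copies $N_1,N_2$ of $N$ (with the disjoint union topology) such that each $(N_i;G_i,R_i,\mathscr T{\upharpoonright}_{N_i})$ is isomorphic to $\underset{\sim}{\mathbf N}$; $N_1$ is identified with $N\times T$, the universe of $\mathbf N\odot_\Gamma\mathbf T$, and $N_2$ with $T\times N$, the universe of $\mathbf T\odot_\Gamma\mathbf N$. Structures of this type have the form $(X_1\,\dot\cup\,X_2;G_1,G_2,R_1,R_2,\mathscr T)$, with the operations in $G_i$ and relations in $R_i$ living on the sort $X_i$ and the topology being the disjoint union topology; morphisms are continuous maps sending sort $i$ to sort $i$ and preserving the structure. Powers are formed sort by sort, $\underset{\sim}{\mathcal M}^S=N_1^S\,\dot\cup\,N_2^S$, and $\mathscr X=\mathbb{IS}_{\mathrm c}\mathbb P^+(\underset{\sim}{\mathcal M})$ is the category of isomorphic copies of closed (multisorted) substructures of non-empty powers of $\underset{\sim}{\mathcal M}$, where sorts may be empty when there are no nullary operations. With $\mathbf M_1=\mathbf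 N\odot_\Gamma\mathbf T$ and $\mathbf M_2=\mathbf T\odot_\Gamma\mathbf N$, the hom-functors are $\mathsf D(\mathbf A)=\mathscr A(\mathbf A,\mathbf M_1)\,\dot\cup\,\mathscr A(\mathbf A,\mathbf M_2)$, a closed substructure of $\underset{\sim}{\mathcal M}^A$, and $\mathsf E(\mathbf X)=\mathscr X(\mathbf X,\underset{\sim}{\mathcal M})$, a subalgebra of $\mathbf M_1^{X_1}\times\mathbf M_2^{X_2}$. "Yields a multisorted duality", "full" and "strong" are defined exactly as in the single-sorted case using the corresponding evaluation maps. Here $\mathscr X\cong\mathscr Y\times\mathscr Y$ means that the assignment $(\mathbf X_1,\mathbf X_2)\mapsto\mathbf X_1\uplus\mathbf X_2$ (disjoint union as a two-sorted structure), $(\phi_1,\phi_2)\mapsto\phi_1\,\dot\cup\,\phi_2$, is a categorical equivalence from $\mathscr Y\times\mathscr Y$ to $\mathscr X$. *)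

theory Defs
  imports "HOL-Analysis.Analysis"
begin

section \<open>Terms and algebras\<close>

datatype 'f trm = Var nat | App 'f "'f trm list"

record 'f sgn =
  syms :: "'f set"
  ar :: "'f \<Rightarrow> nat"

text \<open>The \<open>k\<close>-ary terms, in the variables \<open>Var 0, \<dots>, Var (k - 1)\<close>.\<close>

inductive_set trms :: "'f sgn \<Rightarrow> nat \<Rightarrow> 'f trm set" for Sg k where
  "i < k \<Longrightarrow> Var i \<in> trms Sg k"
| "f \<in> syms Sg \<Longrightarrow> length ts = ar Sg f \<Longrightarrow> \<forall>t \<in> set ts. t \<in> trms Sg k \<Longrightarrow> App f ts \<in> trms Sg k"

record ('f, 'a) alg =
  carrier :: "'a set"
  oper :: "'f \<Rightarrow> 'a list \<Rightarrow> 'a"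

primrec teval :: "('f, 'a) alg \<Rightarrow> 'a list \<Rightarrow> 'f trm \<Rightarrow> 'a" where
  "teval A as (Var i) = as ! i"
| "teval A as (App f ts) = oper A f (map (teval A as) ts)"

definition tuples :: "nat \<Rightarrow> 'a set \<Rightarrow> 'a list set" where
  "tuples n X = {xs. length xs = n \<and> set xs \<subseteq> X}"

definition algebra :: "'f sgn \<Rightarrow> ('f, 'a) alg \<Rightarrow> bool" where
  "algebra Sg A \<longleftrightarrow> carrier A \<noteq> {} \<and>
     (\<forall>f \<in> syms Sg. \<forall>as \<in> tuples (ar Sg f) (carrier A). oper A f as \<in> carrier A)"

definition trivial_algebra :: "'f sgn \<Rightarrow> ('f, 'a) alg \<Rightarrow> bool" where
  "trivial_algebra Sg A \<longleftrightarrow> algebra Sg A \<and> (\<exists>c. carrier A = {c})"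

text \<open>Maps are functions that are \<^const>\<open>undefined\<close> outside their domain, so that sets of
  homomorphisms are subsets of powers.\<close>

definition hom :: "'f sgn \<Rightarrow> ('f, 'a) alg \<Rightarrow> ('f, 'b) alg \<Rightarrow> ('a \<Rightarrow> 'b) set" where
  "hom Sg A B = {h \<in> carrier A \<rightarrow>\<^sub>E carrier B.
     \<forall>f \<in> syms Sg. \<forall>as \<in> tuples (ar Sg f) (carrier A). h (oper A f as) = oper B f (map h as)}"

definition alg_iso :: "'f sgn \<Rightarrow> ('f, 'a) alg \<Rightarrow> ('f, 'b) alg \<Rightarrow> ('a \<Rightarrow> 'b) \<Rightarrow> bool" where
  "alg_iso Sg A B h \<longleftrightarrow> h \<in> hom Sg A B \<and> bij_betw h (carrier A) (carrier B)"

definition subuniverse :: "'f sgn \<Rightarrow> ('f, 'a) alg \<Rightarrow> 'a set \<Rightarrow> bool" where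
  "subuniverse Sg A S \<longleftrightarrow> S \<subseteq> carrier A \<and> S \<noteq> {} \<and>
     (\<forall>f \<in> syms Sg. \<forall>as \<in> tuples (ar Sg f) S. oper A f as \<in> S)"

definition subalg :: "('f, 'a) alg \<Rightarrow> 'a set \<Rightarrow> ('f, 'a) alg" where
  "subalg A S = \<lparr>carrier = S, oper = oper A\<rparr>"

definition prod_alg :: "'i set \<Rightarrow> ('i \<Rightarrow> ('f, 'a) alg) \<Rightarrow> ('f, 'i \<Rightarrow> 'a) alg" where
  "prod_alg I F = \<lparr>carrier = (\<Pi>\<^sub>E i\<in>I. carrier (F i)),
     oper = (\<lambda>f xs. \<lambda>i\<in>I. oper (F i) f (map (\<lambda>x. x i) xs))\<rparr>"

text \<open>In the next two definitions the type of the index set is only chosen large enough: by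
  \<open>ISP_I\<close> and \<open>HSP_I\<close> below, products over index sets of arbitrary type give
  the same classes. Classes of algebras are relative to the carrier type \<open>'a\<close>, which is
  arbitrary.\<close>

definition ISP :: "'f sgn \<Rightarrow> ('f, 'm) alg set \<Rightarrow> ('f, 'a) alg set" where
  "ISP Sg K = {A. algebra Sg A \<and>
     (\<exists>(I :: ('a \<times> 'a) set) F S h. (\<forall>i\<in>I. F i \<in> K) \<and> subuniverse Sg (prod_alg I F) S \<and>
        alg_iso Sg A (subalg (prod_alg I F) S) h)}"

definition HSP :: "'f sgn \<Rightarrow> ('f, 'm) alg set \<Rightarrow> ('f, 'a) alg set" where
  "HSP Sg K = {A. algebra Sg A \<and>
     (\<exists>(I :: (('f, 'm) alg \<times> ('a \<Rightarrow> 'm)) set) F S h.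
        (\<forall>i\<in>I. F i \<in> K) \<and> subuniverse Sg (prod_alg I F) S \<and>
        h \<in> hom Sg (subalg (prod_alg I F) S) A \<and> h ` S = carrier A)}"


lemma tuplesD: "xs \<in> tuples n X \<Longrightarrow> x \<in> set xs \<Longrightarrow> x \<in> X"
  by (auto simp: tuples_def)

lemma tuples_map: "xs \<in> tuples n X \<Longrightarrow> (\<And>x. x \<in> X \<Longrightarrow> f x \<in> Y) \<Longrightarrow> map f xs \<in> tuples n Y"
  by (auto simp: tuples_def)

lemma ISP_I:
  fixes I :: "'i set" and A :: "('f, 'a) alg" and F :: "'i \<Rightarrow> ('f, 'm) alg"
  assumes A: "algebra Sg A" and F: "\<forall>i\<in>I. F i \<in> K"
    and S: "subuniverse Sg (prod_alg I F) S" and h: "alg_iso Sg A (subalg (prod_alg I F) S) h"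
  shows "A \<in> ISP Sg K"
proof -
  define I' where "I' = {(a, b) \<in> carrier A \<times> carrier A. a \<noteq> b}"
  have hS: "h a \<in> S" if "a \<in> carrier A" for a
    using h that by (auto simp: alg_iso_def subalg_def bij_betw_def)
  have SP: "S \<subseteq> (\<Pi>\<^sub>E i\<in>I. carrier (F i))"
    using S by (auto simp: subuniverse_def prod_alg_def)
  have "\<exists>i\<in>I. h a i \<noteq> h b i" if "(a, b) \<in> I'" for a b
  proof (rule ccontr)
    assume "\<not> ?thesis"
    then have "h a = h b"
      using that SP hS[of a] hS[of b] unfolding I'_def by (intro PiE_ext[where k = I and s = "\<lambda>i. carrier (F i)"]) auto
    then show False
      using that h by (auto simp: I'_def alg_iso_def bij_betw_def inj_on_def)
  qed
  then obtain d where d: "\<And>a b. (a, b) \<in> I' \<Longrightarrow> d (a, b) \<in> I \<and> h a (d (a, b)) \<noteq> h b (d (a, b))"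
    by (metis (no_types, lifting) old.prod.case)
  define h' where "h' = (\<lambda>a\<in>carrier A. \<lambda>p\<in>I'. h a (d p))"
  have dI: "d p \<in> I" if "p \<in> I'" for p
    using d that by (cases p) auto
  have mem: "h a (d p) \<in> carrier (F (d p))" if "a \<in> carrier A" "p \<in> I'" for a p
    using SP hS[OF that(1)] dI[OF that(2)] by auto
  have hom': "h' (oper A f as) = oper (prod_alg I' (\<lambda>p. F (d p))) f (map h' as)"
    if "f \<in> syms Sg" "as \<in> tuples (ar Sg f) (carrier A)" for f as
  proof
    fix p
    have "oper A f as \<in> carrier A" using A that by (auto simp: algebra_def)
    moreover have "h (oper A f as) = oper (prod_alg I F) f (map h as)"
      using h that by (auto simp: alg_iso_def hom_def subalg_def)
    moreover have "map (\<lambda>a. h' a p) as = map (\<lambda>a. h a (d p)) as" if "p \<in> I'"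
      using that \<open>as \<in> _\<close> by (auto simp: h'_def tuples_def)
    ultimately show "h' (oper A f as) p = oper (prod_alg I' (\<lambda>p. F (d p))) f (map h' as) p"
      using dI[of p] by (cases "p \<in> I'") (auto simp: h'_def[THEN fun_cong, of "oper A f as"] prod_alg_def o_def cong: map_cong)
  qed
  have into: "h' \<in> carrier A \<rightarrow>\<^sub>E (\<Pi>\<^sub>E p\<in>I'. carrier (F (d p)))"
    using mem by (auto simp: h'_def)
  have inj: "inj_on h' (carrier A)"
  proof (rule inj_onI, rule ccontr)
    fix a b assume ab: "a \<in> carrier A" "b \<in> carrier A" "h' a = h' b" "a \<noteq> b"
    then have "(a, b) \<in> I'" by (auto simp: I'_def)
    moreover have "h' x p = h x (d p)" if "x \<in> carrier A" "p \<in> I'" for x p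
      using that by (simp add: h'_def)
    ultimately show False using d ab by metis
  qed
  let ?S = "h' ` carrier A"
  have sub: "subuniverse Sg (prod_alg I' (\<lambda>p. F (d p))) ?S"
    unfolding subuniverse_def
  proof (intro conjI ballI)
    show "?S \<subseteq> carrier (prod_alg I' (\<lambda>p. F (d p)))" using into by (auto simp: prod_alg_def)
    show "?S \<noteq> {}" using A by (auto simp: algebra_def)
    fix f bs assume f: "f \<in> syms Sg" and bs: "bs \<in> tuples (ar Sg f) ?S"
    define as where "as = map (inv_into (carrier A) h') bs"
    have "as \<in> tuples (ar Sg f) (carrier A)"
      unfolding as_def using bs by (rule tuples_map) (rule inv_into_into)
    then have "oper A f as \<in> carrier A" "h' (oper A f as) = oper (prod_alg I' (\<lambda>p. F (d p))) f (map h' as)"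
      using hom'[OF f] A f by (auto simp: algebra_def)
    moreover have "h' (inv_into (carrier A) h' y) = y" if "y \<in> set bs" for y
      using tuplesD[OF bs that] by (rule f_inv_into_f)
    then have "map h' as = bs"
      unfolding as_def map_map by (intro map_idI) simp
    ultimately show "oper (prod_alg I' (\<lambda>p. F (d p))) f bs \<in> ?S"
      by (metis imageI)
  qed
  have "h' \<in> carrier A \<rightarrow>\<^sub>E ?S" using into by (auto simp: PiE_def)
  then have iso: "alg_iso Sg A (subalg (prod_alg I' (\<lambda>p. F (d p))) ?S) h'"
    using hom' inj by (simp add: alg_iso_def hom_def subalg_def bij_betw_def)
  have K: "\<forall>p\<in>I'. F (d p) \<in> K" using F dI by simp
  show ?thesis
    unfolding ISP_def mem_Collect_eq
    by (intro conjI A sub iso K exI[of _ I'] exI[of _ "\<lambda>p. F (d p)"] exI[of _ ?S] exI[of _ h'])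
qed

lemma HSP_I:
  fixes I :: "'i set" and A :: "('f, 'a) alg" and F :: "'i \<Rightarrow> ('f, 'm) alg"
  assumes A: "algebra Sg A" and F: "\<forall>i\<in>I. F i \<in> K"
    and S: "subuniverse Sg (prod_alg I F) S"
    and h: "h \<in> hom Sg (subalg (prod_alg I F) S) A" "h ` S = carrier A"
  shows "A \<in> HSP Sg K"
proof -
  define s where "s = inv_into S h"
  have s: "s a \<in> S" "h (s a) = a" if "a \<in> carrier A" for a
    using that h(2) by (auto simp: s_def inv_into_into f_inv_into_f)
  have SP: "S \<subseteq> (\<Pi>\<^sub>E i\<in>I. carrier (F i))"
    using S by (auto simp: subuniverse_def prod_alg_def)
  define k where "k = (\<lambda>i. (F i, \<lambda>a\<in>carrier A. s a i))"
  let ?P = "prod_alg (k ` I) fst"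
  define c where "c = (\<lambda>x. \<lambda>i\<in>I. x (k i) :: 'm)"
  define S' where "S' = {x \<in> carrier ?P. c x \<in> S}"
  define h' where "h' = (\<lambda>x\<in>S'. h (c x))"
  have c_i: "c x i = x (k i)" if "i \<in> I" for x i
    using that by (simp add: c_def)
  have c: "c (oper ?P f xs) = oper (prod_alg I F) f (map c xs)" for f xs
  proof
    fix i
    show "c (oper ?P f xs) i = oper (prod_alg I F) f (map c xs) i"
      by (cases "i \<in> I") (auto simp: c_i prod_alg_def o_def, auto simp: c_def k_def)
  qed
  have lift: "\<exists>x\<in>S'. c x = s a" if a: "a \<in> carrier A" for a
  proof -
    define x where "x = (\<lambda>p\<in>k ` I. snd p a)"
    have sP: "s a \<in> (\<Pi>\<^sub>E i\<in>I. carrier (F i))" using SP s(1)[OF a] by blast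
    then have "c x = s a"
      using a
      by (intro PiE_ext[where k = I and s = "\<lambda>i. carrier (F i)"]) (auto simp: c_def x_def k_def)
    moreover have "x \<in> carrier ?P"
      using sP a by (auto simp: x_def prod_alg_def k_def)
    ultimately show ?thesis using s(1)[OF a] by (auto simp: S'_def)
  qed
  have clos: "oper ?P f xs \<in> S'" if f: "f \<in> syms Sg" and xs: "xs \<in> tuples (ar Sg f) S'" for f xs
  proof -
    have m: "map c xs \<in> tuples (ar Sg f) S"
      using xs by (rule tuples_map) (auto simp: S'_def)
    then have *: "c (oper ?P f xs) \<in> S"
      unfolding c using S f by (auto simp: subuniverse_def)
    have "oper ?P f xs p \<in> carrier (fst p)" if p: "p \<in> k ` I" for p
    proof -
      from p obtain i where i: "i \<in> I" "p = k i" by auto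
      have "c (oper ?P f xs) i \<in> carrier (F i)" using * SP i by auto
      then show ?thesis using i by (auto simp: c_def k_def)
    qed
    then have "oper ?P f xs \<in> carrier ?P" by (auto simp: prod_alg_def)
    with * show ?thesis by (auto simp: S'_def)
  qed
  have "subuniverse Sg ?P S'"
    unfolding subuniverse_def
  proof (intro conjI ballI)
    show "S' \<noteq> {}" using A lift by (fastforce simp: algebra_def)
  qed (use clos in \<open>auto simp: S'_def\<close>)
  moreover have im: "h' ` S' = carrier A"
    using lift s h(2) by (force simp: h'_def S'_def)
  moreover have "h' \<in> hom Sg (subalg ?P S') A"
    unfolding hom_def
  proof (intro CollectI conjI ballI)
    show "h' \<in> carrier (subalg ?P S') \<rightarrow>\<^sub>E carrier A"
      using im by (auto simp: h'_def subalg_def)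
    fix f xs assume f: "f \<in> syms Sg" and xs: "xs \<in> tuples (ar Sg f) (carrier (subalg ?P S'))"
    then have xs': "xs \<in> tuples (ar Sg f) S'" by (simp add: subalg_def)
    have m: "map c xs \<in> tuples (ar Sg f) S"
      using xs' by (rule tuples_map) (auto simp: S'_def)
    have "h' (oper ?P f xs) = h (oper (prod_alg I F) f (map c xs))"
      using clos[OF f xs'] by (simp add: h'_def c)
    also have "\<dots> = oper A f (map h (map c xs))"
      using h(1) f m by (auto simp: hom_def subalg_def)
    also have "map h (map c xs) = map h' xs"
      using xs' by (auto simp: h'_def tuples_def)
    finally show "h' (oper (subalg ?P S') f xs) = oper A f (map h' xs)"
      by (simp add: subalg_def)
  qed
  moreover have "\<forall>p\<in>k ` I. fst p \<in> K" using F by (auto simp: k_def)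
  ultimately show ?thesis
    unfolding HSP_def using A by blast
qed


section \<open>The language \<open>\<Gamma>\<close> and the product \<open>\<odot>\<close>\<close>

text \<open>A member \<open>(n, t\<^sub>1, t\<^sub>2)\<close> of \<open>\<Gamma>\<close> is the pair \<open>(t\<^sub>1, t\<^sub>2)\<close> together with half of the
  common arity \<open>2n\<close> of its terms, which the bare terms do not determine. The paper's variable
  \<open>x\<^sub>i\<close> is \<open>Var (i - 1)\<close>.\<close>

type_synonym 'f gpair = "nat \<times> 'f trm \<times> 'f trm"

definition gamma_wf :: "'f sgn \<Rightarrow> 'f gpair set \<Rightarrow> bool" where
  "gamma_wf Sg \<Gamma> \<longleftrightarrow> (\<forall>(n, t1, t2) \<in> \<Gamma>. t1 \<in> trms Sg (2 * n) \<and> t2 \<in> trms Sg (2 * n))"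

definition gsgn :: "'f gpair set \<Rightarrow> 'f gpair sgn" where
  "gsgn \<Gamma> = \<lparr>syms = \<Gamma>, ar = fst\<rparr>"

definition interleave :: "('a \<times> 'a) list \<Rightarrow> 'a list" where
  "interleave ps = concat (map (\<lambda>(a, b). [a, b]) ps)"

definition PGam :: "('f, 'a) alg \<Rightarrow> ('f gpair, 'a \<times> 'a) alg" where
  "PGam N = \<lparr>carrier = carrier N \<times> carrier N,
     oper = (\<lambda>(n, t1, t2) ps. (teval N (interleave ps) t1, teval N (interleave ps) t2))\<rparr>"

definition cond_L :: "'f sgn \<Rightarrow> ('f, 'a) alg \<Rightarrow> 'f gpair set \<Rightarrow> bool" where
  "cond_L Sg N \<Gamma> \<longleftrightarrow> (\<forall>f \<in> syms Sg. \<forall>\<pi> \<in> {fst, snd}. \<exists>t \<in> trms (gsgn \<Gamma>) (ar Sg f).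
     \<forall>as \<in> tuples (ar Sg f) (carrier N).
       \<pi> (teval (PGam N) (map (\<lambda>x. (x, x)) as) t) = oper N f as)"

definition cond_M :: "('f, 'a) alg \<Rightarrow> 'f gpair set \<Rightarrow> bool" where
  "cond_M N \<Gamma> \<longleftrightarrow> (\<exists>v \<in> trms (gsgn \<Gamma>) 2. \<forall>a \<in> carrier N. \<forall>b \<in> carrier N. \<forall>c \<in> carrier N. \<forall>d \<in> carrier N.
     teval (PGam N) [(a, b), (c, d)] v = (a, d))"

text \<open>Condition (D), with the terms \<open>r\<^sub>1, r\<^sub>2\<close> whose existence it asserts made explicit because
  \<open>\<odot>\<close> is built from them. The equations are read as identities of \<open>\<^bold>N\<close>; syntactic equality
  of the terms is a special case.\<close>

definition cond_D ::
    "'f sgn \<Rightarrow> ('f, 'a) alg \<Rightarrow> 'f gpair set \<Rightarrow> ('f gpair \<Rightarrow> 'f trm) \<Rightarrow> ('f gpair \<Rightarrow> 'f trm) \<Rightarrow> bool" where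
  "cond_D Sg N \<Gamma> r1 r2 \<longleftrightarrow> (\<forall>(n, t1, t2) \<in> \<Gamma>.
     r1 (n, t1, t2) \<in> trms Sg n \<and> r2 (n, t1, t2) \<in> trms Sg n \<and>
     (\<forall>ps \<in> tuples n (carrier N \<times> carrier N).
        teval N (interleave ps) t1 = teval N (map fst ps) (r1 (n, t1, t2)) \<and>
        teval N (interleave ps) t2 = teval N (map snd ps) (r2 (n, t1, t2))))"

definition odot :: "('f gpair \<Rightarrow> 'f trm) \<Rightarrow> ('f gpair \<Rightarrow> 'f trm) \<Rightarrow>
    ('f, 'a) alg \<Rightarrow> ('f, 'b) alg \<Rightarrow> ('f gpair, 'a \<times> 'b) alg" where
  "odot r1 r2 P Q = \<lparr>carrier = carrier P \<times> carrier Q,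
     oper = (\<lambda>\<gamma> ps. (teval P (map fst ps) (r1 \<gamma>), teval Q (map snd ps) (r2 \<gamma>)))\<rparr>"


section \<open>Single-sorted dualities\<close>

record ('g, 'r) ssgn =
  gsyms :: "'g set"
  gar :: "'g \<Rightarrow> nat"
  rsyms :: "'r set"
  rar :: "'r \<Rightarrow> nat"

record ('g, 'r, 'x) tstruct =
  scar :: "'x set"
  sop :: "'g \<Rightarrow> 'x list \<Rightarrow> 'x"
  srel :: "'r \<Rightarrow> 'x list set"
  stop :: "'x topology"

definition is_struct :: "('g, 'r) ssgn \<Rightarrow> ('g, 'r, 'x) tstruct \<Rightarrow> bool" where
  "is_struct ss X \<longleftrightarrow> topspace (stop X) = scar X \<and>
     (\<forall>g \<in> gsyms ss. \<forall>xs \<in> tuples (gar ss g) (scar X). sop X g xs \<in> scar X) \<and>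
     (\<forall>r \<in> rsyms ss. srel X r \<subseteq> tuples (rar ss r) (scar X))"

definition mor :: "('g, 'r) ssgn \<Rightarrow> ('g, 'r, 'x) tstruct \<Rightarrow> ('g, 'r, 'y) tstruct \<Rightarrow> ('x \<Rightarrow> 'y) set" where
  "mor ss X Y = {\<phi> \<in> scar X \<rightarrow>\<^sub>E scar Y. continuous_map (stop X) (stop Y) \<phi> \<and>
     (\<forall>g \<in> gsyms ss. \<forall>xs \<in> tuples (gar ss g) (scar X). \<phi> (sop X g xs) = sop Y g (map \<phi> xs)) \<and>
     (\<forall>r \<in> rsyms ss. \<forall>xs \<in> srel X r. map \<phi> xs \<in> srel Y r)}"

definition str_iso :: "('g, 'r) ssgn \<Rightarrow> ('g, 'r, 'x) tstruct \<Rightarrow> ('g, 'r, 'y) tstruct \<Rightarrow> ('x \<Rightarrow> 'y) \<Rightarrow> bool" where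
  "str_iso ss X Y \<phi> \<longleftrightarrow> \<phi> \<in> mor ss X Y \<and>
     (\<exists>\<psi> \<in> mor ss Y X. (\<forall>x \<in> scar X. \<psi> (\<phi> x) = x) \<and> (\<forall>y \<in> scar Y. \<phi> (\<psi> y) = y))"

definition power_str :: "'s set \<Rightarrow> ('g, 'r, 'x) tstruct \<Rightarrow> ('g, 'r, 's \<Rightarrow> 'x) tstruct" where
  "power_str S X = \<lparr>scar = S \<rightarrow>\<^sub>E scar X,
     sop = (\<lambda>g xs. \<lambda>s\<in>S. sop X g (map (\<lambda>x. x s) xs)),
     srel = (\<lambda>r. {xs. set xs \<subseteq> S \<rightarrow>\<^sub>E scar X \<and> (\<forall>s\<in>S. map (\<lambda>x. x s) xs \<in> srel X r)}),
     stop = product_topology (\<lambda>_. stop X) S\<rparr>"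

definition closed_sub :: "('g, 'r) ssgn \<Rightarrow> ('g, 'r, 'x) tstruct \<Rightarrow> 'x set \<Rightarrow> bool" where
  "closed_sub ss X Y \<longleftrightarrow> closedin (stop X) Y \<and>
     (\<forall>g \<in> gsyms ss. \<forall>xs \<in> tuples (gar ss g) Y. sop X g xs \<in> Y)"

definition restr :: "('g, 'r, 'x) tstruct \<Rightarrow> 'x set \<Rightarrow> ('g, 'r, 'x) tstruct" where
  "restr X Y = \<lparr>scar = Y, sop = sop X, srel = (\<lambda>r. {xs \<in> srel X r. set xs \<subseteq> Y}),
     stop = subtopology (stop X) Y\<rparr>"

definition str_embedding ::
    "('g, 'r) ssgn \<Rightarrow> ('g, 'r, 'x) tstruct \<Rightarrow> ('g, 'r, 'y) tstruct \<Rightarrow> ('x \<Rightarrow> 'y) \<Rightarrow> bool" where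
  "str_embedding ss X Y \<phi> \<longleftrightarrow> closed_sub ss Y (\<phi> ` scar X) \<and> str_iso ss X (restr Y (\<phi> ` scar X)) \<phi>"

text \<open>The structure \<open>NT\<close> is an alter ego of the algebra \<open>N\<close>. In the finite case, a compact Hausdorff
  topology is discrete. A finite power of \<open>N\<close> is taken over \<open>{..<n}\<close>, so that its elements are
  turned into argument lists by \<open>map x [0..<n]\<close>.\<close>

definition alter_ego :: "'f sgn \<Rightarrow> ('f, 'n) alg \<Rightarrow> ('g, 'r) ssgn \<Rightarrow> ('g, 'r, 'n) tstruct \<Rightarrow> bool" where
  "alter_ego Sg N ss NT \<longleftrightarrow> is_struct ss NT \<and> scar NT = carrier N \<and>
     compact_space (stop NT) \<and> Hausdorff_space (stop NT) \<and>
     (\<forall>f \<in> syms Sg. continuous_map (product_topology (\<lambda>_. stop NT) {..<ar Sg f}) (stop NT)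
        (\<lambda>x. oper N f (map x [0..<ar Sg f]))) \<and>
     (\<forall>g \<in> gsyms ss. let n = gar ss g in
        if n = 0 then subuniverse Sg N {sop NT g []}
        else (\<lambda>x \<in> {..<n} \<rightarrow>\<^sub>E carrier N. sop NT g (map x [0..<n])) \<in> hom Sg (prod_alg {..<n} (\<lambda>_. N)) N \<and>
          continuous_map (product_topology (\<lambda>_. stop NT) {..<n}) (stop NT)
            (\<lambda>x. sop NT g (map x [0..<n]))) \<and>
     (\<forall>r \<in> rsyms ss. let n = rar ss r; R = {x \<in> {..<n} \<rightarrow>\<^sub>E carrier N. map x [0..<n] \<in> srel NT r} in
        n \<ge> 1 \<and> subuniverse Sg (prod_alg {..<n} (\<lambda>_. N)) R \<and>
        closedin (product_topology (\<lambda>_. stop NT) {..<n}) R)"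

text \<open>The type of the exponent is again only chosen large enough, see \<open>IScP_I\<close> below.
  The structure on the empty set belongs to the class exactly if there are no nullary operations.\<close>

definition IScP :: "('g, 'r) ssgn \<Rightarrow> ('g, 'r, 'n) tstruct \<Rightarrow> ('g, 'r, 'x) tstruct set" where
  "IScP ss NT = {X. is_struct ss X \<and>
     (\<exists>(S :: ('x \<Rightarrow> 'n) set) Y \<phi>. S \<noteq> {} \<and> closed_sub ss (power_str S NT) Y \<and>
        str_iso ss X (restr (power_str S NT) Y) \<phi>)}"

lemma continuous_map_reindex:
  assumes "k ` S \<subseteq> S'"
  shows "continuous_map (product_topology (\<lambda>_. T) S') (product_topology (\<lambda>_. T) S) (\<lambda>y. \<lambda>s\<in>S. y (k s))"
  unfolding continuous_map_componentwise
  using assms by (auto intro!: continuous_map_product_projection)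

lemma reindex_power:
  fixes k :: "'s \<Rightarrow> 't" and X :: "('g, 'r, 'x) tstruct" and NT :: "('g, 'r, 'n) tstruct"
  assumes X: "is_struct ss X" and NT: "is_struct ss NT"
    and Y: "closed_sub ss (power_str S NT) Y" and \<phi>: "str_iso ss X (restr (power_str S NT) Y) \<phi>"
    and k: "\<And>x s s'. x \<in> scar X \<Longrightarrow> s \<in> S \<Longrightarrow> s' \<in> S \<Longrightarrow> k s = k s' \<Longrightarrow> \<phi> x s = \<phi> x s'"
  shows "\<exists>Y' \<phi>'. closed_sub ss (power_str (k ` S) NT) Y' \<and>
    str_iso ss X (restr (power_str (k ` S) NT) Y') \<phi>'"
proof -
  let ?P = "power_str S NT" and ?P' = "power_str (k ` S) NT"
  define c where "c = (\<lambda>y. \<lambda>s\<in>S. y (k s) :: 'n)"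
  have c_s: "c y s = y (k s)" if "s \<in> S" for y s using that by (simp add: c_def)
  have top: "topspace (stop NT) = scar NT" using NT by (simp add: is_struct_def)
  have YP: "Y \<subseteq> S \<rightarrow>\<^sub>E scar NT"
    using Y closedin_subset[of "stop ?P" Y] top by (auto simp: closed_sub_def power_str_def)
  obtain \<psi> where m: "\<phi> \<in> mor ss X (restr ?P Y)" and \<psi>: "\<psi> \<in> mor ss (restr ?P Y) X"
    and \<psi>\<phi>: "\<And>x. x \<in> scar X \<Longrightarrow> \<psi> (\<phi> x) = x" and \<phi>\<psi>: "\<And>y. y \<in> Y \<Longrightarrow> \<phi> (\<psi> y) = y"
    using \<phi> by (auto simp: str_iso_def restr_def)
  have \<phi>Y: "\<phi> x \<in> Y" if "x \<in> scar X" for x using m that by (auto simp: mor_def restr_def)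
  have \<phi>N: "\<phi> x s \<in> scar NT" if "x \<in> scar X" "s \<in> S" for x s using \<phi>Y[OF that(1)] YP that(2) by auto
  define Y' where "Y' = {y \<in> k ` S \<rightarrow>\<^sub>E scar NT. c y \<in> Y}"
  define \<phi>' where "\<phi>' = (\<lambda>x\<in>scar X. \<lambda>p\<in>k ` S. \<phi> x (inv_into S k p))"
  define \<psi>' where "\<psi>' = (\<lambda>y\<in>Y'. \<psi> (c y))"
  have \<phi>'k: "\<phi>' x (k s) = \<phi> x s" if "x \<in> scar X" "s \<in> S" for x s
    using that k[of x "inv_into S k (k s)" s] by (simp add: \<phi>'_def inv_into_into f_inv_into_f)
  have \<phi>'P: "\<phi>' x \<in> k ` S \<rightarrow>\<^sub>E scar NT" if x: "x \<in> scar X" for x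
  proof (rule PiE_I)
    show "\<phi>' x p \<in> scar NT" if "p \<in> k ` S" for p using that \<phi>'k[OF x] \<phi>N[OF x] by auto
    show "\<phi>' x p = undefined" if "p \<notin> k ` S" for p using that x by (simp add: \<phi>'_def)
  qed
  have c\<phi>': "c (\<phi>' x) = \<phi> x" if x: "x \<in> scar X" for x
  proof
    have "\<phi> x \<in> S \<rightarrow>\<^sub>E scar NT" using \<phi>Y[OF x] YP by blast
    then show "c (\<phi>' x) s = \<phi> x s" for s
      using \<phi>'k[OF x] by (cases "s \<in> S") (auto simp: c_def)
  qed
  have \<phi>'Y: "\<phi>' x \<in> Y'" if x: "x \<in> scar X" for x
    using \<phi>'P[OF x] c\<phi>'[OF x] \<phi>Y[OF x] by (simp add: Y'_def)
  have c_inj: "y = z" if "y \<in> Y'" "z \<in> Y'" "c y = c z" for y z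
  proof (rule PiE_ext[where k = "k ` S" and s = "\<lambda>_. scar NT"])
    show "y p = z p" if "p \<in> k ` S" for p
      using that \<open>c y = c z\<close> by (metis c_s imageE)
  qed (use that in \<open>auto simp: Y'_def\<close>)
  have cop: "c (sop ?P' g ys) = sop ?P g (map c ys)" for g ys
  proof
    fix s show "c (sop ?P' g ys) s = sop ?P g (map c ys) s"
      by (cases "s \<in> S") (auto simp: c_s power_str_def o_def, auto simp: c_def)
  qed
  have clos: "sop ?P' g ys \<in> Y'" if g: "g \<in> gsyms ss" and ys: "ys \<in> tuples (gar ss g) Y'" for g ys
  proof -
    have "map (\<lambda>y. y p) ys \<in> tuples (gar ss g) (scar NT)" if "p \<in> k ` S" for p
      using ys by (rule tuples_map) (use that in \<open>auto simp: Y'_def\<close>)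
    then have "sop ?P' g ys \<in> k ` S \<rightarrow>\<^sub>E scar NT"
      using NT g by (auto simp: power_str_def is_struct_def)
    moreover have "map c ys \<in> tuples (gar ss g) Y"
      using ys by (rule tuples_map) (auto simp: Y'_def)
    then have "sop ?P g (map c ys) \<in> Y" using Y g by (auto simp: closed_sub_def)
    ultimately show ?thesis by (simp add: Y'_def cop)
  qed
  have cc: "continuous_map (stop ?P') (stop ?P) c"
    unfolding c_def power_str_def by (simp add: continuous_map_reindex)
  have Y'eq: "Y' = {y \<in> topspace (stop ?P'). c y \<in> Y}"
    by (simp add: Y'_def power_str_def top)
  have sub: "closed_sub ss ?P' Y'"
    unfolding closed_sub_def
  proof (intro conjI ballI)
    show "closedin (stop ?P') Y'"
      unfolding Y'eq using Y by (intro closedin_continuous_map_preimage[OF cc]) (simp add: closed_sub_def)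
  qed (use clos in blast)
  have mor1: "\<phi>' \<in> mor ss X (restr ?P' Y')"
    unfolding mor_def
  proof (intro CollectI conjI ballI)
    show "\<phi>' \<in> scar X \<rightarrow>\<^sub>E scar (restr ?P' Y')"
      using \<phi>'Y by (auto simp: restr_def \<phi>'_def)
    have c\<phi>: "continuous_map (stop X) (product_topology (\<lambda>_. stop NT) S) \<phi>"
      using m by (auto simp: mor_def restr_def power_str_def continuous_map_in_subtopology)
    have "continuous_map (stop X) (stop NT) (\<lambda>x. \<phi>' x p)" if "p \<in> k ` S" for p
    proof -
      from that obtain s where s: "s \<in> S" "p = k s" by auto
      have "continuous_map (stop X) (stop NT) (\<lambda>x. \<phi> x s)"
        using c\<phi> s(1) by (auto simp: continuous_map_componentwise)
      then show ?thesis
        by (rule continuous_map_eq) (use X s \<phi>'k in \<open>auto simp: is_struct_def\<close>)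
    qed
    moreover have "\<phi>' ` topspace (stop X) \<subseteq> extensional (k ` S)"
      using X \<phi>'P by (auto simp: is_struct_def PiE_def)
    ultimately have "continuous_map (stop X) (stop ?P') \<phi>'"
      by (simp add: power_str_def continuous_map_componentwise)
    then show "continuous_map (stop X) (stop (restr ?P' Y')) \<phi>'"
      using X \<phi>'Y by (auto simp: restr_def continuous_map_in_subtopology is_struct_def)
    fix g xs assume g: "g \<in> gsyms ss" and xs: "xs \<in> tuples (gar ss g) (scar X)"
    have gx: "sop X g xs \<in> scar X" using X g xs by (auto simp: is_struct_def)
    have e: "map c (map \<phi>' xs) = map \<phi> xs" using xs c\<phi>' by (auto simp: tuples_def)
    have t: "map \<phi>' xs \<in> tuples (gar ss g) Y'" using xs by (rule tuples_map) (rule \<phi>'Y)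
    have "c (\<phi>' (sop X g xs)) = c (sop ?P' g (map \<phi>' xs))"
      unfolding cop e using m g xs by (simp add: c\<phi>'[OF gx] mor_def restr_def)
    then show "\<phi>' (sop X g xs) = sop (restr ?P' Y') g (map \<phi>' xs)"
      using c_inj[OF \<phi>'Y[OF gx] clos[OF g t]] by (simp add: restr_def)
  next
    fix r xs assume r: "r \<in> rsyms ss" and xs: "xs \<in> srel X r"
    have "xs \<in> tuples (rar ss r) (scar X)" using X r xs unfolding is_struct_def by blast
    then have xX: "set xs \<subseteq> scar X" by (simp add: tuples_def)
    have "map \<phi> xs \<in> srel ?P r" using m r xs by (auto simp: mor_def restr_def)
    then have *: "map (\<lambda>x. \<phi> x s) xs \<in> srel NT r" if "s \<in> S" for s
      using that by (auto simp: power_str_def o_def)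
    have "map (\<lambda>x. \<phi>' x (k s)) xs = map (\<lambda>x. \<phi> x s) xs" if "s \<in> S" for s
      using that xX \<phi>'k by auto
    then have "map (\<lambda>x. \<phi>' x (k s)) xs \<in> srel NT r" if "s \<in> S" for s
      using *[OF that] that by (simp only:)
    then have "\<forall>p\<in>k ` S. map (\<lambda>y. y p) (map \<phi>' xs) \<in> srel NT r"
      by (simp add: o_def)
    moreover have "set (map \<phi>' xs) \<subseteq> Y'" using xX \<phi>'Y by auto
    moreover have "Y' \<subseteq> k ` S \<rightarrow>\<^sub>E scar NT" by (auto simp: Y'_def)
    ultimately show "map \<phi>' xs \<in> srel (restr ?P' Y') r"
      unfolding restr_def power_str_def tstruct.simps mem_Collect_eq by blast
  qed
  have mor2: "\<psi>' \<in> mor ss (restr ?P' Y') X"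
    unfolding mor_def
  proof (intro CollectI conjI ballI)
    show "\<psi>' \<in> scar (restr ?P' Y') \<rightarrow>\<^sub>E scar X"
      using \<psi> by (auto simp: restr_def \<psi>'_def mor_def Y'_def)
    have "continuous_map (stop (restr ?P' Y')) (stop (restr ?P Y)) c"
      using continuous_map_from_subtopology[OF cc]
      by (auto simp: restr_def continuous_map_in_subtopology Y'_def)
    then have "continuous_map (stop (restr ?P' Y')) (stop X) (\<psi> \<circ> c)"
      using \<psi> by (intro continuous_map_compose) (auto simp: mor_def)
    then show "continuous_map (stop (restr ?P' Y')) (stop X) \<psi>'"
      by (rule continuous_map_eq) (auto simp: \<psi>'_def restr_def)
    fix g ys assume g: "g \<in> gsyms ss" and ys: "ys \<in> tuples (gar ss g) (scar (restr ?P' Y'))"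
    then have ys: "ys \<in> tuples (gar ss g) Y'" by (simp add: restr_def)
    have "map c ys \<in> tuples (gar ss g) Y"
      using ys by (rule tuples_map) (auto simp: Y'_def)
    then have "\<psi> (sop ?P g (map c ys)) = sop X g (map \<psi> (map c ys))"
      using \<psi> g by (auto simp: mor_def restr_def)
    moreover have "map \<psi>' ys = map \<psi> (map c ys)" using ys by (auto simp: \<psi>'_def tuples_def)
    moreover have "\<psi>' (sop (restr ?P' Y') g ys) = \<psi> (sop ?P g (map c ys))"
      using clos[OF g ys] by (simp add: \<psi>'_def restr_def cop)
    ultimately show "\<psi>' (sop (restr ?P' Y') g ys) = sop X g (map \<psi>' ys)"
      by (simp only:)
  next
    fix r ys assume r: "r \<in> rsyms ss" and ys: "ys \<in> srel (restr ?P' Y') r"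
    have ys': "set ys \<subseteq> Y'" "\<forall>p\<in>k ` S. map (\<lambda>y. y p) ys \<in> srel NT r"
      using ys by (simp_all add: restr_def power_str_def)
    have "map (\<lambda>y. y s) (map c ys) \<in> srel NT r" if "s \<in> S" for s
      using ys'(2) that by (simp add: o_def c_s)
    moreover have "set (map c ys) \<subseteq> Y" using ys'(1) by (auto simp: Y'_def)
    ultimately have "map c ys \<in> srel (restr ?P Y) r"
      unfolding restr_def power_str_def tstruct.simps mem_Collect_eq using YP by blast
    then have "map \<psi> (map c ys) \<in> srel X r" using \<psi> r unfolding mor_def by blast
    moreover have "map \<psi>' ys = map \<psi> (map c ys)" using ys by (auto simp: \<psi>'_def restr_def)
    ultimately show "map \<psi>' ys \<in> srel X r" by (simp only:)
  qed
  have "\<phi>' (\<psi>' y) = y" if y: "y \<in> Y'" for y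
  proof -
    have cy: "c y \<in> Y" and \<psi>y: "\<psi>' y = \<psi> (c y)" using y by (auto simp: Y'_def \<psi>'_def)
    then have "\<psi>' y \<in> scar X" using \<psi> by (auto simp: mor_def restr_def)
    then show ?thesis using c_inj[OF \<phi>'Y y] c\<phi>' \<phi>\<psi>[OF cy] \<psi>y by simp
  qed
  moreover have "\<psi>' (\<phi>' x) = x" if "x \<in> scar X" for x
    using \<phi>'Y[OF that] c\<phi>'[OF that] \<psi>\<phi>[OF that] by (simp add: \<psi>'_def)
  ultimately have "str_iso ss X (restr ?P' Y') \<phi>'"
    unfolding str_iso_def using mor1 mor2 by (auto simp: restr_def)
  with sub show ?thesis by blast
qed

lemma IScP_I:
  fixes S :: "'s set" and X :: "('g, 'r, 'x) tstruct" and NT :: "('g, 'r, 'n) tstruct"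
  assumes X: "is_struct ss X" and NT: "is_struct ss NT" and S: "S \<noteq> {}"
    and Y: "closed_sub ss (power_str S NT) Y" and \<phi>: "str_iso ss X (restr (power_str S NT) Y) \<phi>"
  shows "X \<in> IScP ss NT"
proof -
  define k where "k = (\<lambda>s. \<lambda>x\<in>scar X. \<phi> x s)"
  have k: "\<phi> x s = \<phi> x s'" if "x \<in> scar X" "k s = k s'" for x s s'
    using that(1) fun_cong[OF that(2), of x] by (simp add: k_def)
  obtain Y' \<phi>' where "closed_sub ss (power_str (k ` S) NT) Y'"
    "str_iso ss X (restr (power_str (k ` S) NT) Y') \<phi>'"
    using reindex_power[OF X NT Y \<phi>, of k] k by metis
  moreover have "k ` S \<noteq> {}" using S by simp
  ultimately show ?thesis
    unfolding IScP_def mem_Collect_eq by (intro conjI X exI[of _ "k ` S"] exI[of _ Y'] exI[of _ \<phi>'])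
qed

definition D1 :: "'f sgn \<Rightarrow> ('f, 'n) alg \<Rightarrow> ('g, 'r, 'n) tstruct \<Rightarrow> ('f, 'a) alg \<Rightarrow> ('g, 'r, 'a \<Rightarrow> 'n) tstruct" where
  "D1 Sg N NT A = restr (power_str (carrier A) NT) (hom Sg A N)"

definition E1 :: "('f, 'n) alg \<Rightarrow> ('g, 'r) ssgn \<Rightarrow> ('g, 'r, 'n) tstruct \<Rightarrow> ('g, 'r, 'x) tstruct \<Rightarrow> ('f, 'x \<Rightarrow> 'n) alg" where
  "E1 N ss NT X = subalg (prod_alg (scar X) (\<lambda>_. N)) (mor ss X NT)"

definition eval1 :: "'f sgn \<Rightarrow> ('f, 'n) alg \<Rightarrow> ('f, 'a) alg \<Rightarrow> 'a \<Rightarrow> ('a \<Rightarrow> 'n) \<Rightarrow> 'n" where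
  "eval1 Sg N A = (\<lambda>a \<in> carrier A. \<lambda>x \<in> hom Sg A N. x a)"

definition coeval1 :: "('g, 'r) ssgn \<Rightarrow> ('g, 'r, 'n) tstruct \<Rightarrow> ('g, 'r, 'x) tstruct \<Rightarrow> 'x \<Rightarrow> ('x \<Rightarrow> 'n) \<Rightarrow> 'n" where
  "coeval1 ss NT X = (\<lambda>x \<in> scar X. \<lambda>\<alpha> \<in> mor ss X NT. \<alpha> x)"

definition yields_duality ::
    "'f sgn \<Rightarrow> ('f, 'n) alg \<Rightarrow> ('g, 'r) ssgn \<Rightarrow> ('g, 'r, 'n) tstruct \<Rightarrow> ('f, 'a) alg set \<Rightarrow> bool" where
  "yields_duality Sg N ss NT \<B> \<longleftrightarrow> alter_ego Sg N ss NT \<and>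
     (\<forall>A \<in> \<B>. alg_iso Sg A (E1 N ss NT (D1 Sg N NT A)) (eval1 Sg N A))"

definition full_duality ::
    "'f sgn \<Rightarrow> ('f, 'n) alg \<Rightarrow> ('g, 'r) ssgn \<Rightarrow> ('g, 'r, 'n) tstruct \<Rightarrow> ('f, 'a) alg set \<Rightarrow>
     ('g, 'r, 'x) tstruct set \<Rightarrow> bool" where
  "full_duality Sg N ss NT \<B> \<Y> \<longleftrightarrow> yields_duality Sg N ss NT \<B> \<and>
     (\<forall>X \<in> \<Y>. str_iso ss X (D1 Sg N NT (E1 N ss NT X)) (coeval1 ss NT X))"

definition injective_in :: "('g, 'r) ssgn \<Rightarrow> ('g, 'r, 'n) tstruct \<Rightarrow> ('g, 'r, 'x) tstruct set \<Rightarrow> bool" where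
  "injective_in ss NT \<Y> \<longleftrightarrow>
     (\<forall>X \<in> \<Y>. \<forall>Y \<in> \<Y>. \<forall>\<phi> \<psi>. str_embedding ss X Y \<phi> \<and> \<psi> \<in> mor ss X NT \<longrightarrow>
        (\<exists>\<theta> \<in> mor ss Y NT. \<forall>x \<in> scar X. \<theta> (\<phi> x) = \<psi> x))"

definition strong_duality ::
    "'f sgn \<Rightarrow> ('f, 'n) alg \<Rightarrow> ('g, 'r) ssgn \<Rightarrow> ('g, 'r, 'n) tstruct \<Rightarrow> ('f, 'a) alg set \<Rightarrow>
     ('g, 'r, 'x) tstruct set \<Rightarrow> bool" where
  "strong_duality Sg N ss NT \<B> \<Y> \<longleftrightarrow> full_duality Sg N ss NT \<B> \<Y> \<and> injective_in ss NT \<Y>"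


section \<open>Two-sorted dualities\<close>

text \<open>Both sorts have operations and relations indexed by the same symbols, and the sorts are sets
  over the same type. The disjoint union of the sorts consists of the pairs \<open>(s, x)\<close> with \<open>x\<close> in
  the sort \<open>s\<close>; the topology is one on this union.\<close>

datatype srt = S1 | S2

record ('g, 'r, 'x) tstruct2 =
  car2 :: "srt \<Rightarrow> 'x set"
  op2 :: "srt \<Rightarrow> 'g \<Rightarrow> 'x list \<Rightarrow> 'x"
  rel2 :: "srt \<Rightarrow> 'r \<Rightarrow> 'x list set"
  top2 :: "(srt \<times> 'x) topology"

definition univ2 :: "('g, 'r, 'x) tstruct2 \<Rightarrow> (srt \<times> 'x) set" where
  "univ2 X = Sigma UNIV (car2 X)"

text \<open>The sort \<open>s\<close> as a single-sorted structure; the topology is the one induced from \<open>top2\<close>.\<close>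

definition sort_of :: "('g, 'r, 'x) tstruct2 \<Rightarrow> srt \<Rightarrow> ('g, 'r, 'x) tstruct" where
  "sort_of X s = \<lparr>scar = car2 X s, sop = op2 X s, srel = rel2 X s,
     stop = pullback_topology (car2 X s) (Pair s) (top2 X)\<rparr>"

definition is_struct2 :: "('g, 'r) ssgn \<Rightarrow> ('g, 'r, 'x) tstruct2 \<Rightarrow> bool" where
  "is_struct2 ss X \<longleftrightarrow> (\<forall>s. is_struct ss (sort_of X s)) \<and>
     top2 X = sum_topology (\<lambda>s. stop (sort_of X s)) UNIV"

definition union2 :: "(srt \<Rightarrow> ('g, 'r, 'x) tstruct) \<Rightarrow> ('g, 'r, 'x) tstruct2" where
  "union2 X = \<lparr>car2 = (\<lambda>s. scar (X s)), op2 = (\<lambda>s. sop (X s)), rel2 = (\<lambda>s. srel (X s)),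
     top2 = sum_topology (\<lambda>s. stop (X s)) UNIV\<rparr>"

definition uplus :: "('g, 'r, 'x) tstruct \<Rightarrow> ('g, 'r, 'x) tstruct \<Rightarrow> ('g, 'r, 'x) tstruct2"
    (infixl \<open>\<uplus>\<close> 65) where
  "X \<uplus> Y = union2 (case_srt X Y)"

definition mor2 :: "('g, 'r) ssgn \<Rightarrow> ('g, 'r, 'x) tstruct2 \<Rightarrow> ('g, 'r, 'y) tstruct2 \<Rightarrow>
    (srt \<times> 'x \<Rightarrow> srt \<times> 'y) set" where
  "mor2 ss X Y = {\<phi> \<in> univ2 X \<rightarrow>\<^sub>E univ2 Y. (\<forall>p \<in> univ2 X. fst (\<phi> p) = fst p) \<and>
     continuous_map (top2 X) (top2 Y) \<phi> \<and>
     (\<forall>s. \<forall>g \<in> gsyms ss. \<forall>xs \<in> tuples (gar ss g) (car2 X s).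
        \<phi> (s, op2 X s g xs) = (s, op2 Y s g (map (\<lambda>x. snd (\<phi> (s, x))) xs))) \<and>
     (\<forall>s. \<forall>r \<in> rsyms ss. \<forall>xs \<in> rel2 X s r. map (\<lambda>x. snd (\<phi> (s, x))) xs \<in> rel2 Y s r)}"

definition str_iso2 :: "('g, 'r) ssgn \<Rightarrow> ('g, 'r, 'x) tstruct2 \<Rightarrow> ('g, 'r, 'y) tstruct2 \<Rightarrow>
    (srt \<times> 'x \<Rightarrow> srt \<times> 'y) \<Rightarrow> bool" where
  "str_iso2 ss X Y \<phi> \<longleftrightarrow> \<phi> \<in> mor2 ss X Y \<and>
     (\<exists>\<psi> \<in> mor2 ss Y X. (\<forall>p \<in> univ2 X. \<psi> (\<phi> p) = p) \<and> (\<forall>q \<in> univ2 Y. \<phi> (\<psi> q) = q))"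

definition power_str2 :: "'s set \<Rightarrow> ('g, 'r, 'x) tstruct2 \<Rightarrow> ('g, 'r, 's \<Rightarrow> 'x) tstruct2" where
  "power_str2 S X = union2 (\<lambda>s. power_str S (sort_of X s))"

definition closed_sub2 :: "('g, 'r) ssgn \<Rightarrow> ('g, 'r, 'x) tstruct2 \<Rightarrow> (srt \<Rightarrow> 'x set) \<Rightarrow> bool" where
  "closed_sub2 ss X Y \<longleftrightarrow> closedin (top2 X) (Sigma UNIV Y) \<and>
     (\<forall>s. \<forall>g \<in> gsyms ss. \<forall>xs \<in> tuples (gar ss g) (Y s). op2 X s g xs \<in> Y s)"

definition restr2 :: "('g, 'r, 'x) tstruct2 \<Rightarrow> (srt \<Rightarrow> 'x set) \<Rightarrow> ('g, 'r, 'x) tstruct2" where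
  "restr2 X Y = \<lparr>car2 = Y, op2 = op2 X, rel2 = (\<lambda>s r. {xs \<in> rel2 X s r. set xs \<subseteq> Y s}),
     top2 = subtopology (top2 X) (Sigma UNIV Y)\<rparr>"

definition str_embedding2 :: "('g, 'r) ssgn \<Rightarrow> ('g, 'r, 'x) tstruct2 \<Rightarrow> ('g, 'r, 'y) tstruct2 \<Rightarrow>
    (srt \<times> 'x \<Rightarrow> srt \<times> 'y) \<Rightarrow> bool" where
  "str_embedding2 ss X Y \<phi> \<longleftrightarrow> (let Z = (\<lambda>s. {y. (s, y) \<in> \<phi> ` univ2 X}) in
     closed_sub2 ss Y Z \<and> str_iso2 ss X (restr2 Y Z) \<phi>)"

text \<open>A two-sorted alter ego of \<open>M S1, M S2\<close>: as every operation and relation lives on a single sort,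
  this is a condition on each sort.\<close>

definition alter_ego2 :: "'f sgn \<Rightarrow> (srt \<Rightarrow> ('f, 'm) alg) \<Rightarrow> ('g, 'r) ssgn \<Rightarrow> ('g, 'r, 'm) tstruct2 \<Rightarrow> bool" where
  "alter_ego2 Sg M ss MT \<longleftrightarrow> is_struct2 ss MT \<and> (\<forall>s. alter_ego Sg (M s) ss (sort_of MT s))"

definition IScP2 :: "('g, 'r) ssgn \<Rightarrow> ('g, 'r, 'm) tstruct2 \<Rightarrow> ('g, 'r, 'x) tstruct2 set" where
  "IScP2 ss MT = {X. is_struct2 ss X \<and>
     (\<exists>(S :: (srt \<times> 'x \<Rightarrow> srt \<times> 'm) set) Y \<phi>. S \<noteq> {} \<and> closed_sub2 ss (power_str2 S MT) Y \<and>
        str_iso2 ss X (restr2 (power_str2 S MT) Y) \<phi>)}"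

lemma sort_of_union2:
  assumes "\<And>s. topspace (stop (X s)) = scar (X s)"
  shows "sort_of (union2 X) s = X s"
proof -
  have "pullback_topology (scar (X s)) (Pair s) (sum_topology (\<lambda>s. stop (X s)) UNIV) = stop (X s)"
    unfolding topology_eq
  proof (intro allI iffI)
    fix U assume "openin (pullback_topology (scar (X s)) (Pair s) (sum_topology (\<lambda>s. stop (X s)) UNIV)) U"
    then obtain V where V: "openin (sum_topology (\<lambda>s. stop (X s)) UNIV) V" "U = Pair s -` V \<inter> scar (X s)"
      unfolding openin_pullback_topology by blast
    from V(1) have "openin (stop (X s)) {x. (s, x) \<in> V}" by (simp add: openin_sum_topology)
    moreover from this have "U = {x. (s, x) \<in> V}"
      using V(2) openin_subset[of "stop (X s)"] assms by fastforce
    ultimately show "openin (stop (X s)) U" by simp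
  next
    fix U assume U: "openin (stop (X s)) U"
    then have "U \<subseteq> scar (X s)" using openin_subset assms by metis
    then have "U = Pair s -` (Pair s ` U) \<inter> scar (X s)" by auto
    moreover have "openin (sum_topology (\<lambda>s. stop (X s)) UNIV) (Pair s ` U)"
      using open_map_component_injection[of s UNIV "\<lambda>s. stop (X s)"] U by (simp add: open_map_def)
    ultimately show "openin (pullback_topology (scar (X s)) (Pair s) (sum_topology (\<lambda>s. stop (X s)) UNIV)) U"
      unfolding openin_pullback_topology by blast
  qed
  then show ?thesis by (simp add: sort_of_def union2_def)
qed

lemma is_struct_topspace: "is_struct ss X \<Longrightarrow> topspace (stop X) = scar X"
  by (simp add: is_struct_def)

lemma is_struct2_sorts: "is_struct2 ss X \<Longrightarrow> union2 (sort_of X) = X" "is_struct2 ss X \<Longrightarrow> is_struct ss (sort_of X s)"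
  by (simp_all add: is_struct2_def union2_def sort_of_def)

lemma univ2_union2: "univ2 (union2 X) = (SIGMA s:UNIV. scar (X s))"
  by (simp add: univ2_def union2_def)

lemma mor2D:
  assumes "\<phi> \<in> mor2 ss X Y" "x \<in> car2 X s"
  shows "\<phi> (s, x) = (s, snd (\<phi> (s, x)))" "snd (\<phi> (s, x)) \<in> car2 Y s"
proof -
  have p: "(s, x) \<in> univ2 X" using assms(2) by (simp add: univ2_def)
  have "\<phi> (s, x) \<in> univ2 Y" using assms(1) p by (auto simp: mor2_def)
  moreover have f: "fst (\<phi> (s, x)) = s" using assms(1) p by (fastforce simp: mor2_def)
  ultimately show "snd (\<phi> (s, x)) \<in> car2 Y s" by (auto simp: univ2_def)
  show "\<phi> (s, x) = (s, snd (\<phi> (s, x)))" using f by (simp add: prod_eq_iff)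
qed

lemma mor2_component:
  assumes X: "\<And>s. is_struct ss (X s)" and Y: "\<And>s. is_struct ss (Y s)"
    and \<phi>: "\<phi> \<in> mor2 ss (union2 X) (union2 Y)"
  shows "(\<lambda>x\<in>scar (X s). snd (\<phi> (s, x))) \<in> mor ss (X s) (Y s)"
proof -
  define f where "f = (\<lambda>x\<in>scar (X s). snd (\<phi> (s, x)))"
  have tag: "\<phi> (s, x) = (s, f x)" and mem: "f x \<in> scar (Y s)" if "x \<in> scar (X s)" for x
  proof -
    have c: "x \<in> car2 (union2 X) s" using that by (simp add: union2_def)
    have e: "f x = snd (\<phi> (s, x))" using that by (simp add: f_def)
    show "\<phi> (s, x) = (s, f x)" unfolding e by (rule mor2D(1)[OF \<phi> c])
    show "f x \<in> scar (Y s)" unfolding e using mor2D(2)[OF \<phi> c] by (simp add: union2_def)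
  qed
  have "continuous_map (stop (X s)) (top2 (union2 Y)) (\<phi> \<circ> Pair s)"
    using \<phi> continuous_map_component_injection[of s UNIV "\<lambda>s. stop (X s)"]
    by (intro continuous_map_compose) (auto simp: mor2_def union2_def)
  then have c: "continuous_map (stop (X s)) (top2 (union2 Y)) (\<lambda>x. (s, f x))"
    by (rule continuous_map_eq) (use tag is_struct_topspace[OF X] in auto)
  have "continuous_map (stop (X s)) (stop (Y s)) f"
    unfolding continuous_map_def
  proof (intro conjI allI impI)
    show "f \<in> topspace (stop (X s)) \<rightarrow> topspace (stop (Y s))"
      using mem is_struct_topspace[OF X] is_struct_topspace[OF Y] by auto
    fix U assume U: "openin (stop (Y s)) U"
    have "openin (top2 (union2 Y)) (Pair s ` U)"
      using open_map_component_injection[of s UNIV "\<lambda>s. stop (Y s)"] U by (simp add: open_map_def union2_def)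
    then have "openin (stop (X s)) {x \<in> topspace (stop (X s)). (s, f x) \<in> Pair s ` U}"
      using c by (rule openin_continuous_map_preimage[rotated])
    moreover have "{x \<in> topspace (stop (X s)). (s, f x) \<in> Pair s ` U} = {x \<in> topspace (stop (X s)). f x \<in> U}"
      by blast
    ultimately show "openin (stop (X s)) {x \<in> topspace (stop (X s)). f x \<in> U}" by simp
  qed
  moreover have "f (sop (X s) g xs) = sop (Y s) g (map f xs)"
    if g: "g \<in> gsyms ss" and xs: "xs \<in> tuples (gar ss g) (scar (X s))" for g xs
  proof -
    have "sop (X s) g xs \<in> scar (X s)" using X g xs by (auto simp: is_struct_def)
    moreover have "\<phi> (s, sop (X s) g xs) = (s, sop (Y s) g (map (\<lambda>x. snd (\<phi> (s, x))) xs))"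
      using \<phi> g xs by (auto simp: mor2_def union2_def)
    moreover have "map (\<lambda>x. snd (\<phi> (s, x))) xs = map f xs" using tuplesD[OF xs] by (simp add: f_def)
    ultimately show ?thesis using tag by simp
  qed
  moreover have "map f xs \<in> srel (Y s) r" if r: "r \<in> rsyms ss" and xs: "xs \<in> srel (X s) r" for r xs
  proof -
    have "map (\<lambda>x. snd (\<phi> (s, x))) xs \<in> srel (Y s) r"
      using \<phi> r xs by (auto simp: mor2_def union2_def)
    moreover have "xs \<in> tuples (rar ss r) (scar (X s))" using X r xs unfolding is_struct_def by blast
    note tuplesD[OF this]
    then have "map (\<lambda>x. snd (\<phi> (s, x))) xs = map f xs" by (simp add: f_def)
    ultimately show ?thesis by simp
  qed
  moreover have "f \<in> scar (X s) \<rightarrow>\<^sub>E scar (Y s)" using mem by (auto simp: f_def)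
  ultimately have "f \<in> mor ss (X s) (Y s)" by (simp add: mor_def)
  then show ?thesis by (simp add: f_def)
qed

lemma mor2_glue:
  assumes X: "\<And>s. is_struct ss (X s)" and Y: "\<And>s. is_struct ss (Y s)"
    and f: "\<And>s. f s \<in> mor ss (X s) (Y s)"
  shows "(\<lambda>(s, x)\<in>univ2 (union2 X). (s, f s x)) \<in> mor2 ss (union2 X) (union2 Y)"
    (is "?\<phi> \<in> _")
proof -
  have val: "?\<phi> (s, x) = (s, f s x)" if "x \<in> scar (X s)" for s x
    using that by (simp add: univ2_union2)
  have mem: "f s x \<in> scar (Y s)" if "x \<in> scar (X s)" for s x
    using f[of s] that by (auto simp: mor_def)
  have "continuous_map (top2 (union2 X)) (top2 (union2 Y)) ?\<phi>"
    unfolding continuous_map_def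
  proof (intro conjI allI impI)
    show "?\<phi> \<in> topspace (top2 (union2 X)) \<rightarrow> topspace (top2 (union2 Y))"
      using mem is_struct_topspace[OF X] is_struct_topspace[OF Y]
      by (auto simp: union2_def univ2_def)
    fix U assume U: "openin (top2 (union2 Y)) U"
    have "openin (stop (X s)) {x \<in> topspace (stop (X s)). f s x \<in> {y. (s, y) \<in> U}}" for s
      using f[of s] U
      by (intro openin_continuous_map_preimage) (auto simp: mor_def union2_def openin_sum_topology)
    moreover have "{x. (s, x) \<in> {p \<in> topspace (top2 (union2 X)). ?\<phi> p \<in> U}} =
        {x \<in> topspace (stop (X s)). f s x \<in> {y. (s, y) \<in> U}}" for s
      using is_struct_topspace[OF X] by (auto simp: union2_def univ2_def)
    ultimately show "openin (top2 (union2 X)) {p \<in> topspace (top2 (union2 X)). ?\<phi> p \<in> U}"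
      by (subst union2_def, simp add: openin_sum_topology) (auto simp: union2_def)
  qed
  moreover have "?\<phi> (s, sop (X s) g xs) = (s, sop (Y s) g (map (\<lambda>x. snd (?\<phi> (s, x))) xs))"
    if g: "g \<in> gsyms ss" and xs: "xs \<in> tuples (gar ss g) (scar (X s))" for s g xs
  proof -
    have "sop (X s) g xs \<in> scar (X s)" using X g xs by (auto simp: is_struct_def)
    then have "?\<phi> (s, sop (X s) g xs) = (s, f s (sop (X s) g xs))" by (rule val)
    moreover have "f s (sop (X s) g xs) = sop (Y s) g (map (f s) xs)"
      using f[of s] g xs by (auto simp: mor_def)
    moreover have "map (\<lambda>x. snd (?\<phi> (s, x))) xs = map (f s) xs"
      using tuplesD[OF xs] val by (intro map_cong) auto
    ultimately show ?thesis by (simp only:)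
  qed
  moreover have "map (\<lambda>x. snd (?\<phi> (s, x))) xs \<in> srel (Y s) r"
    if r: "r \<in> rsyms ss" and xs: "xs \<in> srel (X s) r" for s r xs
  proof -
    have "map (f s) xs \<in> srel (Y s) r" using f[of s] r xs by (auto simp: mor_def)
    moreover have "xs \<in> tuples (rar ss r) (scar (X s))" using X r xs unfolding is_struct_def by blast
    note tuplesD[OF this]
    then have "map (\<lambda>x. snd (?\<phi> (s, x))) xs = map (f s) xs"
      using val by (intro map_cong) auto
    ultimately show ?thesis by (simp only:)
  qed
  moreover have "?\<phi> \<in> univ2 (union2 X) \<rightarrow>\<^sub>E univ2 (union2 Y)"
    using mem by (auto simp: univ2_union2)
  ultimately show ?thesis
    unfolding mor2_def by (auto simp: union2_def univ2_def)
qed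

lemma str_iso2_component:
  assumes X: "\<And>s. is_struct ss (X s)" and Y: "\<And>s. is_struct ss (Y s)"
    and \<phi>: "str_iso2 ss (union2 X) (union2 Y) \<phi>"
  shows "str_iso ss (X s) (Y s) (\<lambda>x\<in>scar (X s). snd (\<phi> (s, x)))"
proof -
  from \<phi> obtain \<psi> where m: "\<phi> \<in> mor2 ss (union2 X) (union2 Y)" "\<psi> \<in> mor2 ss (union2 Y) (union2 X)"
    and i: "\<And>p. p \<in> univ2 (union2 X) \<Longrightarrow> \<psi> (\<phi> p) = p" "\<And>q. q \<in> univ2 (union2 Y) \<Longrightarrow> \<phi> (\<psi> q) = q"
    by (auto simp: str_iso2_def)
  have t1: "\<phi> (s, x) = (s, snd (\<phi> (s, x)))" "snd (\<phi> (s, x)) \<in> scar (Y s)" if "x \<in> scar (X s)" for x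
    using mor2D[OF m(1), of x s] that by (simp_all add: union2_def)
  have t2: "\<psi> (s, x) = (s, snd (\<psi> (s, x)))" "snd (\<psi> (s, x)) \<in> scar (X s)" if "x \<in> scar (Y s)" for x
    using mor2D[OF m(2), of x s] that by (simp_all add: union2_def)
  have "snd (\<psi> (s, snd (\<phi> (s, x)))) = x" if "x \<in> scar (X s)" for x
    using i(1)[of "(s, x)"] t1[OF that] that by (simp add: univ2_union2)
  moreover have "snd (\<phi> (s, snd (\<psi> (s, x)))) = x" if "x \<in> scar (Y s)" for x
    using i(2)[of "(s, x)"] t2[OF that] that by (simp add: univ2_union2)
  ultimately show ?thesis
    unfolding str_iso_def
    using mor2_component[OF X Y m(1), of s] t1(2) t2(2)
    by (auto intro!: bexI[OF _ mor2_component[OF Y X m(2), of s]])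
qed

lemma str_iso2_glue:
  assumes X: "\<And>s. is_struct ss (X s)" and Y: "\<And>s. is_struct ss (Y s)"
    and f: "\<And>s. str_iso ss (X s) (Y s) (f s)"
  shows "str_iso2 ss (union2 X) (union2 Y) (\<lambda>(s, x)\<in>univ2 (union2 X). (s, f s x))"
proof -
  have "\<exists>h\<in>mor ss (Y s) (X s). (\<forall>x\<in>scar (X s). h (f s x) = x) \<and> (\<forall>y\<in>scar (Y s). f s (h y) = y)" for s
    using f[of s] by (simp add: str_iso_def)
  then obtain h where h: "\<And>s. h s \<in> mor ss (Y s) (X s)"
    "\<And>s x. x \<in> scar (X s) \<Longrightarrow> h s (f s x) = x" "\<And>s y. y \<in> scar (Y s) \<Longrightarrow> f s (h s y) = y"
    by metis
  have fm: "f s \<in> mor ss (X s) (Y s)" for s using f by (simp add: str_iso_def)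
  have m: "f s x \<in> scar (Y s)" if "x \<in> scar (X s)" for s x using fm[of s] that by (auto simp: mor_def)
  have n: "h s x \<in> scar (X s)" if "x \<in> scar (Y s)" for s x using h(1)[of s] that by (auto simp: mor_def)
  show ?thesis
    unfolding str_iso2_def
    using h(2,3) m n
    by (auto simp: univ2_union2 intro!: mor2_glue[OF X Y fm, unfolded univ2_union2]
        bexI[OF _ mor2_glue[OF Y X h(1), unfolded univ2_union2]])
qed

lemma is_struct_power:
  assumes X: "is_struct ss X" and Y: "closed_sub ss (power_str S X) Y" and r: "S \<noteq> {}"
  shows "is_struct ss (restr (power_str S X) Y)"
proof -
  obtain i where i: "i \<in> S" using r by blast
  have "topspace (subtopology (stop (power_str S X)) Y) = Y"
    using Y closedin_subset by (fastforce simp: closed_sub_def)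
  moreover have "length xs = rar ss q" if "q \<in> rsyms ss" "xs \<in> srel (power_str S X) q" for q xs
  proof -
    have "map (\<lambda>x. x i) xs \<in> srel X q" using that i by (simp add: power_str_def)
    then have "map (\<lambda>x. x i) xs \<in> tuples (rar ss q) (scar X)" using X that(1) unfolding is_struct_def by blast
    then show ?thesis by (simp add: tuples_def)
  qed
  ultimately show ?thesis
    using Y by (auto simp: is_struct_def restr_def closed_sub_def tuples_def)
qed

lemma closed_sub2_union2: "closed_sub2 ss (union2 X) Y \<longleftrightarrow> (\<forall>s. closed_sub ss (X s) (Y s))"
proof -
  have "Sigma UNIV Y \<subseteq> (SIGMA s:UNIV. topspace (stop (X s))) \<longleftrightarrow> (\<forall>s. Y s \<subseteq> topspace (stop (X s)))"
    by auto
  then show ?thesis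
    using closedin_subset by (fastforce simp: closed_sub2_def closed_sub_def union2_def closedin_sum_topology)
qed

lemma restr2_union2: "restr2 (union2 X) Y = union2 (\<lambda>s. restr (X s) (Y s))"
  by (simp add: restr2_def restr_def union2_def subtopology_sum_topology)

lemma IScP2_I:
  fixes S :: "'s set" and X :: "('g, 'r, 'x) tstruct2" and MT :: "('g, 'r, 'm) tstruct2"
  assumes X: "is_struct2 ss X" and MT: "is_struct2 ss MT" and S: "S \<noteq> {}"
    and Y: "closed_sub2 ss (power_str2 S MT) Y" and \<phi>: "str_iso2 ss X (restr2 (power_str2 S MT) Y) \<phi>"
  shows "X \<in> IScP2 ss MT"
proof -
  note Xs = is_struct2_sorts(2)[OF X] and MTs = is_struct2_sorts(2)[OF MT]
  have Ys: "closed_sub ss (power_str S (sort_of MT s)) (Y s)" for s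
    using Y by (simp add: power_str2_def closed_sub2_union2)
  define \<phi>s where "\<phi>s = (\<lambda>s. \<lambda>x\<in>scar (sort_of X s). snd (\<phi> (s, x)))"
  have iso: "str_iso ss (sort_of X s) (restr (power_str S (sort_of MT s)) (Y s)) (\<phi>s s)" for s
    unfolding \<phi>s_def
    by (rule str_iso2_component)
      (use \<phi> in \<open>simp_all add: Xs is_struct_power[OF MTs Ys S] is_struct2_sorts(1)[OF X] power_str2_def restr2_union2\<close>)
  define k where "k = (\<lambda>i. \<lambda>(s, x)\<in>univ2 X. (s, \<phi>s s x i))"
  have k: "\<phi>s s x i = \<phi>s s x j" if "x \<in> scar (sort_of X s)" "k i = k j" for s x i j
    using that(1) fun_cong[OF that(2), of "(s, x)"] by (simp add: k_def univ2_def sort_of_def)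
  have "\<forall>s. \<exists>Y' \<phi>'. closed_sub ss (power_str (k ` S) (sort_of MT s)) Y' \<and>
      str_iso ss (sort_of X s) (restr (power_str (k ` S) (sort_of MT s)) Y') \<phi>'"
    by (intro allI reindex_power[OF Xs MTs Ys iso]) (rule k)
  then obtain Y' \<phi>' where Y': "\<And>s. closed_sub ss (power_str (k ` S) (sort_of MT s)) (Y' s)"
    and iso': "\<And>s. str_iso ss (sort_of X s) (restr (power_str (k ` S) (sort_of MT s)) (Y' s)) (\<phi>' s)"
    by metis
  have kS: "k ` S \<noteq> {}" using S by simp
  have "closed_sub2 ss (power_str2 (k ` S) MT) Y'"
    using Y' by (simp add: power_str2_def closed_sub2_union2)
  moreover have "\<exists>\<phi>''. str_iso2 ss X (restr2 (power_str2 (k ` S) MT) Y') \<phi>''"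
    using str_iso2_glue[where X = "sort_of X" and Y = "\<lambda>s. restr (power_str (k ` S) (sort_of MT s)) (Y' s)" and f = \<phi>',
        OF Xs is_struct_power[OF MTs Y' kS] iso']
    by (auto simp: is_struct2_sorts(1)[OF X] power_str2_def restr2_union2)
  then obtain \<phi>'' where "str_iso2 ss X (restr2 (power_str2 (k ` S) MT) Y') \<phi>''" ..
  ultimately show ?thesis
    unfolding IScP2_def mem_Collect_eq by (intro conjI X kS exI[of _ "k ` S"] exI[of _ Y'] exI[of _ \<phi>''])
qed

definition D2 :: "'f sgn \<Rightarrow> (srt \<Rightarrow> ('f, 'm) alg) \<Rightarrow> ('g, 'r, 'm) tstruct2 \<Rightarrow> ('f, 'a) alg \<Rightarrow>
    ('g, 'r, 'a \<Rightarrow> 'm) tstruct2" where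
  "D2 Sg M MT A = restr2 (power_str2 (carrier A) MT) (\<lambda>s. hom Sg A (M s))"

text \<open>The algebra on the set of morphisms into \<open>MT\<close>, with pointwise operations. A sort-preserving map
  \<open>\<alpha>\<close> into \<open>MT\<close> is an element of \<open>\<^bold>M\<^sub>1\<^bsup>X\<^sub>1\<^esup> \<times> \<^bold>M\<^sub>2\<^bsup>X\<^sub>2\<^esup>\<close> whose values carry their sort as a tag.\<close>

definition E2 :: "(srt \<Rightarrow> ('f, 'm) alg) \<Rightarrow> ('g, 'r) ssgn \<Rightarrow> ('g, 'r, 'm) tstruct2 \<Rightarrow> ('g, 'r, 'x) tstruct2 \<Rightarrow>
    ('f, srt \<times> 'x \<Rightarrow> srt \<times> 'm) alg" where
  "E2 M ss MT X = \<lparr>carrier = mor2 ss X MT,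
     oper = (\<lambda>f \<alpha>s. \<lambda>p \<in> univ2 X. (fst p, oper (M (fst p)) f (map (\<lambda>\<alpha>. snd (\<alpha> p)) \<alpha>s)))\<rparr>"

definition eval2 :: "'f sgn \<Rightarrow> (srt \<Rightarrow> ('f, 'm) alg) \<Rightarrow> ('f, 'a) alg \<Rightarrow> 'a \<Rightarrow> srt \<times> ('a \<Rightarrow> 'm) \<Rightarrow> srt \<times> 'm" where
  "eval2 Sg M A = (\<lambda>a \<in> carrier A. \<lambda>(s, x) \<in> Sigma UNIV (\<lambda>s. hom Sg A (M s)). (s, x a))"

definition coeval2 :: "('g, 'r) ssgn \<Rightarrow> ('g, 'r, 'm) tstruct2 \<Rightarrow> ('g, 'r, 'x) tstruct2 \<Rightarrow>
    srt \<times> 'x \<Rightarrow> srt \<times> ((srt \<times> 'x \<Rightarrow> srt \<times> 'm) \<Rightarrow> 'm)" where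
  "coeval2 ss MT X = (\<lambda>p \<in> univ2 X. (fst p, \<lambda>\<alpha> \<in> mor2 ss X MT. snd (\<alpha> p)))"

definition yields_duality2 :: "'f sgn \<Rightarrow> (srt \<Rightarrow> ('f, 'm) alg) \<Rightarrow> ('g, 'r) ssgn \<Rightarrow>
    ('g, 'r, 'm) tstruct2 \<Rightarrow> ('f, 'a) alg set \<Rightarrow> bool" where
  "yields_duality2 Sg M ss MT \<A> \<longleftrightarrow> alter_ego2 Sg M ss MT \<and>
     (\<forall>A \<in> \<A>. alg_iso Sg A (E2 M ss MT (D2 Sg M MT A)) (eval2 Sg M A))"

definition full_duality2 :: "'f sgn \<Rightarrow> (srt \<Rightarrow> ('f, 'm) alg) \<Rightarrow> ('g, 'r) ssgn \<Rightarrow>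
    ('g, 'r, 'm) tstruct2 \<Rightarrow> ('f, 'a) alg set \<Rightarrow> ('g, 'r, 'x) tstruct2 set \<Rightarrow> bool" where
  "full_duality2 Sg M ss MT \<A> \<X> \<longleftrightarrow> yields_duality2 Sg M ss MT \<A> \<and>
     (\<forall>X \<in> \<X>. str_iso2 ss X (D2 Sg M MT (E2 M ss MT X)) (coeval2 ss MT X))"

definition injective_in2 :: "('g, 'r) ssgn \<Rightarrow> ('g, 'r, 'm) tstruct2 \<Rightarrow> ('g, 'r, 'x) tstruct2 set \<Rightarrow> bool" where
  "injective_in2 ss MT \<X> \<longleftrightarrow>
     (\<forall>X \<in> \<X>. \<forall>Y \<in> \<X>. \<forall>\<phi> \<psi>. str_embedding2 ss X Y \<phi> \<and> \<psi> \<in> mor2 ss X MT \<longrightarrow>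
        (\<exists>\<theta> \<in> mor2 ss Y MT. \<forall>p \<in> univ2 X. \<theta> (\<phi> p) = \<psi> p))"

definition strong_duality2 :: "'f sgn \<Rightarrow> (srt \<Rightarrow> ('f, 'm) alg) \<Rightarrow> ('g, 'r) ssgn \<Rightarrow>
    ('g, 'r, 'm) tstruct2 \<Rightarrow> ('f, 'a) alg set \<Rightarrow> ('g, 'r, 'x) tstruct2 set \<Rightarrow> bool" where
  "strong_duality2 Sg M ss MT \<A> \<X> \<longleftrightarrow> full_duality2 Sg M ss MT \<A> \<X> \<and> injective_in2 ss MT \<X>"

text \<open>The structure transported along an injective map.\<close>

definition transport :: "('x \<Rightarrow> 'y) \<Rightarrow> ('g, 'r, 'x) tstruct \<Rightarrow> ('g, 'r, 'y) tstruct" where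
  "transport h X = (let k = inv_into (scar X) h in
     \<lparr>scar = h ` scar X, sop = (\<lambda>g ys. h (sop X g (map k ys))), srel = (\<lambda>r. map h ` srel X r),
      stop = pullback_topology (h ` scar X) k (stop X)\<rparr>)"

text \<open>The two algebras \<open>\<^bold>N \<odot> \<^bold>T\<close> and \<open>\<^bold>T \<odot> \<^bold>N\<close>, and the structure \<open>NT \<uplus> NT\<close> based on the copies
  \<open>N \<times> T\<close> and \<open>T \<times> N\<close> of \<open>N\<close>.\<close>

definition Malg :: "('f gpair \<Rightarrow> 'f trm) \<Rightarrow> ('f gpair \<Rightarrow> 'f trm) \<Rightarrow> ('f, 'n) alg \<Rightarrow> ('f, 'n) alg \<Rightarrow>
    srt \<Rightarrow> ('f gpair, 'n \<times> 'n) alg" where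
  "Malg r1 r2 N T = case_srt (odot r1 r2 N T) (odot r1 r2 T N)"

definition Mstr :: "('f, 'n) alg \<Rightarrow> ('g, 'r, 'n) tstruct \<Rightarrow> ('g, 'r, 'n \<times> 'n) tstruct2" where
  "Mstr T NT = (let c = the_elem (carrier T) in
     transport (\<lambda>a. (a, c)) NT \<uplus> transport (\<lambda>a. (c, a)) NT)"


section \<open>Categories\<close>

record ('o, 'm) cat =
  Ob :: "'o set"
  Ar :: "'o \<Rightarrow> 'o \<Rightarrow> 'm set"
  Cmp :: "'o \<Rightarrow> 'o \<Rightarrow> 'o \<Rightarrow> 'm \<Rightarrow> 'm \<Rightarrow> 'm"
  Idn :: "'o \<Rightarrow> 'm"

text \<open>\<open>Cmp C X Y Z g f\<close> is the composite of \<open>f : X \<rightarrow> Y\<close> and \<open>g : Y \<rightarrow> Z\<close>.\<close>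

definition category :: "('o, 'm) cat \<Rightarrow> bool" where
  "category C \<longleftrightarrow>
     (\<forall>X \<in> Ob C. Idn C X \<in> Ar C X X) \<and>
     (\<forall>X \<in> Ob C. \<forall>Y \<in> Ob C. \<forall>Z \<in> Ob C. \<forall>f \<in> Ar C X Y. \<forall>g \<in> Ar C Y Z. Cmp C X Y Z g f \<in> Ar C X Z) \<and>
     (\<forall>X \<in> Ob C. \<forall>Y \<in> Ob C. \<forall>f \<in> Ar C X Y.
        Cmp C X X Y f (Idn C X) = f \<and> Cmp C X Y Y (Idn C Y) f = f) \<and>
     (\<forall>W \<in> Ob C. \<forall>X \<in> Ob C. \<forall>Y \<in> Ob C. \<forall>Z \<in> Ob C.
        \<forall>f \<in> Ar C W X. \<forall>g \<in> Ar C X Y. \<forall>h \<in> Ar C Y Z.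
          Cmp C W Y Z h (Cmp C W X Y g f) = Cmp C W X Z (Cmp C X Y Z h g) f)"

definition functor_between :: "('o, 'm) cat \<Rightarrow> ('p, 'n) cat \<Rightarrow> ('o \<Rightarrow> 'p) \<Rightarrow> ('o \<Rightarrow> 'o \<Rightarrow> 'm \<Rightarrow> 'n) \<Rightarrow> bool" where
  "functor_between C D F \<Phi> \<longleftrightarrow>
     (\<forall>X \<in> Ob C. F X \<in> Ob D \<and> \<Phi> X X (Idn C X) = Idn D (F X)) \<and>
     (\<forall>X \<in> Ob C. \<forall>Y \<in> Ob C. \<forall>f \<in> Ar C X Y. \<Phi> X Y f \<in> Ar D (F X) (F Y)) \<and>
     (\<forall>X \<in> Ob C. \<forall>Y \<in> Ob C. \<forall>Z \<in> Ob C. \<forall>f \<in> Ar C X Y. \<forall>g \<in> Ar C Y Z.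
        \<Phi> X Z (Cmp C X Y Z g f) = Cmp D (F X) (F Y) (F Z) (\<Phi> Y Z g) (\<Phi> X Y f))"

definition iso_arrows :: "('o, 'm) cat \<Rightarrow> 'o \<Rightarrow> 'o \<Rightarrow> 'm set" where
  "iso_arrows C X Y = {f \<in> Ar C X Y. \<exists>g \<in> Ar C Y X. Cmp C X Y X g f = Idn C X \<and> Cmp C Y X Y f g = Idn C Y}"

definition natural_iso :: "('o, 'm) cat \<Rightarrow> ('p, 'n) cat \<Rightarrow> ('o \<Rightarrow> 'p) \<Rightarrow> ('o \<Rightarrow> 'o \<Rightarrow> 'm \<Rightarrow> 'n) \<Rightarrow>
    ('o \<Rightarrow> 'p) \<Rightarrow> ('o \<Rightarrow> 'o \<Rightarrow> 'm \<Rightarrow> 'n) \<Rightarrow> ('o \<Rightarrow> 'n) \<Rightarrow> bool" where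
  "natural_iso C D F \<Phi> G \<Psi> \<eta> \<longleftrightarrow> (\<forall>X \<in> Ob C. \<eta> X \<in> iso_arrows D (F X) (G X)) \<and>
     (\<forall>X \<in> Ob C. \<forall>Y \<in> Ob C. \<forall>f \<in> Ar C X Y.
        Cmp D (F X) (F Y) (G Y) (\<eta> Y) (\<Phi> X Y f) = Cmp D (F X) (G X) (G Y) (\<Psi> X Y f) (\<eta> X))"

definition cat_equivalence :: "('o, 'm) cat \<Rightarrow> ('p, 'n) cat \<Rightarrow> ('o \<Rightarrow> 'p) \<Rightarrow> ('o \<Rightarrow> 'o \<Rightarrow> 'm \<Rightarrow> 'n) \<Rightarrow> bool" where
  "cat_equivalence C D F \<Phi> \<longleftrightarrow> category C \<and> category D \<and> functor_between C D F \<Phi> \<and>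
     (\<exists>G \<Psi> \<eta> \<epsilon>. functor_between D C G \<Psi> \<and>
        natural_iso C C (\<lambda>X. X) (\<lambda>X Y f. f) (\<lambda>X. G (F X)) (\<lambda>X Y f. \<Psi> (F X) (F Y) (\<Phi> X Y f)) \<eta> \<and>
        natural_iso D D (\<lambda>X. F (G X)) (\<lambda>X Y f. \<Phi> (G X) (G Y) (\<Psi> X Y f)) (\<lambda>X. X) (\<lambda>X Y f. f) \<epsilon>)"

definition prod_cat :: "('o, 'm) cat \<Rightarrow> ('p, 'n) cat \<Rightarrow> ('o \<times> 'p, 'm \<times> 'n) cat" where
  "prod_cat C D = \<lparr>Ob = Ob C \<times> Ob D,
     Ar = (\<lambda>(X, X') (Y, Y'). Ar C X Y \<times> Ar D X' Y'),
     Cmp = (\<lambda>(X, X') (Y, Y') (Z, Z') (g, g') (f, f'). (Cmp C X Y Z g f, Cmp D X' Y' Z' g' f')),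
     Idn = (\<lambda>(X, X'). (Idn C X, Idn D X'))\<rparr>"

definition str_cat :: "('g, 'r) ssgn \<Rightarrow> ('g, 'r, 'x) tstruct set \<Rightarrow> (('g, 'r, 'x) tstruct, 'x \<Rightarrow> 'x) cat" where
  "str_cat ss \<Y> = \<lparr>Ob = \<Y>, Ar = mor ss, Cmp = (\<lambda>X Y Z g f. compose (scar X) g f),
     Idn = (\<lambda>X. \<lambda>x \<in> scar X. x)\<rparr>"

definition str_cat2 :: "('g, 'r) ssgn \<Rightarrow> ('g, 'r, 'x) tstruct2 set \<Rightarrow>
    (('g, 'r, 'x) tstruct2, srt \<times> 'x \<Rightarrow> srt \<times> 'x) cat" where
  "str_cat2 ss \<X> = \<lparr>Ob = \<X>, Ar = mor2 ss, Cmp = (\<lambda>X Y Z g f. compose (univ2 X) g f),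
     Idn = (\<lambda>X. \<lambda>p \<in> univ2 X. p)\<rparr>"

definition uplus_map :: "('g, 'r, 'x) tstruct \<times> ('g, 'r, 'x) tstruct \<Rightarrow>
    ('g, 'r, 'x) tstruct \<times> ('g, 'r, 'x) tstruct \<Rightarrow> ('x \<Rightarrow> 'x) \<times> ('x \<Rightarrow> 'x) \<Rightarrow> srt \<times> 'x \<Rightarrow> srt \<times> 'x" where
  "uplus_map X Y \<phi> = (\<lambda>(s, x) \<in> univ2 (fst X \<uplus> snd X). (s, case_srt (fst \<phi>) (snd \<phi>) s x))"

end

theory Submission
  imports Defs
begin

text \<open>Condition (D) says that \<open>\<^bold>P \<odot> \<^bold>Q\<close> is the product of two reducts: \<open>\<gamma>\<close> acts on \<open>P\<close> as the
term \<open>r1 \<gamma>\<close> and on \<open>Q\<close> as \<open>r2 \<gamma>\<close>. The other two conditions are identities, so they pass from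
\<open>\<^bold>N\<close> to all of \<open>HSP(\<^bold>N)\<close>. By (L) each basic operation of \<open>\<^bold>P\<close> is a term operation of either reduct,
hence passing to a reduct neither adds nor loses homomorphisms (\<open>hom_red\<close>). By (M) there is a
\<open>\<Gamma>\<close>-term \<open>band\<close> with value \<open>(a, d)\<close> at \<open>(a, b), (c, d)\<close>. It has two consequences.

First, every algebra \<open>\<^bold>A\<close> in the variety generated by the products \<open>\<^bold>P \<odot> \<^bold>Q\<close> is itself such a product
(\<open>HSP_odot_decomposes\<close>): for a fixed \<open>c\<close>, the maps \<open>a \<mapsto> band(a, c)\<close> and \<open>a \<mapsto> band(c, a)\<close> are
retractions of \<open>A\<close> onto subsets that carry the two factors, and \<open>a\<close> is recovered as the band of its two
images. As the factors live on subsets of \<open>A\<close>, they lie in \<open>HSP(\<^bold>N) = ISP(\<^bold>N)\<close> over the same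
carrier type, where the given duality applies. The factors being separated by homomorphisms into \<open>\<^bold>N\<close>,
\<open>\<^bold>A\<close> is separated by homomorphisms into \<open>\<^bold>N \<odot> \<^bold>T\<close> and \<open>\<^bold>T \<odot> \<^bold>N\<close>; this gives the equality of the classes.

Second, a homomorphism from \<open>\<^bold>P \<odot> \<^bold>Q\<close> to \<open>\<^bold>N \<odot> \<^bold>T\<close> ignores the second coordinate, and so is a
homomorphism \<open>\<^bold>P \<rightarrow> \<^bold>N\<close> in disguise (\<open>hom_eq_lift\<close>); symmetrically for \<open>\<^bold>T \<odot> \<^bold>N\<close>. Thus the two-sorted dual
of \<open>\<^bold>P \<odot> \<^bold>Q\<close> is the disjoint union of the duals of \<open>\<^bold>P\<close> and \<open>\<^bold>Q\<close> (\<open>lift_iso\<close>). Conversely a two-sorted morphism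
is a pair of morphisms, one on each sort, so the algebra of morphisms on \<open>\<^bold>X\<^sub>1 \<uplus> \<^bold>X\<^sub>2\<close> is
\<open>E(\<^bold>X\<^sub>1) \<odot> E(\<^bold>X\<^sub>2)\<close> (\<open>E2_decomposition\<close>). Both evaluation maps therefore act coordinatewise, and the duality,
its fullness and the injectivity of the alter ego are inherited from each coordinate.

On the topological side one has to know that a two-sorted structure is in the dual category exactly if both
of its sorts are in the single-sorted one. The two sorts may a priori come with different exponents, so
membership is first characterised without mentioning an exponent (\<open>representable\<close>). After that, the
functor \<open>\<uplus>\<close> is even an isomorphism of categories, because a structure is the union of its sorts on the nose.\<close>

section \<open>Terms, products and varieties\<close>

lemma algebra_operD:
  "algebra Sg A \<Longrightarrow> f \<in> syms Sg \<Longrightarrow> as \<in> tuples (ar Sg f) (carrier A) \<Longrightarrow> oper A f as \<in> carrier A"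
  by (simp add: algebra_def)

lemma tuples_nth: "as \<in> tuples n X \<Longrightarrow> i < n \<Longrightarrow> as ! i \<in> X"
  by (auto simp: tuples_def)

lemma tuples_length: "as \<in> tuples n X \<Longrightarrow> length as = n"
  by (simp add: tuples_def)

lemma tuples_map_self: "length xs = n \<Longrightarrow> (\<And>x. x \<in> set xs \<Longrightarrow> f x \<in> Y) \<Longrightarrow> map f xs \<in> tuples n Y"
  by (auto simp: tuples_def)

lemma map_restrict: "xs \<in> tuples n X \<Longrightarrow> map (restrict f X) xs = map f xs"
  by (auto simp: tuples_def)

lemma tuples_image:
  assumes "ys \<in> tuples n (f ` X)"
  obtains xs where "xs \<in> tuples n X" "ys = map f xs"
proof -
  have "map (inv_into X f) ys \<in> tuples n X"
    using assms by (rule tuples_map) (rule inv_into_into)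
  moreover have "ys = map f (map (inv_into X f) ys)"
    unfolding map_map using tuplesD[OF assms]
    by (intro map_idI[symmetric]) (simp add: f_inv_into_f)
  ultimately show thesis by (rule that)
qed

lemma teval_mem:
  assumes A: "algebra Sg A" and as: "as \<in> tuples k (carrier A)" and t: "t \<in> trms Sg k"
  shows "teval A as t \<in> carrier A"
  using t
proof induction
  case (1 i)
  then show ?case using as by (simp add: tuples_nth)
next
  case (2 f ts)
  then have "map (teval A as) ts \<in> tuples (ar Sg f) (carrier A)" by (intro tuples_map_self) auto
  with A 2 show ?case by (simp add: algebra_operD)
qed

lemma map_teval_mem:
  assumes "algebra Sg A" "as \<in> tuples k (carrier A)" "\<forall>t\<in>set ts. t \<in> trms Sg k"
  shows "map (teval A as) ts \<in> tuples (length ts) (carrier A)"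
  using assms by (intro tuples_map_self) (auto intro: teval_mem)

lemma hom_mem: "h \<in> hom Sg A B \<Longrightarrow> a \<in> carrier A \<Longrightarrow> h a \<in> carrier B"
  by (auto simp: hom_def)

lemma hom_oper:
  "h \<in> hom Sg A B \<Longrightarrow> f \<in> syms Sg \<Longrightarrow> as \<in> tuples (ar Sg f) (carrier A) \<Longrightarrow>
    h (oper A f as) = oper B f (map h as)"
  by (simp add: hom_def)

lemma homI:
  assumes "\<And>a. a \<in> carrier A \<Longrightarrow> h a \<in> carrier B" "\<And>a. a \<notin> carrier A \<Longrightarrow> h a = undefined"
    and "\<And>f as. f \<in> syms Sg \<Longrightarrow> as \<in> tuples (ar Sg f) (carrier A) \<Longrightarrow>
      h (oper A f as) = oper B f (map h as)"
  shows "h \<in> hom Sg A B"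
  using assms by (auto simp: hom_def)

lemma hom_restrictI:
  assumes A: "algebra Sg A" and "\<And>a. a \<in> carrier A \<Longrightarrow> h a \<in> carrier B"
    and "\<And>f as. f \<in> syms Sg \<Longrightarrow> as \<in> tuples (ar Sg f) (carrier A) \<Longrightarrow>
      h (oper A f as) = oper B f (map h as)"
  shows "(\<lambda>a\<in>carrier A. h a) \<in> hom Sg A B"
proof (rule homI)
  fix f as assume f: "f \<in> syms Sg" and as: "as \<in> tuples (ar Sg f) (carrier A)"
  show "(\<lambda>a\<in>carrier A. h a) (oper A f as) = oper B f (map (\<lambda>a\<in>carrier A. h a) as)"
    unfolding map_restrict[OF as] using assms(3)[OF f as] algebra_operD[OF A f as] by simp
qed (use assms in auto)

lemma hom_comp:
  assumes A: "algebra Sg A" and h: "h \<in> hom Sg A B" and k: "k \<in> hom Sg B C"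
  shows "(\<lambda>a\<in>carrier A. k (h a)) \<in> hom Sg A C"
proof (rule hom_restrictI[OF A])
  fix f as assume f: "f \<in> syms Sg" and as: "as \<in> tuples (ar Sg f) (carrier A)"
  have "map h as \<in> tuples (ar Sg f) (carrier B)" using as by (rule tuples_map) (rule hom_mem[OF h])
  then show "k (h (oper A f as)) = oper C f (map (\<lambda>a. k (h a)) as)"
    by (simp add: hom_oper[OF h f as] hom_oper[OF k f] o_def)
qed (use h k in \<open>auto dest: hom_mem\<close>)

lemma teval_hom:
  assumes A: "algebra Sg A" and h: "h \<in> hom Sg A B" and as: "as \<in> tuples k (carrier A)"
    and t: "t \<in> trms Sg k"
  shows "h (teval A as t) = teval B (map h as) t"
  using t
proof induction
  case (1 i)
  then show ?case using as by (simp add: tuples_length)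
next
  case (2 f ts)
  have "map (teval A as) ts \<in> tuples (ar Sg f) (carrier A)"
    using map_teval_mem[OF A as, of ts] 2 by simp
  moreover have "map h (map (teval A as) ts) = map (teval B (map h as)) ts" using 2 by simp
  ultimately show ?case by (simp only: teval.simps hom_oper[OF h 2(1)])
qed

lemma teval_subalg [simp]: "teval (subalg A S) as t = teval A as t"
  by (induction t) (simp_all add: subalg_def cong: map_cong)

lemma carrier_subalg [simp]: "carrier (subalg A S) = S"
  by (simp add: subalg_def)

lemma oper_subalg [simp]: "oper (subalg A S) = oper A"
  by (simp add: subalg_def)

lemma algebra_subalg: "subuniverse Sg A S \<Longrightarrow> algebra Sg (subalg A S)"
  by (auto simp: subuniverse_def algebra_def)

lemma subuniverse_teval:
  "subuniverse Sg A S \<Longrightarrow> as \<in> tuples k S \<Longrightarrow> t \<in> trms Sg k \<Longrightarrow> teval A as t \<in> S"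
  using teval_mem[OF algebra_subalg, of Sg A S as k t] by simp

lemma subuniverse_carrier: "algebra Sg A \<Longrightarrow> subuniverse Sg A (carrier A)"
  by (auto simp: subuniverse_def algebra_def)

lemma subalg_carrier [simp]: "subalg A (carrier A) = A"
  by (simp add: subalg_def)

lemma carrier_prod_alg [simp]: "carrier (prod_alg I F) = (\<Pi>\<^sub>E i\<in>I. carrier (F i))"
  by (simp add: prod_alg_def)

lemma oper_prod_alg:
  "oper (prod_alg I F) f xs = (\<lambda>i\<in>I. oper (F i) f (map (\<lambda>x. x i) xs))"
  by (simp add: prod_alg_def)

lemma algebra_prod:
  assumes "\<And>i. i \<in> I \<Longrightarrow> algebra Sg (F i)"
  shows "algebra Sg (prod_alg I F)"
proof -
  have "map (\<lambda>x. x i) xs \<in> tuples n (carrier (F i))"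
    if "xs \<in> tuples n (\<Pi>\<^sub>E i\<in>I. carrier (F i))" "i \<in> I" for xs i n
    using that(1) by (rule tuples_map) (use that(2) in auto)
  then show ?thesis
    using assms by (auto simp: algebra_def oper_prod_alg PiE_eq_empty_iff)
qed

lemma prod_proj_hom:
  assumes "\<And>i. i \<in> I \<Longrightarrow> algebra Sg (F i)" "i \<in> I"
  shows "(\<lambda>x\<in>carrier (prod_alg I F). x i) \<in> hom Sg (prod_alg I F) (F i)"
  using assms by (intro hom_restrictI algebra_prod) (auto simp: oper_prod_alg)

lemma teval_prod:
  assumes F: "\<And>i. i \<in> I \<Longrightarrow> algebra Sg (F i)" and i: "i \<in> I"
    and xs: "xs \<in> tuples k (carrier (prod_alg I F))" and t: "t \<in> trms Sg k"
  shows "teval (prod_alg I F) xs t i = teval (F i) (map (\<lambda>x. x i) xs) t"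
proof -
  let ?p = "\<lambda>x\<in>carrier (prod_alg I F). x i"
  have "?p (teval (prod_alg I F) xs t) = teval (F i) (map ?p xs) t"
    by (rule teval_hom[OF algebra_prod[OF F] prod_proj_hom[OF F i] xs t])
  moreover have "teval (prod_alg I F) xs t \<in> carrier (prod_alg I F)"
    by (rule teval_mem[OF algebra_prod[OF F] xs t])
  ultimately show ?thesis unfolding map_restrict[OF xs] by simp
qed

lemma HSP_E:
  fixes A :: "('f, 'a) alg" and K :: "('f, 'm) alg set"
  assumes "A \<in> HSP Sg K"
  obtains I :: "(('f, 'm) alg \<times> ('a \<Rightarrow> 'm)) set" and F S h where "\<forall>i\<in>I. F i \<in> K"
    "subuniverse Sg (prod_alg I F) S" "h \<in> hom Sg (subalg (prod_alg I F) S) A" "h ` S = carrier A"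
  using assms unfolding HSP_def by blast

definition satisfies :: "('f, 'a) alg \<Rightarrow> nat \<Rightarrow> 'f trm \<Rightarrow> 'f trm \<Rightarrow> bool" where
  "satisfies A k t u \<longleftrightarrow> (\<forall>as \<in> tuples k (carrier A). teval A as t = teval A as u)"

lemma HSP_satisfies:
  fixes A :: "('f, 'a) alg" and K :: "('f, 'm) alg set"
  assumes A: "A \<in> HSP Sg K" and K: "\<And>B. B \<in> K \<Longrightarrow> algebra Sg B \<and> satisfies B k t u"
    and t: "t \<in> trms Sg k" and u: "u \<in> trms Sg k"
  shows "satisfies A k t u"
  unfolding satisfies_def
proof
  fix as assume as: "as \<in> tuples k (carrier A)"
  obtain I :: "(('f, 'm) alg \<times> ('a \<Rightarrow> 'm)) set" and F S h where F: "\<forall>i\<in>I. F i \<in> K" and S: "subuniverse Sg (prod_alg I F) S"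
    and h: "h \<in> hom Sg (subalg (prod_alg I F) S) A" "h ` S = carrier A"
    using A by (rule HSP_E)
  have F': "algebra Sg (F i)" if "i \<in> I" for i using F K that by auto
  obtain xs where xs: "xs \<in> tuples k S" "as = map h xs"
    using as unfolding h(2)[symmetric] by (rule tuples_image)
  then have xs': "xs \<in> tuples k (carrier (prod_alg I F))" using S by (auto simp: subuniverse_def tuples_def)
  have "teval (prod_alg I F) xs t = teval (prod_alg I F) xs u"
  proof (rule PiE_ext)
    show "teval (prod_alg I F) xs t \<in> (\<Pi>\<^sub>E i\<in>I. carrier (F i))"
      "teval (prod_alg I F) xs u \<in> (\<Pi>\<^sub>E i\<in>I. carrier (F i))"
      using teval_mem[OF algebra_prod[OF F'] xs'] t u by auto
    fix i assume i: "i \<in> I"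
    have "map (\<lambda>x. x i) xs \<in> tuples k (carrier (F i))"
      using xs' by (rule tuples_map) (use i in auto)
    then show "teval (prod_alg I F) xs t i = teval (prod_alg I F) xs u i"
      using i F K t u by (simp add: teval_prod[OF F' i xs'] satisfies_def)
  qed
  then show "teval A as t = teval A as u"
    using teval_hom[OF algebra_subalg[OF S] h(1), of xs k] xs t u by (metis carrier_subalg teval_subalg)
qed

lemma HSP_algebra: "A \<in> HSP Sg K \<Longrightarrow> algebra Sg A"
  by (simp add: HSP_def)

text \<open>The preimage of \<open>U\<close> under the surjection that presents \<open>B\<close> presents \<open>A\<close>.\<close>

lemma HSP_image:
  fixes B :: "('f, 'b) alg" and A :: "('f, 'a) alg" and K :: "('f, 'm) alg set"
  assumes B: "B \<in> HSP Sg K" and U: "subuniverse Sg B U"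
    and g: "g \<in> hom Sg (subalg B U) A" "g ` U = carrier A" and A: "algebra Sg A"
  shows "A \<in> HSP Sg K"
proof -
  obtain I :: "(('f, 'm) alg \<times> ('b \<Rightarrow> 'm)) set" and F S h where F: "\<forall>i\<in>I. F i \<in> K" and S: "subuniverse Sg (prod_alg I F) S"
    and h: "h \<in> hom Sg (subalg (prod_alg I F) S) B" "h ` S = carrier B"
    using B by (rule HSP_E)
  let ?P = "prod_alg I F"
  define S' where "S' = {x \<in> S. h x \<in> U}"
  have hS': "map h xs \<in> tuples n U" if "xs \<in> tuples n S'" for xs n
    using that by (rule tuples_map) (simp add: S'_def)
  have S'S: "xs \<in> tuples n S" if "xs \<in> tuples n S'" for xs n
    using that by (auto simp: tuples_def S'_def)
  have hop: "h (oper ?P f xs) = oper B f (map h xs)"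
    if "f \<in> syms Sg" "xs \<in> tuples (ar Sg f) S'" for f xs
    using hom_oper[OF h(1) that(1)] S'S[OF that(2)] by simp
  have "h ` S' = U"
    using U h(2) by (force simp: S'_def subuniverse_def)
  have S': "subuniverse Sg ?P S'"
    unfolding subuniverse_def
  proof (intro conjI ballI)
    show "S' \<noteq> {}" using \<open>h ` S' = U\<close> U by (auto simp: subuniverse_def)
    show "S' \<subseteq> carrier ?P" using S by (auto simp: S'_def subuniverse_def)
    fix f xs assume f: "f \<in> syms Sg" "xs \<in> tuples (ar Sg f) S'"
    then have "oper ?P f xs \<in> S" using S S'S by (auto simp: subuniverse_def)
    moreover have "h (oper ?P f xs) \<in> U"
      using hop[OF f] hS'[OF f(2)] U f(1) by (auto simp: subuniverse_def)
    ultimately show "oper ?P f xs \<in> S'" by (simp add: S'_def)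
  qed
  have "(\<lambda>x\<in>carrier (subalg ?P S'). g (h x)) \<in> hom Sg (subalg ?P S') A"
  proof (rule hom_restrictI[OF algebra_subalg[OF S']])
    show "g (h x) \<in> carrier A" if "x \<in> carrier (subalg ?P S')" for x
      using that hom_mem[OF g(1)] by (simp add: S'_def)
    fix f xs assume f: "f \<in> syms Sg" and xs: "xs \<in> tuples (ar Sg f) (carrier (subalg ?P S'))"
    then show "g (h (oper (subalg ?P S') f xs)) = oper A f (map (\<lambda>x. g (h x)) xs)"
      using hom_oper[OF g(1) f] hS' by (simp add: hop o_def)
  qed
  moreover have "(\<lambda>x\<in>carrier (subalg ?P S'). g (h x)) ` S' = carrier A"
    using \<open>h ` S' = U\<close> g(2) by (force simp: image_image)
  ultimately show ?thesis using HSP_I[OF A F S'] by metis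
qed

text \<open>A product of quotients of subalgebras of products is presented by the product over the disjoint
union of all the index sets.\<close>

lemma HSP_prod:
  fixes F :: "'i \<Rightarrow> ('f, 'a) alg" and K :: "('f, 'm) alg set"
  assumes F: "\<And>i. i \<in> I \<Longrightarrow> F i \<in> HSP Sg K"
  shows "prod_alg I F \<in> HSP Sg K"
proof -
  let ?ok = "\<lambda>i (J :: (('f, 'm) alg \<times> ('a \<Rightarrow> 'm)) set) G S h.
     (\<forall>j\<in>J. G j \<in> K) \<and> subuniverse Sg (prod_alg J G) S \<and>
     h \<in> hom Sg (subalg (prod_alg J G) S) (F i) \<and> h ` S = carrier (F i)"
  have "\<forall>i. \<exists>J G S h. i \<in> I \<longrightarrow> ?ok i J G S h"
    using F unfolding HSP_def by fast
  then obtain J G S h where ok: "\<And>i. i \<in> I \<Longrightarrow> ?ok i (J i) (G i) (S i) (h i)"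
    by metis
  note K = ok[THEN conjunct1] and S = ok[THEN conjunct2, THEN conjunct1]
    and h = ok[THEN conjunct2, THEN conjunct2, THEN conjunct1]
    and im = ok[THEN conjunct2, THEN conjunct2, THEN conjunct2]
  have A: "algebra Sg (prod_alg I F)" using F by (intro algebra_prod) (auto dest: HSP_algebra)
  let ?I = "Sigma I J" and ?G = "\<lambda>(i, j). G i j"
  let ?P = "prod_alg ?I ?G"
  \<comment> \<open>The block of an element of the large product that belongs to the factor \<open>i\<close>.\<close>
  define c where "c = (\<lambda>i y. \<lambda>j\<in>J i. y (i, j) :: 'm)"
  define U where "U = {y \<in> carrier ?P. \<forall>i\<in>I. c i y \<in> S i}"
  have cU: "map (c i) ys \<in> tuples n (S i)" if "ys \<in> tuples n U" "i \<in> I" for ys n i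
    using that(1) by (rule tuples_map) (use that(2) in \<open>simp add: U_def\<close>)
  have cop: "c i (oper ?P f ys) = oper (prod_alg (J i) (G i)) f (map (c i) ys)" if "i \<in> I" for f ys i
    using that by (auto simp: c_def oper_prod_alg fun_eq_iff o_def)
  have S_sub: "S i \<subseteq> (\<Pi>\<^sub>E j\<in>J i. carrier (G i j))" if "i \<in> I" for i
    using S[OF that] by (simp add: subuniverse_def)
  have lift: "\<exists>y\<in>U. \<forall>i\<in>I. c i y = x i" if x: "\<And>i. i \<in> I \<Longrightarrow> x i \<in> S i" for x
  proof (intro bexI ballI)
    let ?y = "\<lambda>(i, j)\<in>?I. x i j"
    have xP: "x i \<in> (\<Pi>\<^sub>E j\<in>J i. carrier (G i j))" if "i \<in> I" for i using S_sub x that by blast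
    show c: "c i ?y = x i" if i: "i \<in> I" for i
    proof
      show "c i ?y j = x i j" for j
        using i PiE_arb[OF xP[OF i], of j] by (cases "j \<in> J i") (simp_all add: c_def)
    qed
    have "?y \<in> carrier ?P" using xP by auto
    then show "?y \<in> U" using c x unfolding U_def by (simp del: restrict_apply)
  qed
  have U: "subuniverse Sg ?P U"
    unfolding subuniverse_def
  proof (intro conjI ballI)
    have "\<exists>x. \<forall>i\<in>I. x i \<in> S i"
      using S by (intro bchoice) (metis equals0I subuniverse_def)
    then show "U \<noteq> {}" using lift by blast
    fix f ys assume f: "f \<in> syms Sg" and ys: "ys \<in> tuples (ar Sg f) U"
    have cS: "c i (oper ?P f ys) \<in> S i" if i: "i \<in> I" for i
      unfolding cop[OF i] using S[OF i] f cU[OF ys i] by (auto simp: subuniverse_def)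
    have "oper ?P f ys (i, j) \<in> carrier (G i j)" if "i \<in> I" "j \<in> J i" for i j
      using cS[OF that(1)] S_sub[OF that(1)] that(2) by (fastforce simp: c_def)
    then have "oper ?P f ys \<in> carrier ?P" by (auto simp: oper_prod_alg)
    with cS show "oper ?P f ys \<in> U" by (simp add: U_def)
  qed (auto simp: U_def)
  define k where "k = (\<lambda>y\<in>carrier (subalg ?P U). \<lambda>i\<in>I. h i (c i y))"
  have k: "k \<in> hom Sg (subalg ?P U) (prod_alg I F)"
    unfolding k_def
  proof (rule hom_restrictI[OF algebra_subalg[OF U]])
    show "(\<lambda>i\<in>I. h i (c i y)) \<in> carrier (prod_alg I F)" if "y \<in> carrier (subalg ?P U)" for y
      using that hom_mem[OF h] by (auto simp: U_def)
    fix f ys assume f: "f \<in> syms Sg" and ys: "ys \<in> tuples (ar Sg f) (carrier (subalg ?P U))"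
    then show "(\<lambda>i\<in>I. h i (c i (oper (subalg ?P U) f ys))) =
        oper (prod_alg I F) f (map (\<lambda>y. \<lambda>i\<in>I. h i (c i y)) ys)"
      using hom_oper[OF h f] cU by (auto simp: fun_eq_iff cop oper_prod_alg[of I] o_def)
  qed
  have "k ` U = carrier (prod_alg I F)"
  proof
    show "k ` U \<subseteq> carrier (prod_alg I F)"
      using hom_mem[OF k] unfolding carrier_subalg by blast
    show "carrier (prod_alg I F) \<subseteq> k ` U"
    proof
      fix z assume z: "z \<in> carrier (prod_alg I F)"
      then have "z i \<in> h i ` S i" if "i \<in> I" for i using that im[OF that] by auto
      then have "\<forall>i\<in>I. \<exists>x. x \<in> S i \<and> h i x = z i" by force
      then obtain x where x: "\<And>i. i \<in> I \<Longrightarrow> x i \<in> S i \<and> h i (x i) = z i" by metis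
      obtain y where y: "y \<in> U" "\<forall>i\<in>I. c i y = x i" using lift[of x] x by auto
      have "k y i = z i" for i
        using y x PiE_arb[of z I _ i] z by (cases "i \<in> I") (auto simp: k_def)
      then have "k y = z" ..
      then show "z \<in> k ` U" using y(1) by blast
    qed
  qed
  moreover have "\<forall>p\<in>?I. ?G p \<in> K" using K by auto
  ultimately show ?thesis using HSP_I[OF A _ U k] by metis
qed

lemma HSP_base:
  assumes A: "A \<in> K" "algebra Sg A"
  shows "A \<in> HSP Sg K"
proof -
  let ?P = "prod_alg {()} (\<lambda>_. A)"
  have P: "algebra Sg ?P" using A by (intro algebra_prod)
  have "(\<lambda>x\<in>carrier ?P. x ()) \<in> hom Sg ?P A"
    using A by (intro prod_proj_hom) auto
  moreover have "(\<lambda>x\<in>carrier ?P. x ()) ` carrier ?P = carrier A"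
  proof safe
    fix a assume "a \<in> carrier A"
    then have "(\<lambda>_\<in>{()}. a) \<in> carrier ?P" by auto
    then show "a \<in> (\<lambda>x\<in>carrier ?P. x ()) ` carrier ?P" by (auto intro!: image_eqI)
  qed auto
  ultimately show ?thesis
    using A HSP_I[OF _ _ subuniverse_carrier[OF P], of A K "\<lambda>x\<in>carrier ?P. x ()"]
    unfolding subalg_carrier by blast
qed

lemma alg_iso_inverse:
  assumes A: "algebra Sg A" and h: "alg_iso Sg A B h"
  shows "(\<lambda>b\<in>carrier B. inv_into (carrier A) h b) \<in> hom Sg B A"
proof -
  let ?k = "inv_into (carrier A) h"
  have hom: "h \<in> hom Sg A B" and bij: "bij_betw h (carrier A) (carrier B)"
    using h by (simp_all add: alg_iso_def)
  have k: "?k b \<in> carrier A" "h (?k b) = b" if "b \<in> carrier B" for b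
    using that bij by (auto simp: bij_betw_def inv_into_into f_inv_into_f)
  have kh: "?k (h a) = a" if "a \<in> carrier A" for a
    using that bij by (auto simp: bij_betw_def)
  have op: "?k (oper B f bs) = oper A f (map ?k bs) \<and> oper B f bs \<in> carrier B"
    if f: "f \<in> syms Sg" and bs: "bs \<in> tuples (ar Sg f) (carrier B)" for f bs
  proof -
    have as: "map ?k bs \<in> tuples (ar Sg f) (carrier A)" using bs by (rule tuples_map) (rule k)
    have "map h (map ?k bs) = bs"
      unfolding map_map using tuplesD[OF bs] k(2) by (intro map_idI) simp
    then have "h (oper A f (map ?k bs)) = oper B f bs"
      using hom_oper[OF hom f as] by simp
    then show ?thesis using kh algebra_operD[OF A f as] hom_mem[OF hom] by metis
  qed
  show ?thesis
  proof (rule homI)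
    fix f bs assume f: "f \<in> syms Sg" and bs: "bs \<in> tuples (ar Sg f) (carrier B)"
    show "(\<lambda>b\<in>carrier B. ?k b) (oper B f bs) = oper A f (map (\<lambda>b\<in>carrier B. ?k b) bs)"
      unfolding map_restrict[OF bs] using op[OF f bs] by simp
  qed (use k in auto)
qed

lemma ISP_subset_HSP: "ISP Sg K \<subseteq> HSP Sg K"
proof
  fix A :: "('a, 'b) alg" assume "A \<in> ISP Sg K"
  then obtain I :: "('b \<times> 'b) set" and F S h where A: "algebra Sg A" and F: "\<forall>i\<in>I. F i \<in> K"
    and S: "subuniverse Sg (prod_alg I F) S" and h: "alg_iso Sg A (subalg (prod_alg I F) S) h"
    unfolding ISP_def by blast
  have "bij_betw (inv_into (carrier A) h) S (carrier A)"
    using h by (auto simp: alg_iso_def intro: bij_betw_inv_into)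
  then have "(\<lambda>b\<in>S. inv_into (carrier A) h b) ` S = carrier A"
    by (simp add: bij_betw_def)
  then show "A \<in> HSP Sg K" using HSP_I[OF A F S] alg_iso_inverse[OF A h] by simp
qed

lemma alg_iso_image:
  assumes A: "algebra Sg A" and h: "h \<in> hom Sg A B" and inj: "inj_on h (carrier A)"
  shows "subuniverse Sg B (h ` carrier A)" "alg_iso Sg A (subalg B (h ` carrier A)) h"
proof -
  show "subuniverse Sg B (h ` carrier A)"
    unfolding subuniverse_def
  proof (intro conjI ballI)
    fix f bs assume f: "f \<in> syms Sg" and bs: "bs \<in> tuples (ar Sg f) (h ` carrier A)"
    from bs obtain as where "as \<in> tuples (ar Sg f) (carrier A)" "bs = map h as"
      by (rule tuples_image)
    then show "oper B f bs \<in> h ` carrier A"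
      using hom_oper[OF h f] algebra_operD[OF A f] by (metis imageI)
  qed (use A h in \<open>auto simp: algebra_def dest: hom_mem\<close>)
  show "alg_iso Sg A (subalg B (h ` carrier A)) h"
    using h inj by (auto simp: alg_iso_def hom_def bij_betw_def)
qed

text \<open>One factor for every pair of distinct elements.\<close>

lemma ISP_if_separated:
  fixes A :: "('f, 'a) alg"
  assumes A: "algebra Sg A" and K: "\<And>B. B \<in> K \<Longrightarrow> algebra Sg B"
    and sep: "\<And>a b. a \<in> carrier A \<Longrightarrow> b \<in> carrier A \<Longrightarrow> a \<noteq> b \<Longrightarrow> \<exists>B\<in>K. \<exists>x\<in>hom Sg A B. x a \<noteq> x b"
  shows "A \<in> ISP Sg K"
proof -
  define I where "I = {(a, b). a \<in> carrier A \<and> b \<in> carrier A \<and> a \<noteq> b}"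
  have "\<forall>p\<in>I. \<exists>B x. B \<in> K \<and> x \<in> hom Sg A B \<and> x (fst p) \<noteq> x (snd p)"
    using sep by (fastforce simp: I_def)
  then obtain F x where Fx: "\<And>p. p \<in> I \<Longrightarrow> F p \<in> K \<and> x p \<in> hom Sg A (F p) \<and> x p (fst p) \<noteq> x p (snd p)"
    by metis
  define h where "h = (\<lambda>a\<in>carrier A. \<lambda>p\<in>I. x p a)"
  have x: "x p \<in> hom Sg A (F p)" if "p \<in> I" for p using Fx[OF that] by simp
  have h: "h \<in> hom Sg A (prod_alg I F)"
    unfolding h_def
    by (intro hom_restrictI[OF A])
      (auto simp: oper_prod_alg fun_eq_iff hom_oper[OF x] o_def dest: hom_mem[OF x])
  have "inj_on h (carrier A)"
  proof (rule inj_onI, rule ccontr)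
    fix a b assume ab: "a \<in> carrier A" "b \<in> carrier A" "h a = h b" "a \<noteq> b"
    then have "(a, b) \<in> I" by (simp add: I_def)
    moreover have "h a (a, b) = h b (a, b)" using ab(3) by simp
    ultimately show False using Fx[of "(a, b)"] ab by (simp add: h_def)
  qed
  note e = alg_iso_image[OF A h this]
  show ?thesis by (rule ISP_I[OF A _ e]) (use Fx in blast)
qed

lemma HSP_subalg:
  assumes B: "B \<in> HSP Sg K" and U: "subuniverse Sg B U"
  shows "subalg B U \<in> HSP Sg K"
proof (rule HSP_image[OF B U])
  show "(\<lambda>x\<in>carrier (subalg B U). x) \<in> hom Sg (subalg B U) (subalg B U)"
    by (rule hom_restrictI[OF algebra_subalg[OF U]]) simp_all
qed (simp_all add: algebra_subalg[OF U])

lemma HSP_mono: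
  fixes K K' :: "('f, 'm) alg set"
  assumes "K \<subseteq> K'"
  shows "(HSP Sg K :: ('f, 'a) alg set) \<subseteq> HSP Sg K'"
proof
  fix A :: "('f, 'a) alg" assume A: "A \<in> HSP Sg K"
  then obtain I :: "(('f, 'm) alg \<times> ('a \<Rightarrow> 'm)) set" and F S h where
    F: "\<forall>i\<in>I. F i \<in> K" and *: "subuniverse Sg (prod_alg I F) S"
    "h \<in> hom Sg (subalg (prod_alg I F) S) A" "h ` S = carrier A" by (rule HSP_E)
  have "\<forall>i\<in>I. F i \<in> K'" using F assms by blast
  from HSP_I[OF HSP_algebra[OF A] this *] show "A \<in> HSP Sg K'" .
qed

lemma HSP_iso:
  assumes B: "B \<in> HSP Sg K" and A: "algebra Sg A" and h: "alg_iso Sg A B h"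
  shows "A \<in> HSP Sg K"
proof (rule HSP_image[OF B subuniverse_carrier[OF HSP_algebra[OF B]] _ _ A])
  show "(\<lambda>b\<in>carrier B. inv_into (carrier A) h b) \<in> hom Sg (subalg B (carrier B)) A"
    using alg_iso_inverse[OF A h] by simp
  have "bij_betw (inv_into (carrier A) h) (carrier B) (carrier A)"
    using h by (auto simp: alg_iso_def intro: bij_betw_inv_into)
  then show "(\<lambda>b\<in>carrier B. inv_into (carrier A) h b) ` carrier B = carrier A"
    by (simp add: bij_betw_def)
qed

lemma hom_factor:
  assumes A: "algebra Sg A" and B: "algebra Sg B"
    and q: "q \<in> hom Sg A B" "q ` carrier A = carrier B" and y: "y \<in> hom Sg A C"
    and ker: "\<And>a b. a \<in> carrier A \<Longrightarrow> b \<in> carrier A \<Longrightarrow> q a = q b \<Longrightarrow> y a = y b"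
  shows "\<exists>x \<in> hom Sg B C. \<forall>a \<in> carrier A. x (q a) = y a"
proof -
  define x where "x = (\<lambda>b. y (inv_into (carrier A) q b))"
  have xq: "x (q a) = y a" if "a \<in> carrier A" for a
    using that ker[of "inv_into (carrier A) q (q a)" a]
    by (simp add: x_def inv_into_into f_inv_into_f)
  have "(\<lambda>b\<in>carrier B. x b) \<in> hom Sg B C"
  proof (rule hom_restrictI[OF B])
    show "x b \<in> carrier C" if "b \<in> carrier B" for b
      using that xq hom_mem[OF y] unfolding q(2)[symmetric] by auto
    fix f bs assume f: "f \<in> syms Sg" and bs: "bs \<in> tuples (ar Sg f) (carrier B)"
    then obtain as where as: "as \<in> tuples (ar Sg f) (carrier A)" "bs = map q as"
      unfolding q(2)[symmetric] by (metis tuples_image)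
    have "map x bs = map y as" using as xq by (auto simp: tuples_def)
    moreover have "x (oper B f bs) = oper C f (map y as)"
      using as xq[OF algebra_operD[OF A f as(1)]] by (simp add: hom_oper[OF q(1) f] hom_oper[OF y f])
    ultimately show "x (oper B f bs) = oper C f (map x bs)" by simp
  qed
  then show ?thesis
    using xq hom_mem[OF q(1)] by (intro bexI[of _ "\<lambda>b\<in>carrier B. x b"]) auto
qed

section \<open>The language \<open>\<Gamma>\<close> and reducts\<close>

primrec subst :: "'f trm list \<Rightarrow> 'f trm \<Rightarrow> 'f trm" where
  "subst us (Var i) = us ! i"
| "subst us (App f ts) = App f (map (subst us) ts)"

lemma subst_trms:
  assumes "us \<in> tuples n (trms Sg k)" "t \<in> trms Sg n"
  shows "subst us t \<in> trms Sg k"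
  using assms(2) by induction (use assms(1) in \<open>auto simp: tuples_nth intro!: trms.intros\<close>)

lemma teval_subst:
  assumes "t \<in> trms Sg (length us)"
  shows "teval A as (subst us t) = teval A (map (teval A as) us) t"
  using assms by induction (auto cong: map_cong simp: o_def)

text \<open>Condition (D) splits a \<open>\<Gamma>\<close>-term into two \<open>\<Sigma>\<close>-terms, one per coordinate:
  unfold every symbol \<open>\<gamma>\<close> into the term \<open>r \<gamma>\<close>.\<close>

primrec unfold_term :: "('h \<Rightarrow> 'f trm) \<Rightarrow> 'h trm \<Rightarrow> 'f trm" where
  "unfold_term r (Var i) = Var i"
| "unfold_term r (App h ts) = subst (map (unfold_term r) ts) (r h)"

text \<open>With \<open>r1\<close> and \<open>r2\<close> from (D), \<open>\<^bold>P \<odot> \<^bold>Q\<close> is the product of \<open>reduct r1 P\<close> and \<open>reduct r2 Q\<close>.\<close>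

definition reduct :: "('h \<Rightarrow> 'f trm) \<Rightarrow> ('f, 'a) alg \<Rightarrow> ('h, 'a) alg" where
  "reduct r P = \<lparr>carrier = carrier P, oper = (\<lambda>h as. teval P as (r h))\<rparr>"

lemma carrier_reduct [simp]: "carrier (reduct r P) = carrier P"
  by (simp add: reduct_def)

lemma oper_reduct [simp]: "oper (reduct r P) h as = teval P as (r h)"
  by (simp add: reduct_def)

lemma gsgn_simps [simp]: "syms (gsgn \<Gamma>) = \<Gamma>" "ar (gsgn \<Gamma>) = fst"
  by (simp_all add: gsgn_def)

lemma carrier_odot [simp]: "carrier (odot r1 r2 P Q) = carrier P \<times> carrier Q"
  by (simp add: odot_def)

lemma oper_odot: "oper (odot r1 r2 P Q) \<gamma> ps = (teval P (map fst ps) (r1 \<gamma>), teval Q (map snd ps) (r2 \<gamma>))"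
  by (simp add: odot_def)

lemma tuples_fst: "ps \<in> tuples n (X \<times> Y) \<Longrightarrow> map fst ps \<in> tuples n X"
  by (rule tuples_map) auto

lemma tuples_snd: "ps \<in> tuples n (X \<times> Y) \<Longrightarrow> map snd ps \<in> tuples n Y"
  by (rule tuples_map) auto

text \<open>The position of the argument of the band term that a coordinate is taken from.\<close>

definition idx :: "srt \<Rightarrow> nat" where
  "idx s = case_srt 0 1 s"

definition pr :: "srt \<Rightarrow> 'a \<times> 'a \<Rightarrow> 'a" where
  "pr s = case_srt fst snd s"

lemma pr_simps [simp]: "pr S1 = fst" "pr S2 = snd"
  by (simp_all add: pr_def)

lemma idx_simps [simp]: "idx S1 = 0" "idx S2 = 1"
  by (simp_all add: idx_def)

lemma forall_srt: "(\<forall>s. Q s) \<longleftrightarrow> Q S1 \<and> Q S2"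
  by (metis srt.exhaust)

locale gamma_setting =
  fixes Sg :: "'f sgn" and N T :: "('f, 'n) alg" and \<Gamma> :: "'f gpair set"
    and r1 r2 :: "'f gpair \<Rightarrow> 'f trm"
  assumes N: "algebra Sg N" and T: "trivial_algebra Sg T"
    and L: "cond_L Sg N \<Gamma>" and M: "cond_M N \<Gamma>" and D: "cond_D Sg N \<Gamma> r1 r2"
begin

definition \<rho> :: "srt \<Rightarrow> 'f gpair \<Rightarrow> 'f trm" where
  "\<rho> s = case_srt r1 r2 s"

lemma rho_simps [simp]: "\<rho> S1 = r1" "\<rho> S2 = r2"
  by (simp_all add: \<rho>_def)

abbreviation red :: "srt \<Rightarrow> ('f, 'a) alg \<Rightarrow> ('f gpair, 'a) alg" where
  "red s \<equiv> reduct (\<rho> s)"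

abbreviation GS :: "'f gpair sgn" where
  "GS \<equiv> gsgn \<Gamma>"

lemma rho_trms: "\<gamma> \<in> \<Gamma> \<Longrightarrow> \<rho> s \<gamma> \<in> trms Sg (fst \<gamma>)"
  using D by (cases s) (auto simp: cond_D_def)

lemma unfold_term_trms: "t \<in> trms GS k \<Longrightarrow> unfold_term (\<rho> s) t \<in> trms Sg k"
proof (induction rule: trms.induct)
  case (2 \<gamma> ts)
  have "map (unfold_term (\<rho> s)) ts \<in> tuples (fst \<gamma>) (trms Sg k)"
    using 2 by (intro tuples_map_self) auto
  from subst_trms[OF this rho_trms] 2(1) show ?case by simp
qed (auto intro: trms.intros)

lemma teval_red: "t \<in> trms GS k \<Longrightarrow> teval (red s P) as t = teval P as (unfold_term (\<rho> s) t)"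
proof (induction rule: trms.induct)
  case (2 \<gamma> ts)
  have "\<rho> s \<gamma> \<in> trms Sg (length (map (unfold_term (\<rho> s)) ts))"
    using rho_trms[of \<gamma>] 2 by simp
  moreover have "map (teval (red s P) as) ts = map (teval P as) (map (unfold_term (\<rho> s)) ts)"
    using 2 by simp
  ultimately show ?case by (simp only: unfold_term.simps teval_subst teval.simps oper_reduct)
qed simp

lemma algebra_red: "algebra Sg P \<Longrightarrow> algebra GS (red s P)"
  using teval_mem[OF _ _ rho_trms, of P] unfolding algebra_def[of GS] by (auto simp: algebra_def)

lemma algebra_odot:
  assumes P: "algebra Sg P" and Q: "algebra Sg Q"
  shows "algebra GS (odot r1 r2 P Q)"
proof -
  have "oper (odot r1 r2 P Q) \<gamma> ps \<in> carrier P \<times> carrier Q"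
    if "\<gamma> \<in> \<Gamma>" "ps \<in> tuples (fst \<gamma>) (carrier P \<times> carrier Q)" for \<gamma> ps
    using teval_mem[OF P tuples_fst[OF that(2)]] teval_mem[OF Q tuples_snd[OF that(2)]]
      rho_trms[OF that(1), of S1] rho_trms[OF that(1), of S2]
    by (simp add: oper_odot)
  then show ?thesis using P Q by (auto simp: algebra_def)
qed

lemma odot_fst_hom:
  assumes P: "algebra Sg P" and Q: "algebra Sg Q"
  shows "(\<lambda>p\<in>carrier P \<times> carrier Q. fst p) \<in> hom GS (odot r1 r2 P Q) (red S1 P)"
  using hom_restrictI[OF algebra_odot[OF P Q], of fst "red S1 P"] by (auto simp: oper_odot)

lemma odot_snd_hom:
  assumes P: "algebra Sg P" and Q: "algebra Sg Q"
  shows "(\<lambda>p\<in>carrier P \<times> carrier Q. snd p) \<in> hom GS (odot r1 r2 P Q) (red S2 Q)"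
  using hom_restrictI[OF algebra_odot[OF P Q], of snd "red S2 Q"] by (auto simp: oper_odot)

lemma teval_odot:
  assumes P: "algebra Sg P" and Q: "algebra Sg Q" and t: "t \<in> trms GS k"
    and ps: "ps \<in> tuples k (carrier P \<times> carrier Q)"
  shows "teval (odot r1 r2 P Q) ps t = (teval (red S1 P) (map fst ps) t, teval (red S2 Q) (map snd ps) t)"
proof -
  have ps': "ps \<in> tuples k (carrier (odot r1 r2 P Q))" using ps by simp
  have "teval (odot r1 r2 P Q) ps t \<in> carrier P \<times> carrier Q"
    using teval_mem[OF algebra_odot[OF P Q] ps' t] by simp
  then show ?thesis
    using teval_hom[OF algebra_odot[OF P Q] odot_fst_hom[OF P Q] ps' t]
      teval_hom[OF algebra_odot[OF P Q] odot_snd_hom[OF P Q] ps' t]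
    unfolding map_restrict[OF ps] by (auto simp: prod_eq_iff)
qed

text \<open>By (D), \<open>PGam N\<close> is \<open>\<^bold>N \<odot> \<^bold>N\<close>, as far as argument lists of the right length are concerned. This allows one
to read (L) and (M), which speak about \<open>PGam N\<close>, as statements about the two reducts of \<open>\<^bold>N\<close>.\<close>

lemma carrier_PGam: "carrier (PGam N) = carrier N \<times> carrier N"
  by (simp add: PGam_def)

lemma oper_PGam:
  assumes "\<gamma> \<in> \<Gamma>" "ps \<in> tuples (fst \<gamma>) (carrier N \<times> carrier N)"
  shows "oper (PGam N) \<gamma> ps = oper (odot r1 r2 N N) \<gamma> ps"
  using D assms by (cases \<gamma>) (fastforce simp: cond_D_def PGam_def oper_odot)

lemma PGam_algebra: "algebra GS (PGam N)"
  using algebra_odot[OF N N] by (auto simp: algebra_def carrier_PGam oper_PGam)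

lemma teval_PGam:
  assumes t: "t \<in> trms GS k" and ps: "ps \<in> tuples k (carrier N \<times> carrier N)"
  shows "teval (PGam N) ps t = (teval (red S1 N) (map fst ps) t, teval (red S2 N) (map snd ps) t)"
proof -
  have "(\<lambda>p\<in>carrier (PGam N). p) \<in> hom GS (PGam N) (odot r1 r2 N N)"
    using PGam_algebra by (rule hom_restrictI) (simp_all add: carrier_PGam oper_PGam)
  from teval_hom[OF PGam_algebra this, of ps k t] ps t
  have "teval (PGam N) ps t = teval (odot r1 r2 N N) ps t"
    using teval_mem[OF PGam_algebra, of ps k t] map_restrict[OF ps, of "\<lambda>p. p"] by (simp add: carrier_PGam)
  then show ?thesis using teval_odot[OF N N t ps] by simp
qed

subsection \<open>The terms provided by (L) and (M)\<close>

text \<open>(L) evaluates its term on the diagonal only. That is enough, because by (D) a coordinate of the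
value of a \<open>\<Gamma>\<close>-term depends only on the same coordinates of the arguments.\<close>

lemma L_term: "\<exists>t \<in> trms GS (ar Sg f). \<forall>as \<in> tuples (ar Sg f) (carrier N). teval (red s N) as t = oper N f as"
  if f: "f \<in> syms Sg"
proof -
  have "pr s \<in> {fst, snd}" by (cases s) auto
  then obtain t where t: "t \<in> trms GS (ar Sg f)" and
    e: "\<And>as. as \<in> tuples (ar Sg f) (carrier N) \<Longrightarrow> pr s (teval (PGam N) (map (\<lambda>x. (x, x)) as) t) = oper N f as"
    using L f unfolding cond_L_def by blast
  have "pr s (teval (PGam N) (map (\<lambda>x. (x, x)) as) t) = teval (red s N) as t"
    if "as \<in> tuples (ar Sg f) (carrier N)" for as
    using teval_PGam[OF t tuples_map[OF that], of "\<lambda>x. (x, x)"] by (cases s) (simp_all add: o_def)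
  with t e show ?thesis by auto
qed

definition op_term :: "srt \<Rightarrow> 'f \<Rightarrow> 'f gpair trm" where
  "op_term s f = (SOME t. t \<in> trms GS (ar Sg f) \<and>
     (\<forall>as \<in> tuples (ar Sg f) (carrier N). teval (red s N) as t = oper N f as))"

lemma op_term:
  assumes "f \<in> syms Sg"
  shows "op_term s f \<in> trms GS (ar Sg f)"
    "as \<in> tuples (ar Sg f) (carrier N) \<Longrightarrow> teval (red s N) as (op_term s f) = oper N f as"
  using someI_ex[OF L_term[OF assms, of s, unfolded Bex_def]] by (simp_all add: op_term_def)

text \<open>The name refers to the operation of this term on \<open>\<^bold>P \<odot> \<^bold>Q\<close>, which is that of a rectangular band.\<close>

definition band :: "'f gpair trm" where
  "band = (SOME v. v \<in> trms GS 2 \<and> (\<forall>a \<in> carrier N. \<forall>b \<in> carrier N. \<forall>c \<in> carrier N. \<forall>d \<in> carrier N.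
     teval (PGam N) [(a, b), (c, d)] v = (a, d)))"

lemma band:
  shows "band \<in> trms GS 2"
    "a \<in> carrier N \<Longrightarrow> b \<in> carrier N \<Longrightarrow> teval (red s N) [a, b] band = [a, b] ! idx s"
proof -
  have *: "band \<in> trms GS 2 \<and> (\<forall>a \<in> carrier N. \<forall>b \<in> carrier N. \<forall>c \<in> carrier N. \<forall>d \<in> carrier N.
     teval (PGam N) [(a, b), (c, d)] band = (a, d))"
    unfolding band_def using M unfolding cond_M_def Bex_def by (rule someI_ex)
  then show t: "band \<in> trms GS 2" by simp
  assume ab: "a \<in> carrier N" "b \<in> carrier N"
  have "[(a, a), (b, b)] \<in> tuples 2 (carrier N \<times> carrier N)" using ab by (simp add: tuples_def)
  from teval_PGam[OF t this] * ab show "teval (red s N) [a, b] band = [a, b] ! idx s"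
    by (cases s) auto
qed

text \<open>Identities of \<open>\<^bold>N\<close> hold in the variety that it generates. For (L) and (M) the terms are the
unfoldings of the \<open>\<Gamma>\<close>-terms.\<close>

lemma HSP_N_term:
  assumes P: "P \<in> HSP Sg {N}" and t: "t \<in> trms Sg k" and u: "u \<in> trms Sg k"
    and e: "\<And>as. as \<in> tuples k (carrier N) \<Longrightarrow> teval N as t = teval N as u"
    and as: "as \<in> tuples k (carrier P)"
  shows "teval P as t = teval P as u"
  using HSP_satisfies[OF P _ t u] N e as by (auto simp: satisfies_def)

lemma teval_op_term:
  assumes P: "P \<in> HSP Sg {N}" and f: "f \<in> syms Sg" and as: "as \<in> tuples (ar Sg f) (carrier P)"
  shows "teval (red s P) as (op_term s f) = oper P f as"
proof -
  let ?u = "App f (map Var [0..<ar Sg f])"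
  have u: "teval B bs ?u = oper B f bs" if "length bs = ar Sg f" for B :: "('f, 'x) alg" and bs
    using map_nth[of bs] that by (simp add: o_def)
  have "?u \<in> trms Sg (ar Sg f)" using f by (auto intro!: trms.intros)
  then have "teval P as (unfold_term (\<rho> s) (op_term s f)) = teval P as ?u"
    using op_term[OF f] as
    by (intro HSP_N_term[OF P] unfold_term_trms)
      (auto simp: teval_red[OF op_term(1)[OF f], symmetric] u tuples_length simp del: teval.simps)
  then show ?thesis using as by (simp add: teval_red[OF op_term(1)[OF f]] u tuples_length del: teval.simps)
qed

lemma teval_band:
  assumes P: "P \<in> HSP Sg {N}" and ab: "a \<in> carrier P" "b \<in> carrier P"
  shows "teval (red s P) [a, b] band = [a, b] ! idx s"
proof -
  have "teval P [a, b] (unfold_term (\<rho> s) band) = teval P [a, b] (Var (idx s))"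
  proof (rule HSP_N_term[OF P])
    show "teval N as (unfold_term (\<rho> s) band) = teval N as (Var (idx s))"
      if "as \<in> tuples 2 (carrier N)" for as
      using that band(2)[of "as ! 0" "as ! 1" s]
      by (auto simp: tuples_def teval_red[OF band(1)] length_Suc_conv numeral_2_eq_2)
    show "Var (idx s) \<in> trms Sg 2" by (cases s) (auto intro: trms.intros)
  qed (use ab in \<open>auto simp: tuples_def intro: unfold_term_trms band\<close>)
  then show ?thesis by (simp add: teval_red[OF band(1)])
qed

text \<open>One inclusion holds because homomorphisms preserve terms. For the other one, (L) expresses
the operations of \<open>\<Sigma>\<close> by terms in those of the reduct.\<close>

lemma hom_red:
  assumes P: "P \<in> HSP Sg {N}" and Q: "Q \<in> HSP Sg {N}"
  shows "hom GS (red s P) (red s Q) = hom Sg P Q"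
proof (intro equalityI subsetI)
  fix x assume x: "x \<in> hom Sg P Q"
  show "x \<in> hom GS (red s P) (red s Q)"
    by (rule homI) (use x in \<open>auto simp: hom_def teval_hom[OF HSP_algebra[OF P] x] rho_trms\<close>)
next
  fix x assume x: "x \<in> hom GS (red s P) (red s Q)"
  show "x \<in> hom Sg P Q"
  proof (rule homI)
    fix f as assume f: "f \<in> syms Sg" and as: "as \<in> tuples (ar Sg f) (carrier P)"
    have "x (teval (red s P) as (op_term s f)) = teval (red s Q) (map x as) (op_term s f)"
      using as by (intro teval_hom[OF algebra_red[OF HSP_algebra[OF P]] x _ op_term(1)[OF f]]) simp
    moreover have "map x as \<in> tuples (ar Sg f) (carrier Q)"
      using as by (rule tuples_map) (use x in \<open>auto simp: hom_def\<close>)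
    ultimately show "x (oper P f as) = oper Q f (map x as)"
      using teval_op_term[OF P f as] teval_op_term[OF Q f] by metis
  qed (use x in \<open>auto simp: hom_def\<close>)
qed

lemma HSP_N: "N \<in> HSP Sg {N}"
  using N by (intro HSP_base) auto

lemma HSP_T: "T \<in> HSP Sg {N}"
proof -
  obtain c where c: "carrier T = {c}" using T by (auto simp: trivial_algebra_def)
  have A: "algebra Sg T" using T by (simp add: trivial_algebra_def)
  have "(\<lambda>_\<in>carrier N. c) \<in> hom Sg (subalg N (carrier N)) T"
    using hom_restrictI[OF N, of "\<lambda>_. c" T] algebra_operD[OF A] c
    by (auto simp: tuples_def image_subset_iff)
  moreover have "(\<lambda>_\<in>carrier N. c) ` carrier N = carrier T"
    using N c by (auto simp: algebra_def)
  ultimately show ?thesis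
    using HSP_image[OF HSP_N subuniverse_carrier[OF N]] A by blast
qed

end

section \<open>Decomposing \<open>\<Gamma>\<close>-algebras\<close>

context gamma_setting
begin

text \<open>An isomorphism from \<open>A\<close> to \<open>P S1 \<odot> P S2\<close>, given by its two coordinates \<open>q S1\<close> and \<open>q S2\<close>. Indexing
factors and coordinates by the sort allows one to treat both coordinates by the same argument.\<close>

definition decomposition ::
    "('f gpair, 'a) alg \<Rightarrow> (srt \<Rightarrow> ('f, 'b) alg) \<Rightarrow> (srt \<Rightarrow> 'a \<Rightarrow> 'b) \<Rightarrow> bool" where
  "decomposition A P q \<longleftrightarrow> algebra GS A \<and>
     (\<forall>s. P s \<in> HSP Sg {N} \<and> q s \<in> hom GS A (red s (P s))) \<and>
     bij_betw (\<lambda>a. (q S1 a, q S2 a)) (carrier A) (carrier (P S1) \<times> carrier (P S2))"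

lemma decompositionD:
  assumes "decomposition A P q"
  shows "algebra GS A" "P s \<in> HSP Sg {N}" "q s \<in> hom GS A (red s (P s))"
    "a \<in> carrier A \<Longrightarrow> q s a \<in> carrier (P s)"
  using assms hom_mem[of "q s" GS A "red s (P s)" a] by (auto simp: decomposition_def)

lemma decomposition_eqI:
  assumes "decomposition A P q" "a \<in> carrier A" "b \<in> carrier A" "\<And>s. q s a = q s b"
  shows "a = b"
  using assms by (auto simp: decomposition_def bij_betw_def inj_on_def)

lemma decomposition_ex:
  assumes "decomposition A P q" "\<And>s. p s \<in> carrier (P s)"
  shows "\<exists>a \<in> carrier A. \<forall>s. q s a = p s"
proof -
  have "(p S1, p S2) \<in> (\<lambda>a. (q S1 a, q S2 a)) ` carrier A"
    using assms by (simp add: decomposition_def bij_betw_def)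
  then show ?thesis by (auto simp: forall_srt)
qed

lemma decomposition_surj:
  assumes d: "decomposition A P q"
  shows "q s ` carrier A = carrier (P s)"
proof
  show "carrier (P s) \<subseteq> q s ` carrier A"
  proof
    fix p assume p: "p \<in> carrier (P s)"
    have "\<forall>t. \<exists>u. u \<in> carrier (P t)"
      using HSP_algebra[OF decompositionD(2)[OF d]] unfolding algebra_def by blast
    then obtain u where u: "\<And>t. u t \<in> carrier (P t)" by metis
    have "\<exists>a \<in> carrier A. \<forall>t. q t a = (u(s := p)) t"
      using p u by (intro decomposition_ex[OF d]) auto
    then obtain a where "a \<in> carrier A" "q s a = (u(s := p)) s" by blast
    then show "p \<in> q s ` carrier A" by auto
  qed
qed (use decompositionD(4)[OF d] in auto)

text \<open>Let \<open>A\<close> be a quotient of \<open>U\<close>, and let \<open>k\<close> be the projection of \<open>U\<close> to coordinate \<open>s\<close>. If the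
retraction \<open>e\<close> picks one element from each fibre of \<open>k\<close>, and if it induces a map \<open>w\<close> on \<open>A\<close>, then the
image of \<open>w\<close> is the corresponding factor of \<open>A\<close>: the terms from (L), followed by \<open>w\<close>, make it a \<open>\<Sigma>\<close>-algebra,
and \<open>k x \<mapsto> w (h x)\<close> shows that it is a quotient of a subalgebra of \<open>P0\<close>.\<close>

lemma quotient_factor:
  fixes U :: "('f gpair, 'u) alg" and A :: "('f gpair, 'a) alg" and P0 :: "('f, 'b) alg"
  assumes U: "algebra GS U" and A: "algebra GS A" and P0: "P0 \<in> HSP Sg {N}"
    and h: "h \<in> hom GS U A" "h ` carrier U = carrier A" and k: "k \<in> hom GS U (red s P0)"
    and e: "\<And>x. x \<in> carrier U \<Longrightarrow> e x \<in> carrier U" "\<And>x. x \<in> carrier U \<Longrightarrow> k (e x) = k x"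
      "\<And>x y. x \<in> carrier U \<Longrightarrow> y \<in> carrier U \<Longrightarrow> k x = k y \<Longrightarrow> e x = e y"
    and w: "\<And>x. x \<in> carrier U \<Longrightarrow> w (h x) = h (e x)"
  shows "\<exists>P. P \<in> HSP Sg {N} \<and> carrier P = w ` carrier A \<and> (\<lambda>a\<in>carrier A. w a) \<in> hom GS A (red s P)"
proof -
  let ?t = "op_term s"
  \<comment> \<open>The carrier is a subset of that of \<open>A\<close>, so no new type is needed for the factor.\<close>
  define P where "P = \<lparr>carrier = w ` carrier A, oper = (\<lambda>f as. w (teval A as (?t f)))\<rparr>"
  have wA: "w a \<in> carrier A" if "a \<in> carrier A" for a
    using that w e(1) hom_mem[OF h(1)] unfolding h(2)[symmetric] by auto
  have P: "algebra Sg P"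
    unfolding algebra_def
  proof (intro conjI ballI)
    show "carrier P \<noteq> {}" using A by (auto simp: P_def algebra_def)
    fix f as assume f: "f \<in> syms Sg" and as: "as \<in> tuples (ar Sg f) (carrier P)"
    then have "as \<in> tuples (ar Sg f) (carrier A)" using wA by (auto simp: P_def tuples_def)
    then show "oper P f as \<in> carrier P"
      using teval_mem[OF A _ op_term(1)[OF f]] by (simp add: P_def)
  qed
  let ?V = "k ` carrier U"
  have V: "subuniverse Sg P0 ?V"
    unfolding subuniverse_def
  proof (intro conjI ballI)
    show "?V \<subseteq> carrier P0" "?V \<noteq> {}" using hom_mem[OF k] U by (auto simp: algebra_def)
    fix f bs assume f: "f \<in> syms Sg" and bs: "bs \<in> tuples (ar Sg f) ?V"
    from bs obtain xs where xs: "xs \<in> tuples (ar Sg f) (carrier U)" "bs = map k xs" by (rule tuples_image)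
    have "bs \<in> tuples (ar Sg f) (carrier P0)" using bs \<open>?V \<subseteq> carrier P0\<close> by (auto simp: tuples_def)
    then have "oper P0 f bs = k (teval U xs (?t f))"
      using teval_op_term[OF P0 f] teval_hom[OF U k xs(1) op_term(1)[OF f]] xs(2) by metis
    then show "oper P0 f bs \<in> ?V" using teval_mem[OF U xs(1) op_term(1)[OF f]] by simp
  qed
  have "\<exists>g \<in> hom Sg (subalg P0 ?V) P. \<forall>x \<in> carrier U. g (k x) = w (h x)"
  proof -
    define g where "g = (\<lambda>b. w (h (inv_into (carrier U) k b)))"
    have gk: "g (k x) = w (h x)" if "x \<in> carrier U" for x
      using that w e(3)[of "inv_into (carrier U) k (k x)" x]
      by (simp add: g_def inv_into_into f_inv_into_f)
    have "(\<lambda>b\<in>carrier (subalg P0 ?V). g b) \<in> hom Sg (subalg P0 ?V) P"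
    proof (rule hom_restrictI[OF algebra_subalg[OF V]])
      show "g b \<in> carrier P" if "b \<in> carrier (subalg P0 ?V)" for b
        using that gk hom_mem[OF h(1)] by (auto simp: P_def)
      fix f bs assume f: "f \<in> syms Sg" and bs: "bs \<in> tuples (ar Sg f) (carrier (subalg P0 ?V))"
      then obtain xs where xs: "xs \<in> tuples (ar Sg f) (carrier U)" "bs = map k xs"
        by (auto elim: tuples_image)
      note t = op_term(1)[OF f, of s]
      have ex: "map e xs \<in> tuples (ar Sg f) (carrier U)" using xs(1) by (rule tuples_map) (rule e)
      have m: "map k (map e xs) = map k xs" "map g bs = map h (map e xs)"
        using tuplesD[OF xs(1)] e(2) gk w by (simp_all add: xs(2))
      have "map k xs \<in> tuples (ar Sg f) (carrier P0)"
        using xs(1) by (rule tuples_map) (use hom_mem[OF k] in simp)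
      then have "oper (subalg P0 ?V) f bs = k (teval U xs (?t f))"
        using teval_op_term[OF P0 f] teval_hom[OF U k xs(1) t] by (simp add: xs(2))
      then have "g (oper (subalg P0 ?V) f bs) = h (e (teval U xs (?t f)))"
        using gk w teval_mem[OF U xs(1) t] by simp
      moreover have "k (teval U xs (?t f)) = k (teval U (map e xs) (?t f))"
        using teval_hom[OF U k xs(1) t] teval_hom[OF U k ex t] m(1) by metis
      then have "e (teval U xs (?t f)) = e (teval U (map e xs) (?t f))"
        using e(3) teval_mem[OF U _ t] xs(1) ex by blast
      moreover have "oper P f (map g bs) = w (h (teval U (map e xs) (?t f)))"
        using teval_hom[OF U h(1) ex t] m(2) by (simp add: P_def)
      ultimately show "g (oper (subalg P0 ?V) f bs) = oper P f (map g bs)"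
        using w teval_mem[OF U ex t] by simp
    qed
    then show ?thesis using gk by (intro bexI[of _ "\<lambda>b\<in>carrier (subalg P0 ?V). g b"]) auto
  qed
  then obtain g where g: "g \<in> hom Sg (subalg P0 ?V) P" and gk: "\<And>x. x \<in> carrier U \<Longrightarrow> g (k x) = w (h x)"
    by blast
  have "g ` ?V = carrier P"
    unfolding P_def using gk h(2) by (force simp: image_image)
  then have HP: "P \<in> HSP Sg {N}" by (rule HSP_image[OF P0 V g _ P])
  have "(\<lambda>a\<in>carrier A. w a) \<in> hom GS A (red s P)"
  proof (rule hom_restrictI[OF A])
    fix \<gamma> as assume \<gamma>: "\<gamma> \<in> syms GS" and as: "as \<in> tuples (ar GS \<gamma>) (carrier A)"
    then obtain xs where xs: "xs \<in> tuples (ar GS \<gamma>) (carrier U)" "as = map h xs"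
      unfolding h(2)[symmetric] by (metis tuples_image)
    have kx: "map k xs \<in> tuples (fst \<gamma>) (carrier (subalg P0 ?V))"
      using xs(1) by (auto simp: tuples_def)
    have "w (oper A \<gamma> as) = g (k (oper U \<gamma> xs))"
      using gk algebra_operD[OF U \<gamma> xs(1)] by (simp add: xs(2) hom_oper[OF h(1) \<gamma> xs(1)])
    also have "\<dots> = g (teval (subalg P0 ?V) (map k xs) (\<rho> s \<gamma>))"
      by (simp add: hom_oper[OF k \<gamma> xs(1)])
    also have "\<dots> = teval P (map g (map k xs)) (\<rho> s \<gamma>)"
      using \<gamma> by (intro teval_hom[OF algebra_subalg[OF V] g kx] rho_trms) simp
    also have "map g (map k xs) = map w as"
      using tuplesD[OF xs(1)] gk by (simp add: xs(2))
    finally show "w (oper A \<gamma> as) = oper (red s P) \<gamma> (map w as)" by simp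
  qed (simp add: P_def)
  with HP show ?thesis by (auto simp: P_def)
qed

text \<open>Let \<open>h\<close> map a subalgebra \<open>S\<close> of a product of algebras \<open>G1 i \<odot> G2 i\<close> onto \<open>A\<close>. On \<open>S\<close> the band term takes the
first coordinates from one argument and the second coordinates from the other. Fixing one argument at
\<open>z \<in> S\<close> gives a retraction of \<open>S\<close> that forgets one half of the coordinates, and \<open>quotient_factor\<close>
produces the two factors.\<close>

lemma HSP_odot_decomposes:
  fixes A :: "('f gpair, 'a) alg"
  assumes "A \<in> HSP GS {odot r1 r2 P Q | (P :: ('f, 'p) alg) (Q :: ('f, 'q) alg). P \<in> HSP Sg {N} \<and> Q \<in> HSP Sg {N}}"
    (is "A \<in> HSP GS ?K")
  obtains P :: "srt \<Rightarrow> ('f, 'a) alg" and q where "decomposition A P q"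
proof -
  note A = HSP_algebra[OF assms]
  obtain I :: "(('f gpair, 'p \<times> 'q) alg \<times> ('a \<Rightarrow> 'p \<times> 'q)) set" and F S h where
    F: "\<forall>i\<in>I. F i \<in> ?K"
    and S: "subuniverse GS (prod_alg I F) S"
    and h: "h \<in> hom GS (subalg (prod_alg I F) S) A" "h ` S = carrier A"
    using assms by (rule HSP_E)
  from F have "\<forall>i\<in>I. \<exists>(P :: ('f, 'p) alg) (Q :: ('f, 'q) alg). F i = odot r1 r2 P Q \<and> P \<in> HSP Sg {N} \<and> Q \<in> HSP Sg {N}"
    by blast
  then obtain G1 :: "_ \<Rightarrow> ('f, 'p) alg" and G2 :: "_ \<Rightarrow> ('f, 'q) alg" where
    G: "\<And>i. i \<in> I \<Longrightarrow> F i = odot r1 r2 (G1 i) (G2 i)"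
       "\<And>i. i \<in> I \<Longrightarrow> G1 i \<in> HSP Sg {N}" "\<And>i. i \<in> I \<Longrightarrow> G2 i \<in> HSP Sg {N}"
    by metis
  note GA = HSP_algebra[OF G(2)] HSP_algebra[OF G(3)]
  have FA: "algebra GS (F i)" if "i \<in> I" for i using algebra_odot[OF GA(1)[OF that] GA(2)[OF that]] G(1)[OF that] by simp
  let ?B = "prod_alg I F" and ?P1 = "prod_alg I G1" and ?P2 = "prod_alg I G2"
  let ?U = "subalg ?B S"
  note U = algebra_subalg[OF S]
  have SB: "S \<subseteq> carrier ?B" using S by (simp add: subuniverse_def)
  have mem: "x i \<in> carrier (G1 i) \<times> carrier (G2 i)" if "x \<in> S" "i \<in> I" for x i
  proof -
    have "x i \<in> carrier (F i)" using SB that by auto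
    then show ?thesis using G(1)[OF that(2)] by simp
  qed
  have P1: "?P1 \<in> HSP Sg {N}" and P2: "?P2 \<in> HSP Sg {N}"
    using G by (auto intro: HSP_prod)
  define k1 where "k1 = (\<lambda>(x :: _ \<Rightarrow> 'p \<times> 'q). \<lambda>i\<in>I. fst (x i))"
  define k2 where "k2 = (\<lambda>(x :: _ \<Rightarrow> 'p \<times> 'q). \<lambda>i\<in>I. snd (x i))"
  have coord: "(\<lambda>x\<in>carrier ?U. \<lambda>i\<in>I. \<pi> (x i)) \<in> hom GS ?U (red s (prod_alg I G))"
    if G: "\<And>i. i \<in> I \<Longrightarrow> algebra Sg (G i)" and \<pi>: "\<And>x i. x \<in> S \<Longrightarrow> i \<in> I \<Longrightarrow> \<pi> (x i) \<in> carrier (G i)"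
      and op: "\<And>i \<gamma> ps. i \<in> I \<Longrightarrow> \<pi> (oper (F i) \<gamma> ps) = teval (G i) (map \<pi> ps) (\<rho> s \<gamma>)"
    for G :: "_ \<Rightarrow> ('f, 'c) alg" and \<pi> s
  proof (rule hom_restrictI[OF U])
    let ?k = "\<lambda>x. \<lambda>i\<in>I. \<pi> (x i)"
    show kP: "?k x \<in> carrier (red s (prod_alg I G))" if "x \<in> carrier ?U" for x
      using \<pi> that by auto
    fix \<gamma> xs assume \<gamma>: "\<gamma> \<in> syms GS" and xs: "xs \<in> tuples (ar GS \<gamma>) (carrier ?U)"
    have kx: "map ?k xs \<in> tuples (fst \<gamma>) (carrier (prod_alg I G))"
      by (rule tuples_map[OF xs[unfolded gsgn_simps]]) (rule kP[unfolded carrier_reduct])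
    have r: "\<rho> s \<gamma> \<in> trms Sg (fst \<gamma>)" using \<gamma> rho_trms by simp
    have "teval (prod_alg I G) (map ?k xs) (\<rho> s \<gamma>) \<in> carrier (prod_alg I G)"
      by (rule teval_mem[OF algebra_prod[OF G] kx r])
    moreover have "teval (prod_alg I G) (map ?k xs) (\<rho> s \<gamma>) i = \<pi> (oper ?B \<gamma> xs i)" if i: "i \<in> I" for i
      using i teval_prod[OF G i kx r] by (simp add: oper_prod_alg op o_def)
    ultimately have "teval (prod_alg I G) (map ?k xs) (\<rho> s \<gamma>) i = ?k (oper ?B \<gamma> xs) i" for i
      using PiE_arb[of _ I _ i] by (cases "i \<in> I") auto
    then show "?k (oper ?U \<gamma> xs) = oper (red s (prod_alg I G)) \<gamma> (map ?k xs)" by auto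
  qed
  have k1: "(\<lambda>x\<in>carrier ?U. k1 x) \<in> hom GS ?U (red S1 ?P1)"
    unfolding k1_def using mem by (intro coord GA(1)) (force simp: G(1) oper_odot)+
  have k2: "(\<lambda>x\<in>carrier ?U. k2 x) \<in> hom GS ?U (red S2 ?P2)"
    unfolding k2_def using mem by (intro coord GA(2)) (force simp: G(1) oper_odot)+
  define v where "v = (\<lambda>(x :: _ \<Rightarrow> 'p \<times> 'q) (y :: _ \<Rightarrow> 'p \<times> 'q). \<lambda>i\<in>I. (fst (x i), snd (y i)))"
  have band_v: "teval ?U [x, y] band = v x y" if xy: "x \<in> S" "y \<in> S" for x y
  proof -
    have t: "[x, y] \<in> tuples 2 (carrier ?B)" using xy SB by (auto simp: tuples_def)
    have "teval ?B [x, y] band \<in> carrier ?B"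
      by (rule teval_mem[OF algebra_prod[OF FA] t band(1)])
    moreover have "teval ?B [x, y] band i = v x y i" if i: "i \<in> I" for i
    proof -
      have "teval ?B [x, y] band i = teval (odot r1 r2 (G1 i) (G2 i)) [x i, y i] band"
        using teval_prod[OF FA i t band(1)] G(1)[OF i] by simp
      also have "\<dots> = (fst (x i), snd (y i))"
        using mem[OF xy(1) i] mem[OF xy(2) i] teval_band[OF G(2)[OF i], of "fst (x i)" "fst (y i)" S1]
          teval_band[OF G(3)[OF i], of "snd (x i)" "snd (y i)" S2]
        by (subst teval_odot[OF GA(1)[OF i] GA(2)[OF i] band(1)]) (auto simp: tuples_def)
      finally show ?thesis using i by (simp add: v_def)
    qed
    ultimately have "teval ?B [x, y] band i = v x y i" for i
      using PiE_arb[of _ I _ i] by (cases "i \<in> I") (auto simp: v_def)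
    then show ?thesis by auto
  qed
  have vS: "v x y \<in> S" if "x \<in> S" "y \<in> S" for x y
    using subuniverse_teval[OF S, of "[x, y]" 2 band] band_v[OF that] that band(1)
    by (simp add: tuples_def)
  have v_idem: "v x x = x" if "x \<in> S" for x
  proof
    show "v x x i = x i" for i
      using SB that PiE_arb[of x I _ i] by (cases "i \<in> I") (auto simp: v_def)
  qed
  have v_v: "v (v x y) z = v x z" "v x (v y z) = v x z" for x y z
    by (auto simp: v_def)
  have kv: "k1 (v x y) = k1 x" "k2 (v x y) = k2 y" for x y
    by (auto simp: v_def k1_def k2_def)
  have vk: "v x z = v y z" if "k1 x = k1 y" for x y z
  proof
    show "v x z i = v y z i" for i using fun_cong[OF that, of i] by (auto simp: v_def k1_def)
  qed
  have vk': "v z x = v z y" if "k2 x = k2 y" for x y z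
  proof
    show "v z x i = v z y i" for i using fun_cong[OF that, of i] by (auto simp: v_def k2_def)
  qed
  define m where "m = (\<lambda>a b. teval A [a, b] band)"
  have mh: "m (h x) (h y) = h (v x y)" if "x \<in> S" "y \<in> S" for x y
    using teval_hom[OF U h(1), of "[x, y]" 2 band] that band(1)
    by (simp add: m_def band_v[OF that, simplified] tuples_def)
  obtain z where z: "z \<in> S" using S by (auto simp: subuniverse_def)
  \<comment> \<open>\<open>w S1\<close> forgets the second coordinate and \<open>w S2\<close> the first: it is replaced by that of \<open>h z\<close>.\<close>
  define w where "w = (\<lambda>s a. case_srt (m a (h z)) (m (h z) a) s)"
  have "\<exists>P. P \<in> HSP Sg {N} \<and> carrier P = w S1 ` carrier A \<and> (\<lambda>a\<in>carrier A. w S1 a) \<in> hom GS A (red S1 P)"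
  proof (rule quotient_factor[OF U A P1 h(1) _ k1, where e = "\<lambda>x. v x z"])
    show "v x z = v y z"
      if "x \<in> carrier ?U" "y \<in> carrier ?U" "restrict k1 (carrier ?U) x = restrict k1 (carrier ?U) y" for x y
      using that by (intro vk) simp
  qed (use h(2) vS z kv mh in \<open>simp_all add: w_def\<close>)
  moreover have "\<exists>P. P \<in> HSP Sg {N} \<and> carrier P = w S2 ` carrier A \<and> (\<lambda>a\<in>carrier A. w S2 a) \<in> hom GS A (red S2 P)"
  proof (rule quotient_factor[OF U A P2 h(1) _ k2, where e = "\<lambda>x. v z x"])
    show "v z x = v z y"
      if "x \<in> carrier ?U" "y \<in> carrier ?U" "restrict k2 (carrier ?U) x = restrict k2 (carrier ?U) y" for x y
      using that by (intro vk') simp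
  qed (use h(2) vS z kv mh in \<open>simp_all add: w_def\<close>)
  ultimately have "\<forall>s. \<exists>P. P \<in> HSP Sg {N} \<and> carrier P = w s ` carrier A \<and> (\<lambda>a\<in>carrier A. w s a) \<in> hom GS A (red s P)"
    by (simp add: forall_srt)
  then obtain P where P: "\<And>s. P s \<in> HSP Sg {N}" "\<And>s. carrier (P s) = w s ` carrier A"
    "\<And>s. (\<lambda>a\<in>carrier A. w s a) \<in> hom GS A (red s (P s))"
    by metis
  have wh: "w S1 (h x) = h (v x z)" "w S2 (h x) = h (v z x)" if "x \<in> S" for x
    using that z by (simp_all add: w_def mh)
  have "inj_on (\<lambda>a. (w S1 a, w S2 a)) (carrier A)"
  proof (rule inj_on_inverseI[where g = "\<lambda>(a, b). m a b"])
    show "(\<lambda>(a, b). m a b) (w S1 a, w S2 a) = a" if "a \<in> carrier A" for a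
      using that unfolding h(2)[symmetric] by (auto simp: wh mh vS z v_v v_idem)
  qed
  moreover have "(\<lambda>a. (w S1 a, w S2 a)) ` carrier A = carrier (P S1) \<times> carrier (P S2)"
  proof
    show "carrier (P S1) \<times> carrier (P S2) \<subseteq> (\<lambda>a. (w S1 a, w S2 a)) ` carrier A"
    proof safe
      fix a b assume "a \<in> carrier (P S1)" "b \<in> carrier (P S2)"
      then obtain x y where xy: "x \<in> S" "y \<in> S" "a = w S1 (h x)" "b = w S2 (h y)"
        unfolding P(2) h(2)[symmetric] by blast
      then have "(a, b) = (w S1 (h (v x y)), w S2 (h (v x y)))"
        by (simp add: wh vS v_v)
      then show "(a, b) \<in> (\<lambda>a. (w S1 a, w S2 a)) ` carrier A"
        using vS[OF xy(1,2)] h(2) by blast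
    qed
  qed (auto simp: P(2))
  ultimately have "bij_betw (\<lambda>a. (w S1 a, w S2 a)) (carrier A) (carrier (P S1) \<times> carrier (P S2))"
    by (simp add: bij_betw_def)
  then have "bij_betw (\<lambda>a. ((\<lambda>a\<in>carrier A. w S1 a) a, (\<lambda>a\<in>carrier A. w S2 a) a)) (carrier A) (carrier (P S1) \<times> carrier (P S2))"
    by (subst bij_betw_cong[where g = "\<lambda>a. (w S1 a, w S2 a)"]) simp_all
  then have "decomposition A P (\<lambda>s. \<lambda>a\<in>carrier A. w s a)"
    unfolding decomposition_def by (intro conjI allI A P)
  then show thesis by (rule that)
qed

lemma odot_decomposition:
  assumes d: "decomposition A P q"
  shows "alg_iso GS A (odot r1 r2 (P S1) (P S2)) (\<lambda>a\<in>carrier A. (q S1 a, q S2 a))"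
proof -
  note A = decompositionD(1)[OF d]
  have "(\<lambda>a\<in>carrier A. (q S1 a, q S2 a)) \<in> hom GS A (odot r1 r2 (P S1) (P S2))"
    by (rule hom_restrictI[OF A])
      (auto simp: decompositionD(4)[OF d] oper_odot o_def hom_oper[OF decompositionD(3)[OF d]])
  moreover have "bij_betw (\<lambda>a\<in>carrier A. (q S1 a, q S2 a)) (carrier A) (carrier (P S1) \<times> carrier (P S2))"
    using d by (subst bij_betw_cong[where g = "\<lambda>a. (q S1 a, q S2 a)"]) (simp_all add: decomposition_def)
  ultimately show ?thesis by (simp add: alg_iso_def)
qed

subsection \<open>The algebras \<open>\<^bold>N \<odot> \<^bold>T\<close> and \<open>\<^bold>T \<odot> \<^bold>N\<close>\<close>

definition pt :: 'n where "pt = the_elem (carrier T)"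

lemma carrier_T: "carrier T = {pt}"
  using T the_elem_eq unfolding pt_def trivial_algebra_def by metis

lemma T_algebra: "algebra Sg T"
  using T by (simp add: trivial_algebra_def)

text \<open>The identification of \<open>N\<close> with the carrier of \<open>\<^bold>N \<odot> \<^bold>T\<close>, respectively \<open>\<^bold>T \<odot> \<^bold>N\<close>; its inverse is \<open>pr\<close>.\<close>

definition emb :: "srt \<Rightarrow> 'n \<Rightarrow> 'n \<times> 'n" where
  "emb s a = case_srt (a, pt) (pt, a) s"

lemma emb_simps: "emb S1 a = (a, pt)" "emb S2 a = (pt, a)"
  by (simp_all add: emb_def)

lemma pr_emb [simp]: "pr s (emb s a) = a"
  by (cases s) (simp_all add: emb_simps)

lemma emb_eq_iff [simp]: "emb s a = emb s b \<longleftrightarrow> a = b"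
  by (metis pr_emb)

abbreviation MM :: "srt \<Rightarrow> ('f gpair, 'n \<times> 'n) alg" where
  "MM \<equiv> Malg r1 r2 N T"

lemma MM_simps: "MM S1 = odot r1 r2 N T" "MM S2 = odot r1 r2 T N"
  by (simp_all add: Malg_def)

lemma carrier_MM: "carrier (MM s) = emb s ` carrier N"
  by (cases s) (auto simp: MM_simps carrier_T emb_simps)

lemma emb_pr: "p \<in> carrier (MM s) \<Longrightarrow> emb s (pr s p) = p"
  by (auto simp: carrier_MM)

lemma algebra_MM: "algebra GS (MM s)"
  using algebra_odot N T_algebra by (cases s) (simp_all add: MM_simps)

lemma pr_hom: "(\<lambda>p\<in>carrier (MM s). pr s p) \<in> hom GS (MM s) (red s N)"
  using odot_fst_hom[OF N T_algebra] odot_snd_hom[OF T_algebra N] by (cases s) (simp_all add: MM_simps)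

lemma emb_hom: "(\<lambda>a\<in>carrier N. emb s a) \<in> hom GS (red s N) (MM s)"
proof -
  have bij: "bij_betw (\<lambda>p\<in>carrier (MM s). pr s p) (carrier (MM s)) (carrier N)"
    by (rule bij_betw_byWitness[where f' = "emb s"]) (auto simp: carrier_MM)
  have "inv_into (carrier (MM s)) (\<lambda>p\<in>carrier (MM s). pr s p) a = emb s a" if "a \<in> carrier N" for a
    using that bij by (intro inv_into_f_eq) (auto simp: carrier_MM bij_betw_def)
  then have "(\<lambda>a\<in>carrier N. inv_into (carrier (MM s)) (\<lambda>p\<in>carrier (MM s). pr s p) a) = (\<lambda>a\<in>carrier N. emb s a)"
    by (intro restrict_ext) simp
  with alg_iso_inverse[OF algebra_MM[of s], of "red s N" "\<lambda>p\<in>carrier (MM s). pr s p"] bij pr_hom[of s]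
  show ?thesis by (simp add: alg_iso_def)
qed

definition lift :: "('f gpair, 'a) alg \<Rightarrow> (srt \<Rightarrow> 'a \<Rightarrow> 'b) \<Rightarrow> srt \<Rightarrow> ('b \<Rightarrow> 'n) \<Rightarrow> 'a \<Rightarrow> 'n \<times> 'n" where
  "lift A q s x = (\<lambda>a\<in>carrier A. emb s (x (q s a)))"

text \<open>Identifying \<open>N\<close> with the carrier of \<open>MM s\<close>, \<open>lift\<close> is composition with the coordinate \<open>q s\<close>.\<close>

lemma lift_hom:
  assumes d: "decomposition A P q" and x: "x \<in> hom Sg (P s) N"
  shows "lift A q s x \<in> hom GS A (MM s)"
proof -
  note A = decompositionD(1)[OF d] and P = decompositionD(2)[OF d] and q = decompositionD(3)[OF d]
  have "x \<in> hom GS (red s (P s)) (red s N)"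
    using x hom_red[OF P HSP_N] by simp
  from hom_comp[OF A hom_comp[OF A q this] emb_hom]
  have *: "(\<lambda>a\<in>carrier A. (\<lambda>a\<in>carrier N. emb s a) ((\<lambda>a\<in>carrier A. x (q s a)) a)) \<in> hom GS A (MM s)" .
  have "(\<lambda>a\<in>carrier A. (\<lambda>a\<in>carrier N. emb s a) ((\<lambda>a\<in>carrier A. x (q s a)) a)) = lift A q s x"
    unfolding lift_def
    by (intro restrict_ext) (simp add: hom_mem[OF x decompositionD(4)[OF d]])
  with * show ?thesis by simp
qed

text \<open>If \<open>a\<close> and \<open>b\<close> agree in coordinate \<open>s\<close>, then \<open>band(a, b)\<close> is one of them, as its other coordinate
comes from \<open>b\<close> (for the first sort) or from \<open>a\<close> (for the second one). But in the target the other coordinate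
carries no information, so \<open>y\<close> takes at \<open>band(a, b)\<close> the value that it takes at the other of the two. Hence \<open>y\<close> factors through \<open>q s\<close>.\<close>

lemma hom_eq_lift:
  assumes d: "decomposition A P q" and y: "y \<in> hom GS A (MM s)"
  obtains x where "x \<in> hom Sg (P s) N" "y = lift A q s x"
proof -
  note A = decompositionD(1)[OF d] and P = decompositionD(2)[OF d] and q = decompositionD(3)[OF d]
  note PA = algebra_red[OF HSP_algebra[OF P]]
  define y' where "y' = (\<lambda>a\<in>carrier A. pr s (y a))"
  have "(\<lambda>a\<in>carrier A. (\<lambda>p\<in>carrier (MM s). pr s p) (y a)) = y'"
    unfolding y'_def by (intro restrict_ext) (simp add: hom_mem[OF y])
  then have y': "y' \<in> hom GS A (red s N)" using hom_comp[OF A y pr_hom] by simp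
  have ker: "y' a = y' b" if ab: "a \<in> carrier A" "b \<in> carrier A" and e: "q s a = q s b" for a b
  proof -
    have t: "[a, b] \<in> tuples 2 (carrier A)" using ab by (simp add: tuples_def)
    let ?c = "teval A [a, b] band"
    have c: "?c \<in> carrier A" by (rule teval_mem[OF A t band(1)])
    have qc: "q s' ?c = [q s' a, q s' b] ! idx s'" for s'
      using teval_hom[OF A q t band(1), of s'] teval_band[OF P decompositionD(4)[OF d ab(1)] decompositionD(4)[OF d ab(2)]]
      by simp
    have yc: "y' ?c = [y' a, y' b] ! idx s"
      using teval_hom[OF A y' t band(1)] teval_band[OF HSP_N, of "y' a" "y' b" s] hom_mem[OF y'] ab
      by simp
    \<comment> \<open>For \<open>S1\<close>, the second coordinate of the band comes from \<open>b\<close> and the first ones agree; dually for \<open>S2\<close>.\<close>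
    have "?c = (case s of S1 \<Rightarrow> b | S2 \<Rightarrow> a)"
    proof (rule decomposition_eqI[OF d c])
      show "q s' ?c = q s' (case s of S1 \<Rightarrow> b | S2 \<Rightarrow> a)" for s'
        using e qc by (cases s; cases s') auto
    qed (use ab in \<open>auto split: srt.split\<close>)
    with yc show ?thesis by (cases s) auto
  qed
  have "q s ` carrier A = carrier (red s (P s))" using decomposition_surj[OF d] by simp
  from hom_factor[OF A PA q this y' ker] obtain x where
    x: "x \<in> hom GS (red s (P s)) (red s N)" "\<And>a. a \<in> carrier A \<Longrightarrow> x (q s a) = y' a" by blast
  have "y = lift A q s x"
  proof
    show "y a = lift A q s x a" for a
      using y x(2) emb_pr[OF hom_mem[OF y]] by (cases "a \<in> carrier A") (auto simp: lift_def y'_def hom_def)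
  qed
  with x(1) show thesis using that hom_red[OF P HSP_N] by blast
qed

lemma decomposed_ISP:
  fixes A :: "('f gpair, 'a) alg" and P :: "srt \<Rightarrow> ('f, 'b) alg"
  assumes d: "decomposition A P q"
    and sep: "\<And>s p p'. p \<in> carrier (P s) \<Longrightarrow> p' \<in> carrier (P s) \<Longrightarrow> p \<noteq> p' \<Longrightarrow> \<exists>x \<in> hom Sg (P s) N. x p \<noteq> x p'"
  shows "A \<in> ISP GS {odot r1 r2 N T, odot r1 r2 T N}"
proof (rule ISP_if_separated[OF decompositionD(1)[OF d]])
  show "algebra GS B" if "B \<in> {odot r1 r2 N T, odot r1 r2 T N}" for B
    using that algebra_odot N T_algebra by auto
  fix a b assume ab: "a \<in> carrier A" "b \<in> carrier A" "a \<noteq> b"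
  then obtain s where s: "q s a \<noteq> q s b" using decomposition_eqI[OF d] by blast
  obtain x where x: "x \<in> hom Sg (P s) N" "x (q s a) \<noteq> x (q s b)"
    using sep[OF _ _ s] decompositionD(4)[OF d] ab by blast
  have "lift A q s x a \<noteq> lift A q s x b" using x(2) ab by (simp add: lift_def)
  moreover have "MM s \<in> {odot r1 r2 N T, odot r1 r2 T N}" by (cases s) (auto simp: MM_simps)
  ultimately show "\<exists>B\<in>{odot r1 r2 N T, odot r1 r2 T N}. \<exists>x\<in>hom GS A B. x a \<noteq> x b"
    using lift_hom[OF d x(1)] by blast
qed

end
section \<open>Structures and their morphisms\<close>

lemma is_structD:
  assumes "is_struct ss X"
  shows "g \<in> gsyms ss \<Longrightarrow> xs \<in> tuples (gar ss g) (scar X) \<Longrightarrow> sop X g xs \<in> scar X"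
    "r \<in> rsyms ss \<Longrightarrow> xs \<in> srel X r \<Longrightarrow> xs \<in> tuples (rar ss r) (scar X)"
  using assms unfolding is_struct_def by blast+

lemma morD:
  assumes "\<phi> \<in> mor ss X Y"
  shows "x \<in> scar X \<Longrightarrow> \<phi> x \<in> scar Y" "continuous_map (stop X) (stop Y) \<phi>"
    "g \<in> gsyms ss \<Longrightarrow> xs \<in> tuples (gar ss g) (scar X) \<Longrightarrow> \<phi> (sop X g xs) = sop Y g (map \<phi> xs)"
    "r \<in> rsyms ss \<Longrightarrow> xs \<in> srel X r \<Longrightarrow> map \<phi> xs \<in> srel Y r"
    "x \<notin> scar X \<Longrightarrow> \<phi> x = undefined"
  using assms unfolding mor_def by auto

lemma mor_eqI:
  assumes "\<phi> \<in> mor ss X Y" "\<psi> \<in> mor ss X Y" "\<And>x. x \<in> scar X \<Longrightarrow> \<phi> x = \<psi> x"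
  shows "\<phi> = \<psi>"
  using assms morD(5) by (metis ext)

lemma mor_restrictI:
  assumes X: "is_struct ss X" and m: "\<And>x. x \<in> scar X \<Longrightarrow> \<phi> x \<in> scar Y"
    and c: "continuous_map (stop X) (stop Y) \<phi>"
    and g: "\<And>g xs. g \<in> gsyms ss \<Longrightarrow> xs \<in> tuples (gar ss g) (scar X) \<Longrightarrow> \<phi> (sop X g xs) = sop Y g (map \<phi> xs)"
    and r: "\<And>r xs. r \<in> rsyms ss \<Longrightarrow> xs \<in> srel X r \<Longrightarrow> map \<phi> xs \<in> srel Y r"
  shows "(\<lambda>x\<in>scar X. \<phi> x) \<in> mor ss X Y"
  unfolding mor_def
proof (intro CollectI conjI ballI)
  show "(\<lambda>x\<in>scar X. \<phi> x) \<in> scar X \<rightarrow>\<^sub>E scar Y" using m by auto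
  show "continuous_map (stop X) (stop Y) (\<lambda>x\<in>scar X. \<phi> x)"
    by (rule continuous_map_eq[OF c]) (simp add: is_struct_topspace[OF X])
  fix h xs assume h: "h \<in> gsyms ss" "xs \<in> tuples (gar ss h) (scar X)"
  then show "(\<lambda>x\<in>scar X. \<phi> x) (sop X h xs) = sop Y h (map (\<lambda>x\<in>scar X. \<phi> x) xs)"
    unfolding map_restrict[OF h(2)] using g[OF h] is_structD(1)[OF X h] by simp
next
  fix q xs assume q: "q \<in> rsyms ss" "xs \<in> srel X q"
  show "map (\<lambda>x\<in>scar X. \<phi> x) xs \<in> srel Y q"
    unfolding map_restrict[OF is_structD(2)[OF X q]] by (rule r[OF q])
qed

lemma mor_comp:
  assumes X: "is_struct ss X" and \<phi>: "\<phi> \<in> mor ss X Y" and \<psi>: "\<psi> \<in> mor ss Y Z"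
  shows "(\<lambda>x\<in>scar X. \<psi> (\<phi> x)) \<in> mor ss X Z"
proof (rule mor_restrictI[OF X])
  show "continuous_map (stop X) (stop Z) (\<lambda>x. \<psi> (\<phi> x))"
    using continuous_map_compose[OF morD(2)[OF \<phi>] morD(2)[OF \<psi>]] by (simp add: o_def)
  fix g xs assume g: "g \<in> gsyms ss" and xs: "xs \<in> tuples (gar ss g) (scar X)"
  have "map \<phi> xs \<in> tuples (gar ss g) (scar Y)" using xs by (rule tuples_map) (rule morD(1)[OF \<phi>])
  then show "\<psi> (\<phi> (sop X g xs)) = sop Z g (map (\<lambda>x. \<psi> (\<phi> x)) xs)"
    by (simp add: morD(3)[OF \<phi> g xs] morD(3)[OF \<psi> g] o_def)
next
  fix r xs assume "r \<in> rsyms ss" "xs \<in> srel X r"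
  from morD(4)[OF \<psi> this(1) morD(4)[OF \<phi> this]]
  show "map (\<lambda>x. \<psi> (\<phi> x)) xs \<in> srel Z r" by (simp add: o_def)
qed (use morD(1)[OF \<phi>] morD(1)[OF \<psi>] in blast)

lemma mor_id: "is_struct ss X \<Longrightarrow> (\<lambda>x\<in>scar X. x) \<in> mor ss X X"
  using mor_restrictI[of ss X "\<lambda>x. x" X] by simp

lemma str_iso_morD: "str_iso ss X Y \<phi> \<Longrightarrow> \<phi> \<in> mor ss X Y"
  by (simp add: str_iso_def)

lemma str_iso_comp:
  assumes X: "is_struct ss X" and Z: "is_struct ss Z"
    and \<phi>: "str_iso ss X Y \<phi>" and \<psi>: "str_iso ss Y Z \<psi>"
  shows "str_iso ss X Z (\<lambda>x\<in>scar X. \<psi> (\<phi> x))"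
proof -
  obtain \<phi>' \<psi>' where m: "\<phi> \<in> mor ss X Y" "\<phi>' \<in> mor ss Y X" "\<psi> \<in> mor ss Y Z" "\<psi>' \<in> mor ss Z Y"
    and i: "\<And>x. x \<in> scar X \<Longrightarrow> \<phi>' (\<phi> x) = x" "\<And>y. y \<in> scar Y \<Longrightarrow> \<phi> (\<phi>' y) = y"
      "\<And>y. y \<in> scar Y \<Longrightarrow> \<psi>' (\<psi> y) = y" "\<And>z. z \<in> scar Z \<Longrightarrow> \<psi> (\<psi>' z) = z"
    using \<phi> \<psi> unfolding str_iso_def by blast
  show ?thesis
    unfolding str_iso_def
    using mor_comp[OF X m(1,3)] mor_comp[OF Z m(4,2)] i
    by (auto simp: morD(1)[OF m(1)] morD(1)[OF m(2)] morD(1)[OF m(3)] morD(1)[OF m(4)]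
        intro!: bexI[of _ "\<lambda>z\<in>scar Z. \<phi>' (\<psi>' z)"])
qed

section \<open>Substructures of powers\<close>

lemma power_str_simps:
  "scar (restr (power_str S NT) Y) = Y"
  "sop (restr (power_str S NT) Y) g xs = (\<lambda>s\<in>S. sop NT g (map (\<lambda>x. x s) xs))"
  "stop (restr (power_str S NT) Y) = subtopology (product_topology (\<lambda>_. stop NT) S) Y"
  by (simp_all add: restr_def power_str_def)

lemma srel_power:
  "Y \<subseteq> S \<rightarrow>\<^sub>E scar NT \<Longrightarrow> xs \<in> srel (restr (power_str S NT) Y) r \<longleftrightarrow>
    set xs \<subseteq> Y \<and> (\<forall>s\<in>S. map (\<lambda>x. x s) xs \<in> srel NT r)"
  by (auto simp: restr_def power_str_def)

text \<open>Subsets of a non-empty power that are closed under the operations, not necessarily in the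
topology. This suffices for them to be structures with the pointwise relations.\<close>

definition subpower :: "('g, 'r) ssgn \<Rightarrow> 's set \<Rightarrow> ('g, 'r, 'x) tstruct \<Rightarrow> ('s \<Rightarrow> 'x) set \<Rightarrow> bool" where
  "subpower ss S NT Y \<longleftrightarrow> S \<noteq> {} \<and> Y \<subseteq> S \<rightarrow>\<^sub>E scar NT \<and>
     (\<forall>g \<in> gsyms ss. \<forall>ys \<in> tuples (gar ss g) Y. (\<lambda>s\<in>S. sop NT g (map (\<lambda>y. y s) ys)) \<in> Y)"

lemma is_struct_subpower:
  assumes NT: "is_struct ss NT" and Y: "subpower ss S NT Y"
  shows "is_struct ss (restr (power_str S NT) Y)"
proof -
  have YS: "Y \<subseteq> S \<rightarrow>\<^sub>E scar NT" and "S \<noteq> {}" using Y by (simp_all add: subpower_def)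
  then obtain s where s: "s \<in> S" by blast
  have "xs \<in> tuples (rar ss r) Y" if r: "r \<in> rsyms ss" and xs: "xs \<in> srel (restr (power_str S NT) Y) r" for r xs
  proof -
    have "set xs \<subseteq> Y" "map (\<lambda>x. x s) xs \<in> srel NT r" using xs s by (auto simp: srel_power[OF YS])
    then show ?thesis using is_structD(2)[OF NT r] by (fastforce simp: tuples_def)
  qed
  then show ?thesis
    using Y YS is_struct_topspace[OF NT] by (auto simp: is_struct_def power_str_simps subpower_def)
qed

lemma proj_mor:
  assumes NT: "is_struct ss NT" and Y: "subpower ss S NT Y" and s: "s \<in> S"
  shows "(\<lambda>y\<in>Y. y s) \<in> mor ss (restr (power_str S NT) Y) NT"
proof -
  have YS: "Y \<subseteq> S \<rightarrow>\<^sub>E scar NT" using Y by (simp add: subpower_def)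
  have "(\<lambda>y\<in>scar (restr (power_str S NT) Y). y s) \<in> mor ss (restr (power_str S NT) Y) NT"
    by (rule mor_restrictI[OF is_struct_subpower[OF NT Y]])
      (use YS s in \<open>auto simp: power_str_simps srel_power
        intro!: continuous_map_from_subtopology continuous_map_product_projection\<close>)
  then show ?thesis by (simp add: power_str_simps)
qed

text \<open>The universal property of powers.\<close>

lemma mor_into_power:
  assumes X: "is_struct ss X" and Y: "subpower ss S NT Y"
    and m: "\<And>x. x \<in> scar X \<Longrightarrow> \<phi> x \<in> Y"
    and \<phi>: "\<And>s. s \<in> S \<Longrightarrow> (\<lambda>x\<in>scar X. \<phi> x s) \<in> mor ss X NT"
  shows "(\<lambda>x\<in>scar X. \<phi> x) \<in> mor ss X (restr (power_str S NT) Y)"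
proof (rule mor_restrictI[OF X])
  have YS: "Y \<subseteq> S \<rightarrow>\<^sub>E scar NT" using Y by (simp add: subpower_def)
  have X': "topspace (stop X) = scar X" by (rule is_struct_topspace[OF X])
  have "continuous_map (stop X) (product_topology (\<lambda>_. stop NT) S) (\<lambda>x\<in>scar X. \<phi> x)"
    unfolding continuous_map_componentwise
  proof (intro conjI ballI)
    show "(\<lambda>x\<in>scar X. \<phi> x) ` topspace (stop X) \<subseteq> extensional S"
      using m YS X' by (auto simp: PiE_def)
    fix s assume "s \<in> S"
    from morD(2)[OF \<phi>[OF this]] show "continuous_map (stop X) (stop NT) (\<lambda>x. (\<lambda>x\<in>scar X. \<phi> x) x s)"
      by (rule continuous_map_eq) (simp add: X')
  qed
  then have "continuous_map (stop X) (product_topology (\<lambda>_. stop NT) S) \<phi>"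
    by (rule continuous_map_eq) (simp add: X')
  then show "continuous_map (stop X) (stop (restr (power_str S NT) Y)) \<phi>"
    using m X' by (simp add: power_str_simps continuous_map_in_subtopology)
  fix g xs assume g: "g \<in> gsyms ss" and xs: "xs \<in> tuples (gar ss g) (scar X)"
  have gx: "sop X g xs \<in> scar X" by (rule is_structD(1)[OF X g xs])
  show "\<phi> (sop X g xs) = sop (restr (power_str S NT) Y) g (map \<phi> xs)"
  proof
    fix s
    have "\<phi> (sop X g xs) s = sop NT g (map (\<lambda>x. \<phi> x s) xs)" if "s \<in> S"
      using morD(3)[OF \<phi>[OF that] g xs] gx unfolding map_restrict[OF xs] by simp
    moreover have "\<phi> (sop X g xs) s = undefined" if "s \<notin> S"
      using m[OF gx] YS that by (auto simp: PiE_def extensional_def)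
    ultimately show "\<phi> (sop X g xs) s = sop (restr (power_str S NT) Y) g (map \<phi> xs) s"
      by (simp add: power_str_simps o_def)
  qed
next
  have YS: "Y \<subseteq> S \<rightarrow>\<^sub>E scar NT" using Y by (simp add: subpower_def)
  fix r xs assume r: "r \<in> rsyms ss" and xs: "xs \<in> srel X r"
  note t = is_structD(2)[OF X r xs]
  have "map (\<lambda>x. \<phi> x s) xs \<in> srel NT r" if "s \<in> S" for s
    using morD(4)[OF \<phi>[OF that] r xs] unfolding map_restrict[OF t] .
  moreover have "set (map \<phi> xs) \<subseteq> Y" using tuplesD[OF t] m by auto
  ultimately show "map \<phi> xs \<in> srel (restr (power_str S NT) Y) r"
    by (simp add: srel_power[OF YS] o_def)
qed (use m in \<open>simp add: power_str_simps\<close>)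

lemma closed_sub_subpower:
  assumes NT: "is_struct ss NT" and S: "S \<noteq> {}" and Y: "closed_sub ss (power_str S NT) Y"
  shows "subpower ss S NT Y"
  using Y closedin_subset[of "stop (power_str S NT)" Y] S is_struct_topspace[OF NT]
  by (simp add: closed_sub_def subpower_def power_str_def)

section \<open>Structures representable over an alter ego\<close>

text \<open>Membership in \<open>IS\<^sub>cP\<^sup>+(NT)\<close> without an exponent: a structure is a closed substructure of a power if it is
compact and if the morphisms to \<open>NT\<close> separate its points and reflect its relations. That a morphism
exists is the condition that the exponent be non-empty; it matters for one-point structures, which may
satisfy the other conditions without admitting any morphism.\<close>

definition representable :: "('g, 'r) ssgn \<Rightarrow> ('g, 'r, 'n) tstruct \<Rightarrow> ('g, 'r, 'x) tstruct \<Rightarrow> bool" where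
  "representable ss NT X \<longleftrightarrow> is_struct ss X \<and> compact_space (stop X) \<and> mor ss X NT \<noteq> {} \<and>
     (\<forall>x \<in> scar X. \<forall>y \<in> scar X. x \<noteq> y \<longrightarrow> (\<exists>\<alpha> \<in> mor ss X NT. \<alpha> x \<noteq> \<alpha> y)) \<and>
     (\<forall>r \<in> rsyms ss. \<forall>xs \<in> tuples (rar ss r) (scar X).
        (\<forall>\<alpha> \<in> mor ss X NT. map \<alpha> xs \<in> srel NT r) \<longrightarrow> xs \<in> srel X r)"

lemma representable_if_iso:
  assumes X: "is_struct ss X" and NT: "is_struct ss NT" "compact_space (stop NT)" and S: "S \<noteq> {}"
    and Y: "closed_sub ss (power_str S NT) Y" and \<phi>: "str_iso ss X (restr (power_str S NT) Y) \<phi>"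
  shows "representable ss NT X"
proof -
  let ?R = "restr (power_str S NT) Y"
  note Ysub = closed_sub_subpower[OF NT(1) S Y]
  have YS: "Y \<subseteq> S \<rightarrow>\<^sub>E scar NT" using Ysub by (simp add: subpower_def)
  obtain \<psi> where m: "\<phi> \<in> mor ss X ?R" "\<psi> \<in> mor ss ?R X" and i: "\<And>x. x \<in> scar X \<Longrightarrow> \<psi> (\<phi> x) = x"
    using \<phi> unfolding str_iso_def by blast
  have \<phi>Y: "\<phi> x \<in> Y" if "x \<in> scar X" for x using morD(1)[OF m(1) that] by (simp add: power_str_simps)
  have "compact_space (product_topology (\<lambda>_. stop NT) S)"
    using NT(2) by (simp add: compact_space_product_topology)
  moreover have "closedin (product_topology (\<lambda>_. stop NT) S) Y"
    using Y by (simp add: closed_sub_def power_str_def)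
  ultimately have "compactin (stop ?R) Y"
    by (simp add: power_str_simps closedin_compact_space compactin_subtopology)
  from image_compactin[OF this morD(2)[OF m(2)]] have "compactin (stop X) (\<psi> ` Y)" .
  moreover have "\<psi> ` Y = scar X"
    using morD(1)[OF m(2)] \<phi>Y i by (force simp: power_str_simps)
  ultimately have comp: "compact_space (stop X)"
    by (simp add: compact_space_def is_struct_topspace[OF X])
  define \<alpha> where "\<alpha> = (\<lambda>s. \<lambda>x\<in>scar X. \<phi> x s)"
  have \<alpha>: "\<alpha> s \<in> mor ss X NT" if "s \<in> S" for s
  proof -
    have "(\<lambda>x\<in>scar X. (\<lambda>y\<in>Y. y s) (\<phi> x)) = \<alpha> s"
      unfolding \<alpha>_def by (intro restrict_ext) (simp add: \<phi>Y)
    with mor_comp[OF X m(1) proj_mor[OF NT(1) Ysub that]] show ?thesis by simp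
  qed
  have "\<exists>\<alpha> \<in> mor ss X NT. \<alpha> x \<noteq> \<alpha> y" if xy: "x \<in> scar X" "y \<in> scar X" "x \<noteq> y" for x y
  proof -
    have "\<phi> x \<noteq> \<phi> y" using i xy by metis
    then have "\<exists>s\<in>S. \<phi> x s \<noteq> \<phi> y s"
      using PiE_ext[of "\<phi> x" S "\<lambda>_. scar NT" "\<phi> y"] \<phi>Y xy YS by blast
    then obtain s where "s \<in> S" "\<phi> x s \<noteq> \<phi> y s" by blast
    then show ?thesis using \<alpha>[of s] xy by (intro bexI[of _ "\<alpha> s"]) (simp_all add: \<alpha>_def)
  qed
  moreover have "xs \<in> srel X r" if r: "r \<in> rsyms ss" and xs: "xs \<in> tuples (rar ss r) (scar X)"
    and all: "\<forall>\<alpha> \<in> mor ss X NT. map \<alpha> xs \<in> srel NT r" for r xs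
  proof -
    have "map (\<lambda>y. y s) (map \<phi> xs) \<in> srel NT r" if "s \<in> S" for s
    proof -
      have "map (\<alpha> s) xs \<in> srel NT r" using all \<alpha>[OF that] by blast
      then show ?thesis unfolding \<alpha>_def map_restrict[OF xs] by (simp add: o_def)
    qed
    moreover have "set (map \<phi> xs) \<subseteq> Y" using tuplesD[OF xs] \<phi>Y by auto
    ultimately have "map \<phi> xs \<in> srel ?R r" by (simp add: srel_power[OF YS])
    from morD(4)[OF m(2) r this] show ?thesis
      using i tuplesD[OF xs] by (simp add: o_def map_idI)
  qed
  moreover have "mor ss X NT \<noteq> {}" using \<alpha> S by blast
  ultimately show ?thesis
    unfolding representable_def using X comp by auto
qed

text \<open>Evaluation embeds \<open>X\<close> into the power indexed by its morphisms. An injective continuous map from a compact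
to a Hausdorff space is a homeomorphism onto a closed set. The morphisms are indexed by a surjection
\<open>\<alpha>\<close>, so that the same index set can later serve both sorts.\<close>

lemma iso_if_representable:
  assumes X: "representable ss NT X" and NT: "is_struct ss NT" "Hausdorff_space (stop NT)"
    and S: "\<alpha> ` S = mor ss X NT"
  defines "\<phi> \<equiv> \<lambda>x\<in>scar X. \<lambda>s\<in>S. \<alpha> s x"
  shows "closed_sub ss (power_str S NT) (\<phi> ` scar X)"
    "str_iso ss X (restr (power_str S NT) (\<phi> ` scar X)) \<phi>"
proof -
  note X' = X[unfolded representable_def]
  have Xs: "is_struct ss X" using X' by blast
  note tX = is_struct_topspace[OF Xs] and tN = is_struct_topspace[OF NT(1)]
  have \<alpha>: "\<alpha> s \<in> mor ss X NT" if "s \<in> S" for s using that S by blast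
  have "S \<noteq> {}" using S X' by auto
  let ?Y = "\<phi> ` scar X"
  have val: "\<phi> x s = \<alpha> s x" if "x \<in> scar X" "s \<in> S" for x s using that by (simp add: \<phi>_def)
  have YS: "?Y \<subseteq> S \<rightarrow>\<^sub>E scar NT" using morD(1)[OF \<alpha>] by (auto simp: \<phi>_def)
  have op: "(\<lambda>s\<in>S. sop NT g (map (\<lambda>y. y s) (map \<phi> xs))) = \<phi> (sop X g xs)"
    if g: "g \<in> gsyms ss" and xs: "xs \<in> tuples (gar ss g) (scar X)" for g xs
  proof
    fix s
    have e: "map (\<lambda>y. y s) (map \<phi> xs) = map (\<alpha> s) xs" if "s \<in> S"
      using val[OF _ that] tuplesD[OF xs] by simp
    show "(\<lambda>s\<in>S. sop NT g (map (\<lambda>y. y s) (map \<phi> xs))) s = \<phi> (sop X g xs) s"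
    proof (cases "s \<in> S")
      case True
      show ?thesis unfolding restrict_apply'[OF True] e[OF True]
        using morD(3)[OF \<alpha>[OF True] g xs] val[OF is_structD(1)[OF Xs g xs] True] by simp
    qed (use is_structD(1)[OF Xs g xs] in \<open>simp add: \<phi>_def\<close>)
  qed
  have sub: "subpower ss S NT ?Y"
    unfolding subpower_def
  proof (intro conjI ballI)
    fix g ys assume g: "g \<in> gsyms ss" and ys: "ys \<in> tuples (gar ss g) ?Y"
    from ys obtain xs where xs: "xs \<in> tuples (gar ss g) (scar X)" "ys = map \<phi> xs" by (rule tuples_image)
    show "(\<lambda>s\<in>S. sop NT g (map (\<lambda>y. y s) ys)) \<in> ?Y"
      unfolding xs(2) op[OF g xs(1)] using is_structD(1)[OF Xs g xs(1)] by simp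
  qed fact+
  let ?R = "restr (power_str S NT) ?Y"
  have ext: "(\<lambda>x\<in>scar X. \<phi> x) = \<phi>" by (auto simp: \<phi>_def)
  have "(\<lambda>x\<in>scar X. \<phi> x s) = \<alpha> s" if "s \<in> S" for s
    using val[OF _ that] morD(5)[OF \<alpha>[OF that]] by (auto simp: fun_eq_iff)
  then have m: "\<phi> \<in> mor ss X ?R"
    using mor_into_power[OF Xs sub, of \<phi>] \<alpha> ext by simp
  have inj: "inj_on \<phi> (scar X)"
  proof (rule inj_onI, rule ccontr)
    fix x y assume xy: "x \<in> scar X" "y \<in> scar X" "\<phi> x = \<phi> y" "x \<noteq> y"
    then obtain s where s: "s \<in> S" "\<alpha> s x \<noteq> \<alpha> s y" using X' S by (metis (no_types, lifting) imageE)
    then show False using val[OF xy(1) s(1)] val[OF xy(2) s(1)] xy(3) by simp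
  qed
  have H: "Hausdorff_space (product_topology (\<lambda>_. stop NT) S)"
    using NT(2) by (simp add: Hausdorff_space_product_topology)
  have cX: "compactin (stop X) (scar X)" using X' tX by (simp add: compact_space_def)
  have cont: "continuous_map (stop X) (product_topology (\<lambda>_. stop NT) S) \<phi>"
    using morD(2)[OF m] by (simp add: power_str_simps continuous_map_in_subtopology)
  have "closedin (stop (power_str S NT)) ?Y"
    using compactin_imp_closedin[OF H image_compactin[OF cX cont]] by (simp add: power_str_def)
  then show "closed_sub ss (power_str S NT) ?Y"
    using sub by (simp add: closed_sub_def subpower_def power_str_def)
  have "homeomorphic_map (stop X) (stop ?R) \<phi>"
  proof (rule continuous_imp_homeomorphic_map[OF morD(2)[OF m]])
    show "\<phi> ` topspace (stop X) = topspace (stop ?R)"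
      using YS tX tN by (auto simp: power_str_simps)
  qed (use X' H inj tX in \<open>auto simp: power_str_simps Hausdorff_space_subtopology\<close>)
  then obtain k where k: "homeomorphic_maps (stop X) (stop ?R) \<phi> k"
    by (auto simp: homeomorphic_map_maps)
  have tR: "topspace (stop ?R) = ?Y" using YS tN by (auto simp: power_str_simps)
  have k\<phi>: "k (\<phi> x) = x" if "x \<in> scar X" for x using k that tX by (simp add: homeomorphic_maps_def)
  have "(\<lambda>y\<in>scar ?R. k y) \<in> mor ss ?R X"
  proof (rule mor_restrictI[OF is_struct_subpower[OF NT(1) sub]])
    show "k y \<in> scar X" if "y \<in> scar ?R" for y using that k\<phi> by (auto simp: power_str_simps)
    show "continuous_map (stop ?R) (stop X) k" using k by (simp add: homeomorphic_maps_def)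
    fix g ys assume g: "g \<in> gsyms ss" and ys: "ys \<in> tuples (gar ss g) (scar ?R)"
    from ys obtain xs where xs: "xs \<in> tuples (gar ss g) (scar X)" "ys = map \<phi> xs"
      unfolding power_str_simps by (rule tuples_image)
    have "map k ys = xs" unfolding xs(2) map_map using k\<phi> tuplesD[OF xs(1)] by (intro map_idI) simp
    then show "k (sop ?R g ys) = sop X g (map k ys)"
      using k\<phi>[OF is_structD(1)[OF Xs g xs(1)]] op[OF g xs(1)] by (simp add: power_str_simps xs(2))
  next
    fix r ys assume r: "r \<in> rsyms ss" and ys: "ys \<in> srel ?R r"
    have "ys \<in> tuples (rar ss r) (scar ?R)" by (rule is_structD(2)[OF is_struct_subpower[OF NT(1) sub] r ys])
    then obtain xs where xs: "xs \<in> tuples (rar ss r) (scar X)" "ys = map \<phi> xs"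
      unfolding power_str_simps by (rule tuples_image)
    have e: "map k ys = xs" unfolding xs(2) map_map using k\<phi> tuplesD[OF xs(1)] by (intro map_idI) simp
    have "map (\<alpha> s) xs \<in> srel NT r" if "s \<in> S" for s
    proof -
      have "map (\<lambda>y. y s) ys = map (\<alpha> s) xs" unfolding xs(2) using val[OF _ that] tuplesD[OF xs(1)] by simp
      then show ?thesis using ys that unfolding srel_power[OF YS] by metis
    qed
    then have "\<forall>\<beta>\<in>mor ss X NT. map \<beta> xs \<in> srel NT r" unfolding S[symmetric] by blast
    then show "map k ys \<in> srel X r" using X' r xs(1) unfolding e by simp
  qed
  then show "str_iso ss X ?R \<phi>"
    unfolding str_iso_def using m k\<phi>
    by (intro conjI bexI[of _ "\<lambda>y\<in>scar ?R. k y"]) (auto simp: power_str_simps)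
qed

lemma IScP_iff_representable:
  fixes X :: "('g, 'r, 'x) tstruct" and NT :: "('g, 'r, 'n) tstruct"
  assumes NT: "is_struct ss NT" "compact_space (stop NT)" "Hausdorff_space (stop NT)"
  shows "X \<in> IScP ss NT \<longleftrightarrow> representable ss NT X"
proof
  assume "X \<in> IScP ss NT"
  then obtain S :: "('x \<Rightarrow> 'n) set" and Y \<phi> where "is_struct ss X" "S \<noteq> {}"
    "closed_sub ss (power_str S NT) Y" "str_iso ss X (restr (power_str S NT) Y) \<phi>"
    unfolding IScP_def by blast
  then show "representable ss NT X" by (intro representable_if_iso[OF _ NT(1,2)])
next
  assume X: "representable ss NT X"
  have "(\<lambda>\<alpha>. \<alpha>) ` mor ss X NT = mor ss X NT" by simp
  note i = iso_if_representable[OF X NT(1,3) this]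
  have "is_struct ss X" "mor ss X NT \<noteq> {}" using X by (simp_all add: representable_def)
  then show "X \<in> IScP ss NT" using IScP_I[OF _ NT(1) _ i] by blast
qed

section \<open>Transported structures\<close>

context
  fixes ss :: "('g, 'r) ssgn" and NT :: "('g, 'r, 'n) tstruct" and h :: "'n \<Rightarrow> 'm" and k :: "'m \<Rightarrow> 'n"
  assumes NT: "is_struct ss NT" and inv: "\<forall>a \<in> scar NT. k (h a) = a"
begin

lemma left_inverse: "a \<in> scar NT \<Longrightarrow> k (h a) = a"
  using inv by blast

lemma inv_transport: "a \<in> scar NT \<Longrightarrow> inv_into (scar NT) h (h a) = a"
  using left_inverse by (metis inj_on_inverseI inv_into_f_f)

lemma transport_simps:
  "scar (transport h NT) = h ` scar NT"
  "xs \<in> tuples n (scar NT) \<Longrightarrow> sop (transport h NT) g (map h xs) = h (sop NT g xs)"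
  "srel (transport h NT) r = map h ` srel NT r"
proof -
  assume "xs \<in> tuples n (scar NT)"
  then have "map (inv_into (scar NT) h) (map h xs) = xs"
    using inv_transport by (simp add: map_idI tuples_def subset_iff)
  then show "sop (transport h NT) g (map h xs) = h (sop NT g xs)"
    by (simp add: transport_def Let_def del: map_map)
qed (simp_all add: transport_def Let_def)

lemma topspace_transport: "topspace (stop (transport h NT)) = h ` scar NT"
  using inv_transport by (auto simp: transport_def Let_def topspace_pullback_topology is_struct_topspace[OF NT])

lemma is_struct_transport: "is_struct ss (transport h NT)"
  unfolding is_struct_def
proof (intro conjI ballI)
  show "topspace (stop (transport h NT)) = scar (transport h NT)"
    by (simp add: topspace_transport transport_simps)
  fix g ys assume g: "g \<in> gsyms ss" and ys: "ys \<in> tuples (gar ss g) (scar (transport h NT))"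
  then obtain xs where xs: "xs \<in> tuples (gar ss g) (scar NT)" "ys = map h xs"
    unfolding transport_simps by (metis tuples_image)
  show "sop (transport h NT) g ys \<in> scar (transport h NT)"
    using is_structD(1)[OF NT g xs(1)] transport_simps(2)[OF xs(1)] by (simp add: xs(2) transport_simps)
next
  fix r assume r: "r \<in> rsyms ss"
  show "srel (transport h NT) r \<subseteq> tuples (rar ss r) (scar (transport h NT))"
    using is_structD(2)[OF NT r] by (fastforce simp: transport_simps tuples_def)
qed

lemma transport_continuous:
  "continuous_map (stop NT) (stop (transport h NT)) h"
  "continuous_map (stop (transport h NT)) (stop NT) k"
proof -
  let ?k = "inv_into (scar NT) h"
  have s: "stop (transport h NT) = pullback_topology (h ` scar NT) ?k (stop NT)"
    by (simp add: transport_def Let_def)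
  have "continuous_map (stop NT) (stop NT) (?k \<circ> h)"
    by (rule continuous_map_eq[of _ _ "\<lambda>x. x"]) (simp_all add: is_struct_topspace[OF NT] inv_transport)
  then show "continuous_map (stop NT) (stop (transport h NT)) h"
    unfolding s by (rule continuous_map_pullback') (auto simp: is_struct_topspace[OF NT])
  have "continuous_map (stop (transport h NT)) (stop NT) ((\<lambda>x. x) \<circ> ?k)"
    unfolding s by (rule continuous_map_pullback) simp
  then show "continuous_map (stop (transport h NT)) (stop NT) k"
    by (rule continuous_map_eq) (auto simp: topspace_transport inv_transport left_inverse)
qed

lemma transport_mor:
  "(\<lambda>a\<in>scar NT. h a) \<in> mor ss NT (transport h NT)"
  "(\<lambda>p\<in>h ` scar NT. k p) \<in> mor ss (transport h NT) NT"
proof -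
  show "(\<lambda>a\<in>scar NT. h a) \<in> mor ss NT (transport h NT)"
    by (rule mor_restrictI[OF NT]) (auto simp: transport_simps transport_continuous)
  have "(\<lambda>p\<in>scar (transport h NT). k p) \<in> mor ss (transport h NT) NT"
  proof (rule mor_restrictI[OF is_struct_transport])
    fix g ys assume g: "g \<in> gsyms ss" and ys: "ys \<in> tuples (gar ss g) (scar (transport h NT))"
    then obtain xs where xs: "xs \<in> tuples (gar ss g) (scar NT)" "ys = map h xs"
      unfolding transport_simps by (metis tuples_image)
    have "map k ys = xs" unfolding xs(2) map_map using left_inverse tuplesD[OF xs(1)] by (intro map_idI) simp
    then show "k (sop (transport h NT) g ys) = sop NT g (map k ys)"
      using left_inverse is_structD(1)[OF NT g xs(1)] transport_simps(2)[OF xs(1)] by (simp add: xs(2))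
  next
    fix r ys assume r: "r \<in> rsyms ss" and ys: "ys \<in> srel (transport h NT) r"
    then obtain xs where xs: "xs \<in> srel NT r" "ys = map h xs" by (auto simp: transport_simps)
    have "map k ys = xs"
      unfolding xs(2) map_map using left_inverse tuplesD[OF is_structD(2)[OF NT r xs(1)]] by (intro map_idI) simp
    then show "map k ys \<in> srel NT r" using xs by simp
  qed (auto simp: transport_simps left_inverse transport_continuous)
  then show "(\<lambda>p\<in>h ` scar NT. k p) \<in> mor ss (transport h NT) NT" by (simp add: transport_simps)
qed

lemma compact_transport: "compact_space (stop NT) \<Longrightarrow> compact_space (stop (transport h NT))"
  using image_compactin[OF _ transport_continuous(1), of "scar NT"]
  by (simp add: compact_space_def topspace_transport is_struct_topspace[OF NT])

lemma Hausdorff_transport: "Hausdorff_space (stop NT) \<Longrightarrow> Hausdorff_space (stop (transport h NT))"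
  by (rule Hausdorff_space_injective_preimage[OF _ transport_continuous(2)])
    (auto simp: topspace_transport left_inverse inj_on_def)

lemma mor_transport:
  assumes X: "is_struct ss X"
  shows "\<alpha> \<in> mor ss X NT \<Longrightarrow> (\<lambda>x\<in>scar X. h (\<alpha> x)) \<in> mor ss X (transport h NT)"
    "\<beta> \<in> mor ss X (transport h NT) \<Longrightarrow> (\<lambda>x\<in>scar X. k (\<beta> x)) \<in> mor ss X NT"
    "\<beta> \<in> mor ss X (transport h NT) \<Longrightarrow> x \<in> scar X \<Longrightarrow> h (k (\<beta> x)) = \<beta> x"
proof -
  assume \<alpha>: "\<alpha> \<in> mor ss X NT"
  have "(\<lambda>x\<in>scar X. (\<lambda>a\<in>scar NT. h a) (\<alpha> x)) = (\<lambda>x\<in>scar X. h (\<alpha> x))"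
    by (intro restrict_ext) (simp add: morD(1)[OF \<alpha>])
  with mor_comp[OF X \<alpha> transport_mor(1)] show "(\<lambda>x\<in>scar X. h (\<alpha> x)) \<in> mor ss X (transport h NT)" by simp
next
  assume \<beta>: "\<beta> \<in> mor ss X (transport h NT)"
  then have m: "\<beta> x \<in> h ` scar NT" if "x \<in> scar X" for x using morD(1)[OF \<beta> that] by (simp add: transport_simps)
  then have "(\<lambda>x\<in>scar X. (\<lambda>p\<in>h ` scar NT. k p) (\<beta> x)) = (\<lambda>x\<in>scar X. k (\<beta> x))"
    by (intro restrict_ext) simp
  with mor_comp[OF X \<beta> transport_mor(2)] show "(\<lambda>x\<in>scar X. k (\<beta> x)) \<in> mor ss X NT" by simp
  show "h (k (\<beta> x)) = \<beta> x" if "x \<in> scar X" using m[OF that] left_inverse by auto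
qed

lemma representable_transport:
  "representable ss (transport h NT) X \<longleftrightarrow> representable ss NT X"
proof (cases "is_struct ss X")
  case X: True
  let ?TT = "transport h NT"
  let ?up = "\<lambda>\<alpha>. \<lambda>x\<in>scar X. h (\<alpha> x)"
  have surj: "mor ss X ?TT = ?up ` mor ss X NT"
  proof (intro equalityI subsetI)
    fix \<beta> assume \<beta>: "\<beta> \<in> mor ss X ?TT"
    let ?\<alpha> = "\<lambda>x\<in>scar X. k (\<beta> x)"
    have "\<beta> = ?up ?\<alpha>"
      by (rule mor_eqI[OF \<beta> mor_transport(1)[OF X mor_transport(2)[OF X \<beta>]]])
        (simp add: mor_transport(3)[OF X \<beta>])
    then show "\<beta> \<in> ?up ` mor ss X NT" using mor_transport(2)[OF X \<beta>] by blast
  qed (use mor_transport(1)[OF X] in blast)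
  have eq: "?up \<alpha> x \<noteq> ?up \<alpha> y \<longleftrightarrow> \<alpha> x \<noteq> \<alpha> y" if "\<alpha> \<in> mor ss X NT" "x \<in> scar X" "y \<in> scar X" for \<alpha> x y
    using that left_inverse morD(1)[OF that(1)] by (metis restrict_apply')
  have rel: "map (?up \<alpha>) xs \<in> srel ?TT r \<longleftrightarrow> map \<alpha> xs \<in> srel NT r"
    if \<alpha>: "\<alpha> \<in> mor ss X NT" and r: "r \<in> rsyms ss" and xs: "xs \<in> tuples (rar ss r) (scar X)" for \<alpha> r xs
  proof -
    have kh_map: "map k (map h us) = us" if "us \<in> tuples n (scar NT)" for us n
      unfolding map_map using tuplesD[OF that] left_inverse by (intro map_idI) simp
    have us: "map \<alpha> xs \<in> tuples (rar ss r) (scar NT)" using xs by (rule tuples_map) (rule morD(1)[OF \<alpha>])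
    have e1: "map \<alpha> xs = vs" if "map h (map \<alpha> xs) = map h vs" "vs \<in> srel NT r" for vs
      using kh_map[OF us] kh_map[OF is_structD(2)[OF NT r that(2)]] unfolding that(1) by metis
    have e2: "map (?up \<alpha>) xs = map h (map \<alpha> xs)" unfolding map_restrict[OF xs] by simp
    show ?thesis unfolding transport_simps(3) e2 using e1 by blast
  qed
  have "mor ss X ?TT \<noteq> {} \<longleftrightarrow> mor ss X NT \<noteq> {}"
    by (simp add: surj)
  moreover have "(\<exists>\<beta>\<in>mor ss X ?TT. \<beta> x \<noteq> \<beta> y) \<longleftrightarrow> (\<exists>\<alpha>\<in>mor ss X NT. \<alpha> x \<noteq> \<alpha> y)"
    if "x \<in> scar X" "y \<in> scar X" for x y
    unfolding surj bex_simps using eq[OF _ that] by (rule bex_cong[OF refl])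
  moreover have "(\<forall>\<beta>\<in>mor ss X ?TT. map \<beta> xs \<in> srel ?TT r) \<longleftrightarrow> (\<forall>\<alpha>\<in>mor ss X NT. map \<alpha> xs \<in> srel NT r)"
    if "r \<in> rsyms ss" "xs \<in> tuples (rar ss r) (scar X)" for r xs
    unfolding surj ball_simps using rel[OF _ that] by (rule ball_cong[OF refl])
  ultimately show ?thesis
    unfolding representable_def by (simp cong: ball_cong)
qed (simp add: representable_def)

end

section \<open>Two-sorted structures sort by sort\<close>

lemma mor2_outside: "\<phi> \<in> mor2 ss X Y \<Longrightarrow> p \<notin> univ2 X \<Longrightarrow> \<phi> p = undefined"
  by (auto simp: mor2_def)

text \<open>The common exponent for both sorts is the set of pairs of morphisms, one on each sort. As neither sort is
without morphisms, the pairs project onto all morphisms of either sort.\<close>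

lemma IScP2_iff_representable:
  fixes X :: "('g, 'r, 'x) tstruct2" and MT :: "('g, 'r, 'm) tstruct2"
  assumes MT: "is_struct2 ss MT" and comp: "\<And>s. compact_space (stop (sort_of MT s))"
    and Haus: "\<And>s. Hausdorff_space (stop (sort_of MT s))"
  shows "X \<in> IScP2 ss MT \<longleftrightarrow> is_struct2 ss X \<and> (\<forall>s. representable ss (sort_of MT s) (sort_of X s))"
proof
  note MTs = is_struct2_sorts(2)[OF MT]
  assume "X \<in> IScP2 ss MT"
  then obtain S :: "(srt \<times> 'x \<Rightarrow> srt \<times> 'm) set" and Y \<phi> where X: "is_struct2 ss X" and S: "S \<noteq> {}"
    and Y: "closed_sub2 ss (power_str2 S MT) Y" and \<phi>: "str_iso2 ss X (restr2 (power_str2 S MT) Y) \<phi>"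
    unfolding IScP2_def by blast
  note Xs = is_struct2_sorts(2)[OF X]
  have Ys: "closed_sub ss (power_str S (sort_of MT s)) (Y s)" for s
    using Y by (simp add: power_str2_def closed_sub2_union2)
  have "str_iso ss (sort_of X s) (restr (power_str S (sort_of MT s)) (Y s))
      (\<lambda>x\<in>scar (sort_of X s). snd (\<phi> (s, x)))" for s
    by (rule str_iso2_component)
      (use \<phi> in \<open>simp_all add: Xs is_struct_power[OF MTs Ys S] is_struct2_sorts(1)[OF X] power_str2_def restr2_union2\<close>)
  then show "is_struct2 ss X \<and> (\<forall>s. representable ss (sort_of MT s) (sort_of X s))"
    using X representable_if_iso[OF Xs MTs comp S Ys] by blast
next
  note MTs = is_struct2_sorts(2)[OF MT]
  assume "is_struct2 ss X \<and> (\<forall>s. representable ss (sort_of MT s) (sort_of X s))"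
  then have X: "is_struct2 ss X" and rep: "\<And>s. representable ss (sort_of MT s) (sort_of X s)" by blast+
  note Xs = is_struct2_sorts(2)[OF X]
  have ne: "mor ss (sort_of X s) (sort_of MT s) \<noteq> {}" for s using rep[of s] by (simp add: representable_def)
  let ?S = "mor ss (sort_of X S1) (sort_of MT S1) \<times> mor ss (sort_of X S2) (sort_of MT S2)"
  define \<phi> where "\<phi> = (\<lambda>s. \<lambda>x\<in>scar (sort_of X s). \<lambda>p\<in>?S. pr s p x)"
  have S: "?S \<noteq> {}" using ne by auto
  have "pr s ` ?S = mor ss (sort_of X s) (sort_of MT s)" for s using ne by (cases s) auto
  note i' = iso_if_representable[OF rep MTs Haus this]
  have i: "closed_sub ss (power_str ?S (sort_of MT s)) (\<phi> s ` scar (sort_of X s))"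
    "str_iso ss (sort_of X s) (restr (power_str ?S (sort_of MT s)) (\<phi> s ` scar (sort_of X s))) (\<phi> s)" for s
    unfolding \<phi>_def using i'[of s] by blast+
  have Y: "closed_sub2 ss (power_str2 ?S MT) (\<lambda>s. \<phi> s ` scar (sort_of X s))"
    unfolding power_str2_def closed_sub2_union2 using i(1) by blast
  have "str_iso2 ss X (restr2 (power_str2 ?S MT) (\<lambda>s. \<phi> s ` scar (sort_of X s)))
      (\<lambda>(s, x)\<in>univ2 (union2 (sort_of X)). (s, \<phi> s x))"
    using str_iso2_glue[where X = "sort_of X" and f = \<phi>, OF Xs is_struct_power[OF MTs i(1) S] i(2)]
    unfolding is_struct2_sorts(1)[OF X] power_str2_def restr2_union2 .
  from IScP2_I[OF X MT S Y this] show "X \<in> IScP2 ss MT" .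
qed

section \<open>Alter egos\<close>

lemma alter_egoD:
  assumes "alter_ego Sg N ss NT"
  shows "is_struct ss NT" "scar NT = carrier N" "compact_space (stop NT)" "Hausdorff_space (stop NT)"
    "f \<in> syms Sg \<Longrightarrow> continuous_map (product_topology (\<lambda>_. stop NT) {..<ar Sg f}) (stop NT)
        (\<lambda>x. oper N f (map x [0..<ar Sg f]))"
    "g \<in> gsyms ss \<Longrightarrow> gar ss g = 0 \<Longrightarrow> subuniverse Sg N {sop NT g []}"
    "g \<in> gsyms ss \<Longrightarrow> gar ss g = n \<Longrightarrow> n \<noteq> 0 \<Longrightarrow>
       (\<lambda>x \<in> {..<n} \<rightarrow>\<^sub>E carrier N. sop NT g (map x [0..<n])) \<in> hom Sg (prod_alg {..<n} (\<lambda>_. N)) N"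
    "g \<in> gsyms ss \<Longrightarrow> gar ss g = n \<Longrightarrow> n \<noteq> 0 \<Longrightarrow>
       continuous_map (product_topology (\<lambda>_. stop NT) {..<n}) (stop NT) (\<lambda>x. sop NT g (map x [0..<n]))"
    "r \<in> rsyms ss \<Longrightarrow> rar ss r \<ge> 1"
    "r \<in> rsyms ss \<Longrightarrow> rar ss r = n \<Longrightarrow>
       subuniverse Sg (prod_alg {..<n} (\<lambda>_. N)) {x \<in> {..<n} \<rightarrow>\<^sub>E carrier N. map x [0..<n] \<in> srel NT r}"
    "r \<in> rsyms ss \<Longrightarrow> rar ss r = n \<Longrightarrow>
       closedin (product_topology (\<lambda>_. stop NT) {..<n}) {x \<in> {..<n} \<rightarrow>\<^sub>E carrier N. map x [0..<n] \<in> srel NT r}"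
  using assms unfolding alter_ego_def Let_def by auto

lemma continuous_map_oper:
  assumes op: "continuous_map (product_topology (\<lambda>_. Y) {..<n}) Z (\<lambda>x. F (map x [0..<n]))"
    and len: "length \<alpha>s = n" and \<alpha>: "\<And>\<alpha>. \<alpha> \<in> set \<alpha>s \<Longrightarrow> continuous_map X Y \<alpha>"
  shows "continuous_map X Z (\<lambda>x. F (map (\<lambda>\<alpha>. \<alpha> x) \<alpha>s))"
proof -
  have "continuous_map X (product_topology (\<lambda>_. Y) {..<n}) (\<lambda>x. \<lambda>i\<in>{..<n}. (\<alpha>s ! i) x)"
    unfolding continuous_map_componentwise using \<alpha> len by auto
  from continuous_map_compose[OF this op]
  have "continuous_map X Z (\<lambda>x. F (map (\<lambda>i\<in>{..<n}. (\<alpha>s ! i) x) [0..<n]))" by (simp add: o_def)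
  moreover have "map (\<lambda>i\<in>{..<n}. (\<alpha>s ! i) x) [0..<n] = map (\<lambda>\<alpha>. \<alpha> x) \<alpha>s" for x
    using len by (intro nth_equalityI) auto
  ultimately show ?thesis by simp
qed

lemma list_as_tuple:
  "length xs = n \<Longrightarrow> map (\<lambda>i\<in>{..<n}. xs ! i) [0..<n] = xs"
  by (intro nth_equalityI) auto

lemma tuple_mem: "xs \<in> tuples n X \<Longrightarrow> (\<lambda>i\<in>{..<n}. xs ! i) \<in> {..<n} \<rightarrow>\<^sub>E X"
  by (auto simp: tuples_nth)

text \<open>Rows and columns of a matrix over \<open>N\<close>: applying \<open>f\<close> to all columns and \<open>g\<close> to the result is the same as
applying \<open>g\<close> to all rows and \<open>f\<close> to the result, since \<open>g\<close> is a homomorphism. For nullary \<open>g\<close> this says that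
its value is a fixed point of \<open>f\<close>.\<close>

lemma alter_ego_commute:
  assumes N: "algebra Sg N" and AE: "alter_ego Sg N ss NT" and f: "f \<in> syms Sg" and g: "g \<in> gsyms ss"
    and xss: "xss \<in> tuples (ar Sg f) (tuples (gar ss g) (carrier N))"
  shows "sop NT g (map (\<lambda>j. oper N f (map (\<lambda>xs. xs ! j) xss)) [0..<gar ss g]) = oper N f (map (sop NT g) xss)"
proof (cases "gar ss g = 0")
  case True
  have "xs = []" if "xs \<in> set xss" for xs using tuplesD[OF xss that] True by (simp add: tuples_def)
  then have "map (sop NT g) xss \<in> tuples (ar Sg f) {sop NT g []}"
    using xss by (auto simp: tuples_def)
  then show ?thesis using alter_egoD(6)[OF AE g True] f True by (auto simp: subuniverse_def)
next
  case False
  let ?n = "gar ss g" and ?G = "\<lambda>x \<in> {..<gar ss g} \<rightarrow>\<^sub>E carrier N. sop NT g (map x [0..<gar ss g])"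
  let ?x = "\<lambda>xs. \<lambda>i\<in>{..<?n}. xs ! i"
  have x: "map ?x xss \<in> tuples (ar Sg f) (carrier (prod_alg {..<?n} (\<lambda>_. N)))"
    using xss by (rule tuples_map) (use tuple_mem in simp)
  note h = alter_egoD(7)[OF AE g refl False]
  have "map ?G (map ?x xss) = map (sop NT g) xss"
    unfolding map_restrict[OF x[unfolded carrier_prod_alg]] map_map
    by (intro map_cong refl) (simp only: comp_apply restrict_apply'[OF tuple_mem[OF tuplesD[OF xss]]] list_as_tuple[OF tuples_length[OF tuplesD[OF xss]]])
  then have G: "?G (oper (prod_alg {..<?n} (\<lambda>_. N)) f (map ?x xss)) = oper N f (map (sop NT g) xss)"
    by (simp only: hom_oper[OF h f x])
  have o: "oper (prod_alg {..<?n} (\<lambda>_. N)) f (map ?x xss) \<in> {..<?n} \<rightarrow>\<^sub>E carrier N"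
    using algebra_operD[OF algebra_prod f x] N by simp
  have "map (oper (prod_alg {..<?n} (\<lambda>_. N)) f (map ?x xss)) [0..<?n] =
      map (\<lambda>j. oper N f (map (\<lambda>xs. xs ! j) xss)) [0..<?n]"
    by (intro nth_equalityI) (auto simp: oper_prod_alg o_def)
  with G show ?thesis by (simp only: restrict_apply'[OF o])
qed

lemma alter_ego_rel:
  assumes AE: "alter_ego Sg N ss NT" and f: "f \<in> syms Sg" and r: "r \<in> rsyms ss"
    and xss: "xss \<in> tuples (ar Sg f) (srel NT r)"
  shows "map (\<lambda>j. oper N f (map (\<lambda>xs. xs ! j) xss)) [0..<rar ss r] \<in> srel NT r"
proof -
  let ?n = "rar ss r" and ?R = "{x \<in> {..<rar ss r} \<rightarrow>\<^sub>E carrier N. map x [0..<rar ss r] \<in> srel NT r}"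
  let ?x = "\<lambda>xs. \<lambda>i\<in>{..<?n}. xs ! i"
  have t: "xs \<in> tuples ?n (carrier N)" if "xs \<in> srel NT r" for xs
    using is_structD(2)[OF alter_egoD(1)[OF AE] r that] alter_egoD(2)[OF AE] by simp
  have "?x xs \<in> ?R" if "xs \<in> srel NT r" for xs
    using tuple_mem[OF t[OF that]] that list_as_tuple[OF tuples_length[OF t[OF that]]] by simp
  then have "map ?x xss \<in> tuples (ar Sg f) ?R" using xss by (intro tuples_map)
  then have "oper (prod_alg {..<?n} (\<lambda>_. N)) f (map ?x xss) \<in> ?R"
    using alter_egoD(10)[OF AE r refl] f unfolding subuniverse_def by blast
  moreover have "map (oper (prod_alg {..<?n} (\<lambda>_. N)) f (map ?x xss)) [0..<?n] =
      map (\<lambda>j. oper N f (map (\<lambda>xs. xs ! j) xss)) [0..<?n]"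
    by (intro nth_equalityI) (auto simp: oper_prod_alg o_def)
  ultimately show ?thesis by simp
qed

text \<open>The next two closure properties are instances of the commutation of the operations of the algebra with those
of the alter ego: dual spaces are substructures of powers, and morphisms form a subalgebra of a power.\<close>

lemma hom_subpower:
  assumes N: "algebra Sg N" and AE: "alter_ego Sg N ss NT" and A: "algebra Sg A"
  shows "subpower ss (carrier A) NT (hom Sg A N)"
  unfolding subpower_def
proof (intro conjI ballI)
  show "carrier A \<noteq> {}" using A by (simp add: algebra_def)
  show "hom Sg A N \<subseteq> carrier A \<rightarrow>\<^sub>E scar NT" by (auto simp: hom_def alter_egoD(2)[OF AE])
  fix g ys assume g: "g \<in> gsyms ss" and ys: "ys \<in> tuples (gar ss g) (hom Sg A N)"
  have t: "map (\<lambda>y. y a) ys \<in> tuples (gar ss g) (carrier N)" if "a \<in> carrier A" for a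
    using ys by (rule tuples_map) (rule hom_mem[OF _ that])
  show "(\<lambda>a\<in>carrier A. sop NT g (map (\<lambda>y. y a) ys)) \<in> hom Sg A N"
  proof (rule hom_restrictI[OF A])
    show "sop NT g (map (\<lambda>y. y a) ys) \<in> carrier N" if "a \<in> carrier A" for a
      using is_structD(1)[OF alter_egoD(1)[OF AE] g] t[OF that] alter_egoD(2)[OF AE] by simp
    fix f as assume f: "f \<in> syms Sg" and as: "as \<in> tuples (ar Sg f) (carrier A)"
    have "map (\<lambda>a. map (\<lambda>y. y a) ys) as \<in> tuples (ar Sg f) (tuples (gar ss g) (carrier N))"
      using as by (rule tuples_map) (rule t)
    from alter_ego_commute[OF N AE f g this]
    have "sop NT g (map (\<lambda>j. oper N f (map (\<lambda>a. map (\<lambda>y. y a) ys ! j) as)) [0..<gar ss g]) =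
        oper N f (map (\<lambda>a. sop NT g (map (\<lambda>y. y a) ys)) as)" by (simp add: o_def)
    moreover have "map (\<lambda>j. oper N f (map (\<lambda>a. map (\<lambda>y. y a) ys ! j) as)) [0..<gar ss g] =
        map (\<lambda>y. y (oper A f as)) ys"
    proof (rule nth_equalityI)
      fix j assume "j < length (map (\<lambda>j. oper N f (map (\<lambda>a. map (\<lambda>y. y a) ys ! j) as)) [0..<gar ss g])"
      then have j: "j < length ys" "ys ! j \<in> hom Sg A N" using ys by (simp_all add: tuples_nth tuples_length)
      then show "map (\<lambda>j. oper N f (map (\<lambda>a. map (\<lambda>y. y a) ys ! j) as)) [0..<gar ss g] ! j =
          map (\<lambda>y. y (oper A f as)) ys ! j"
        using tuples_length[OF ys] hom_oper[OF j(2) f as] by simp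
    qed (use ys in \<open>simp add: tuples_length\<close>)
    ultimately show "sop NT g (map (\<lambda>y. y (oper A f as)) ys) =
        oper N f (map (\<lambda>a. sop NT g (map (\<lambda>y. y a) ys)) as)" by simp
  qed
qed

lemma mor_subuniverse:
  assumes N: "algebra Sg N" and AE: "alter_ego Sg N ss NT" and X: "is_struct ss X"
    and ne: "mor ss X NT \<noteq> {}"
  shows "subuniverse Sg (prod_alg (scar X) (\<lambda>_. N)) (mor ss X NT)"
  unfolding subuniverse_def
proof (intro conjI ballI)
  note NT = alter_egoD(1,2)[OF AE]
  show "mor ss X NT \<subseteq> carrier (prod_alg (scar X) (\<lambda>_. N))" by (auto simp: mor_def NT(2))
  fix f \<alpha>s assume f: "f \<in> syms Sg" and \<alpha>s: "\<alpha>s \<in> tuples (ar Sg f) (mor ss X NT)"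
  have t: "map (\<lambda>\<alpha>. \<alpha> x) \<alpha>s \<in> tuples (ar Sg f) (carrier N)" if "x \<in> scar X" for x
    using \<alpha>s by (rule tuples_map) (use morD(1)[OF _ that] NT(2) in blast)
  have "(\<lambda>x\<in>scar X. oper N f (map (\<lambda>\<alpha>. \<alpha> x) \<alpha>s)) \<in> mor ss X NT"
  proof (rule mor_restrictI[OF X])
    show "oper N f (map (\<lambda>\<alpha>. \<alpha> x) \<alpha>s) \<in> scar NT" if "x \<in> scar X" for x
      using algebra_operD[OF N f t[OF that]] NT(2) by simp
    show "continuous_map (stop X) (stop NT) (\<lambda>x. oper N f (map (\<lambda>\<alpha>. \<alpha> x) \<alpha>s))"
      by (rule continuous_map_oper[OF alter_egoD(5)[OF AE f] tuples_length[OF \<alpha>s]])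
        (use tuplesD[OF \<alpha>s] morD(2) in blast)
    fix g xs assume g: "g \<in> gsyms ss" and xs: "xs \<in> tuples (gar ss g) (scar X)"
    have "map (\<lambda>\<alpha>. map \<alpha> xs) \<alpha>s \<in> tuples (ar Sg f) (tuples (gar ss g) (carrier N))"
      using \<alpha>s by (rule tuples_map) (use tuples_map[OF xs] morD(1) NT(2) in metis)
    from alter_ego_commute[OF N AE f g this]
    have "oper N f (map (\<lambda>\<alpha>. sop NT g (map \<alpha> xs)) \<alpha>s) =
        sop NT g (map (\<lambda>j. oper N f (map (\<lambda>\<alpha>. map \<alpha> xs ! j) \<alpha>s)) [0..<gar ss g])" by (simp add: o_def)
    moreover have "map (\<lambda>j. oper N f (map (\<lambda>\<alpha>. map \<alpha> xs ! j) \<alpha>s)) [0..<gar ss g] =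
        map (\<lambda>x. oper N f (map (\<lambda>\<alpha>. \<alpha> x) \<alpha>s)) xs"
      using tuples_length[OF xs] by (intro nth_equalityI) simp_all
    moreover have "map (\<lambda>\<alpha>. \<alpha> (sop X g xs)) \<alpha>s = map (\<lambda>\<alpha>. sop NT g (map \<alpha> xs)) \<alpha>s"
      by (intro map_cong refl morD(3)[OF _ g xs] tuplesD[OF \<alpha>s])
    ultimately show "oper N f (map (\<lambda>\<alpha>. \<alpha> (sop X g xs)) \<alpha>s) =
        sop NT g (map (\<lambda>x. oper N f (map (\<lambda>\<alpha>. \<alpha> x) \<alpha>s)) xs)" by metis
  next
    fix r xs assume r: "r \<in> rsyms ss" and xs: "xs \<in> srel X r"
    have "map (\<lambda>\<alpha>. map \<alpha> xs) \<alpha>s \<in> tuples (ar Sg f) (srel NT r)"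
      using \<alpha>s by (rule tuples_map) (rule morD(4)[OF _ r xs])
    from alter_ego_rel[OF AE f r this]
    have "map (\<lambda>j. oper N f (map (\<lambda>\<alpha>. map \<alpha> xs ! j) \<alpha>s)) [0..<rar ss r] \<in> srel NT r" by (simp add: o_def)
    moreover have "map (\<lambda>j. oper N f (map (\<lambda>\<alpha>. map \<alpha> xs ! j) \<alpha>s)) [0..<rar ss r] =
        map (\<lambda>x. oper N f (map (\<lambda>\<alpha>. \<alpha> x) \<alpha>s)) xs"
      using tuples_length[OF is_structD(2)[OF X r xs]] by (intro nth_equalityI) simp_all
    ultimately show "map (\<lambda>x. oper N f (map (\<lambda>\<alpha>. \<alpha> x) \<alpha>s)) xs \<in> srel NT r" by simp
  qed
  then show "oper (prod_alg (scar X) (\<lambda>_. N)) f \<alpha>s \<in> mor ss X NT"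
    by (simp add: oper_prod_alg)
qed (rule ne)

lemma subuniverse_preimage:
  assumes A: "algebra Sg A" and h: "h \<in> hom Sg A B" and S: "subuniverse Sg B S"
    and ne: "\<exists>a \<in> carrier A. h a \<in> S"
  shows "subuniverse Sg A {a \<in> carrier A. h a \<in> S}"
  unfolding subuniverse_def
proof (intro conjI ballI)
  fix f as assume f: "f \<in> syms Sg" and as: "as \<in> tuples (ar Sg f) {a \<in> carrier A. h a \<in> S}"
  have as': "as \<in> tuples (ar Sg f) (carrier A)" "map h as \<in> tuples (ar Sg f) S"
    using as by (auto simp: tuples_def)
  then show "oper A f as \<in> {a \<in> carrier A. h a \<in> S}"
    using algebra_operD[OF A f as'(1)] hom_oper[OF h f as'(1)] S f by (simp add: subuniverse_def)
qed (use ne in auto)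

text \<open>For the copies of \<open>N\<close> that carry \<open>\<^bold>N \<odot> \<^bold>T\<close> and \<open>\<^bold>T \<odot> \<^bold>N\<close>.\<close>

lemma alter_ego_transport:
  assumes A: "algebra Sg A" and B: "algebra Sg B" and AE: "alter_ego Sg A ss NT"
    and h: "(\<lambda>a\<in>carrier A. h a) \<in> hom Sg A B" and k: "(\<lambda>b\<in>carrier B. k b) \<in> hom Sg B A"
    and kh: "\<And>a. a \<in> carrier A \<Longrightarrow> k (h a) = a" and im: "carrier B = h ` carrier A"
  shows "alter_ego Sg B ss (transport h NT)"
proof -
  note NT = alter_egoD(1,2)[OF AE]
  have kh': "\<forall>a \<in> scar NT. k (h a) = a" using kh NT(2) by simp
  note tr = transport_simps[where k = k and h = h, OF NT(1) kh']
    and cont = transport_continuous[where k = k and h = h, OF NT(1) kh']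
  let ?TT = "transport h NT"
  let ?A = "\<lambda>n. prod_alg {..<n} (\<lambda>_. A)" and ?B = "\<lambda>n. prod_alg {..<n} (\<lambda>_. B)"
    and ?T = "\<lambda>n. product_topology (\<lambda>_. stop ?TT) {..<n}"
  have kB: "k b \<in> carrier A" "h (k b) = b" if "b \<in> carrier B" for b using that kh im by auto
  \<comment> \<open>Everything about \<open>B\<close> is pulled back along this homomorphic homeomorphism between finite powers.\<close>
  let ?K = "\<lambda>n x. \<lambda>i\<in>{..<n}. k (x i)"
  have Kc: "continuous_map (?T n) (product_topology (\<lambda>_. stop NT) {..<n}) (?K n)" for n :: nat
    unfolding continuous_map_componentwise
  proof (intro conjI ballI)
    fix i assume i: "i \<in> {..<n}"
    show "continuous_map (?T n) (stop NT) (\<lambda>x. ?K n x i)"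
      using continuous_map_compose[OF continuous_map_product_projection[OF i, of "\<lambda>_. stop ?TT"] cont(2)] i
      by (simp add: o_def)
  qed auto
  have Kh: "(\<lambda>x\<in>carrier (?B n). ?K n x) \<in> hom Sg (?B n) (?A n)" for n :: nat
  proof (rule hom_restrictI[OF algebra_prod[OF B]])
    show "?K n x \<in> carrier (?A n)" if "x \<in> carrier (?B n)" for x
      using that kB by auto
    fix f xs assume f: "f \<in> syms Sg" and xs: "xs \<in> tuples (ar Sg f) (carrier (?B n))"
    have "k (oper B f (map (\<lambda>x. x i) xs)) = oper A f (map (\<lambda>x. k (x i)) xs)" if i: "i < n" for i
    proof -
      have t: "map (\<lambda>x. x i) xs \<in> tuples (ar Sg f) (carrier B)" using xs by (rule tuples_map) (use i in auto)
      show ?thesis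
        using hom_oper[OF k f t] algebra_operD[OF B f t] unfolding map_restrict[OF t] by (simp add: o_def)
    qed
    then show "?K n (oper (?B n) f xs) = oper (?A n) f (map (?K n) xs)"
      by (auto simp: oper_prod_alg fun_eq_iff o_def)
  qed
  have mapK: "map x [0..<n] = map h (map (?K n x) [0..<n])" "map (?K n x) [0..<n] \<in> tuples n (carrier A)"
    if "x \<in> {..<n} \<rightarrow>\<^sub>E carrier B" for x and n :: nat
    using kB PiE_mem[OF that] by (auto simp: tuples_def)
  have top: "topspace (stop ?TT) = carrier B"
    using topspace_transport[where k = k and h = h, OF NT(1) kh'] im NT(2) by simp
  have opB: "continuous_map (?T (ar Sg f)) (stop ?TT) (\<lambda>x. oper B f (map x [0..<ar Sg f]))"
    if f: "f \<in> syms Sg" for f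
  proof -
    let ?n = "ar Sg f"
    have "continuous_map (?T ?n) (stop ?TT)
        (h \<circ> ((\<lambda>x. oper A f (map x [0..<?n])) \<circ> ?K ?n))"
      by (intro continuous_map_compose[OF _ cont(1)] continuous_map_compose[OF Kc alter_egoD(5)[OF AE f]])
    then show ?thesis
    proof (rule continuous_map_eq)
      fix x assume "x \<in> topspace (?T ?n)"
      then have x: "x \<in> {..<?n} \<rightarrow>\<^sub>E carrier B" by (simp add: top)
      have "h (oper A f (map (?K ?n x) [0..<?n])) = oper B f (map h (map (?K ?n x) [0..<?n]))"
        using hom_oper[OF h f mapK(2)[OF x]] algebra_operD[OF A f mapK(2)[OF x]]
        unfolding map_restrict[OF mapK(2)[OF x]] by simp
      then show "(h \<circ> ((\<lambda>x. oper A f (map x [0..<?n])) \<circ> ?K ?n)) x = oper B f (map x [0..<?n])"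
        by (simp only: comp_apply mapK(1)[OF x, symmetric])
    qed
  qed
  have g0: "subuniverse Sg B {sop ?TT g []}" if g: "g \<in> gsyms ss" and n: "gar ss g = 0" for g
  proof -
    note e = alter_egoD(6)[OF AE g n]
    then have eA: "sop NT g [] \<in> carrier A" by (simp add: subuniverse_def)
    have "[] \<in> tuples 0 (scar NT)" by (simp add: tuples_def)
    from tr(2)[OF this, of g] have sop: "sop ?TT g [] = h (sop NT g [])" by simp
    have "subuniverse Sg B {b \<in> carrier B. (\<lambda>b\<in>carrier B. k b) b \<in> {sop NT g []}}"
      by (rule subuniverse_preimage[OF B k e]) (use eA kh im in auto)
    moreover have "{b \<in> carrier B. (\<lambda>b\<in>carrier B. k b) b \<in> {sop NT g []}} = {sop ?TT g []}"
      unfolding sop using eA kh im by auto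
    ultimately show ?thesis by simp
  qed
  have sopTT: "sop ?TT g (map x [0..<n]) = h (sop NT g (map (?K n x) [0..<n]))"
    if "x \<in> {..<n} \<rightarrow>\<^sub>E carrier B" for x g and n :: nat
    using tr(2)[of _ n g] mapK[OF that] NT(2) by metis
  have g1: "(\<lambda>x \<in> {..<n} \<rightarrow>\<^sub>E carrier B. sop ?TT g (map x [0..<n])) \<in> hom Sg (?B n) B \<and>
      continuous_map (?T n) (stop ?TT) (\<lambda>x. sop ?TT g (map x [0..<n]))"
    if g: "g \<in> gsyms ss" and n: "gar ss g = n" "n \<noteq> 0" for g n
  proof
    note G = alter_egoD(7)[OF AE g n] and PB = algebra_prod[of "{..<n}" Sg "\<lambda>_. B", OF B]
    let ?c = "\<lambda>x\<in>carrier (?B n). (\<lambda>a\<in>carrier A. h a) ((\<lambda>x\<in>carrier (?B n).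
       (\<lambda>x\<in>{..<n} \<rightarrow>\<^sub>E carrier A. sop NT g (map x [0..<n])) ((\<lambda>x\<in>carrier (?B n). ?K n x) x)) x)"
    have "?c \<in> hom Sg (?B n) B"
      by (rule hom_comp[OF PB hom_comp[OF PB Kh G] h])
    moreover have "?c = (\<lambda>x \<in> {..<n} \<rightarrow>\<^sub>E carrier B. sop ?TT g (map x [0..<n]))"
      unfolding carrier_prod_alg
    proof (rule restrict_ext)
      fix x assume x: "x \<in> {..<n} \<rightarrow>\<^sub>E carrier B"
      have Kx: "?K n x \<in> {..<n} \<rightarrow>\<^sub>E carrier A" using x kB by auto
      have "map (?K n x) [0..<n] \<in> tuples (gar ss g) (scar NT)" using mapK(2)[OF x] NT(2) n by simp
      then have "sop NT g (map (?K n x) [0..<n]) \<in> carrier A"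
        using is_structD(1)[OF NT(1) g] NT(2) by simp
      then show "(\<lambda>a\<in>carrier A. h a) ((\<lambda>x\<in>{..<n} \<rightarrow>\<^sub>E carrier B. (\<lambda>x\<in>{..<n} \<rightarrow>\<^sub>E carrier A. sop NT g (map x [0..<n]))
          ((\<lambda>x\<in>{..<n} \<rightarrow>\<^sub>E carrier B. ?K n x) x)) x) = sop ?TT g (map x [0..<n])"
        unfolding restrict_apply'[OF x] restrict_apply'[OF Kx] sopTT[OF x] by simp
    qed
    ultimately show "(\<lambda>x \<in> {..<n} \<rightarrow>\<^sub>E carrier B. sop ?TT g (map x [0..<n])) \<in> hom Sg (?B n) B"
      by simp
    have "continuous_map (?T n) (stop ?TT)
        (h \<circ> ((\<lambda>x. sop NT g (map x [0..<n])) \<circ> ?K n))"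
      by (intro continuous_map_compose[OF _ cont(1)] continuous_map_compose[OF Kc alter_egoD(8)[OF AE g n]])
    then show "continuous_map (?T n) (stop ?TT) (\<lambda>x. sop ?TT g (map x [0..<n]))"
    proof (rule continuous_map_eq)
      fix x assume "x \<in> topspace (?T n)"
      then have x: "x \<in> {..<n} \<rightarrow>\<^sub>E carrier B" by (simp add: top)
      show "(h \<circ> ((\<lambda>x. sop NT g (map x [0..<n])) \<circ> ?K n)) x = sop ?TT g (map x [0..<n])"
        unfolding sopTT[OF x] by simp
    qed
  qed
  have rel: "n \<ge> 1 \<and> subuniverse Sg (?B n) {x \<in> {..<n} \<rightarrow>\<^sub>E carrier B. map x [0..<n] \<in> srel ?TT r} \<and>
     closedin (?T n) {x \<in> {..<n} \<rightarrow>\<^sub>E carrier B. map x [0..<n] \<in> srel ?TT r}"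
    if r: "r \<in> rsyms ss" and n: "rar ss r = n" for r n
  proof (intro conjI)
    let ?R = "{x \<in> {..<n} \<rightarrow>\<^sub>E carrier A. map x [0..<n] \<in> srel NT r}"
    let ?R' = "{x \<in> {..<n} \<rightarrow>\<^sub>E carrier B. map x [0..<n] \<in> srel ?TT r}"
    have KR: "?K n x \<in> ?R \<longleftrightarrow> map x [0..<n] \<in> srel ?TT r" if x: "x \<in> {..<n} \<rightarrow>\<^sub>E carrier B" for x
    proof -
      have Kx: "?K n x \<in> {..<n} \<rightarrow>\<^sub>E carrier A" using x kB by auto
      have kh_map: "map k (map h us) = us" if "us \<in> tuples n (carrier A)" for us
        unfolding map_map using tuplesD[OF that] kh by (intro map_idI) simp
      have "us \<in> tuples n (carrier A)" if "us \<in> srel NT r" for us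
        using is_structD(2)[OF NT(1) r that] NT(2) n by simp
      then have "map (?K n x) [0..<n] = us" if "us \<in> srel NT r" "map h (map (?K n x) [0..<n]) = map h us" for us
        using kh_map[OF mapK(2)[OF x]] kh_map[of us] that by metis
      then show ?thesis using Kx unfolding mapK(1)[OF x] tr(3) by blast
    qed
    have eq: "{x \<in> carrier (?B n). (\<lambda>x\<in>carrier (?B n). ?K n x) x \<in> ?R} = ?R'"
      using KR by auto
    obtain x where x: "x \<in> ?R" using alter_egoD(10)[OF AE r n] by (auto simp: subuniverse_def)
    have hx: "(\<lambda>i\<in>{..<n}. h (x i)) \<in> {..<n} \<rightarrow>\<^sub>E carrier B" using x im by auto
    have "?K n (\<lambda>i\<in>{..<n}. h (x i)) = x" using x kh by (auto simp: fun_eq_iff PiE_def extensional_def)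
    then have "\<exists>y\<in>carrier (?B n). (\<lambda>x\<in>carrier (?B n). ?K n x) y \<in> ?R"
      using hx x unfolding carrier_prod_alg by (intro bexI[OF _ hx]) (simp only: restrict_apply'[OF hx])
    from subuniverse_preimage[OF algebra_prod[OF B] Kh alter_egoD(10)[OF AE r n] this]
    show "subuniverse Sg (?B n) ?R'" unfolding eq .
    have "closedin (?T n)
       {x \<in> topspace (?T n). ?K n x \<in> ?R}"
      by (rule closedin_continuous_map_preimage[OF Kc alter_egoD(11)[OF AE r n]])
    moreover have "{x \<in> topspace (?T n). ?K n x \<in> ?R} = ?R'"
      using KR by (auto simp: top)
    ultimately show "closedin (?T n) ?R'" by simp
    show "n \<ge> 1" using alter_egoD(9)[OF AE r] n by simp
  qed
  show ?thesis
    unfolding alter_ego_def Let_def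
    using is_struct_transport[where k = k and h = h, OF NT(1) kh'] tr(1) NT(2) im opB g0 g1 rel
      compact_transport[where k = k and h = h, OF NT(1) kh' alter_egoD(3)[OF AE]] Hausdorff_transport[where k = k and h = h, OF NT(1) kh' alter_egoD(4)[OF AE]]
    by auto
qed

locale gamma_alter_ego = gamma_setting Sg N T \<Gamma> r1 r2
  for Sg :: "'f sgn" and N T :: "('f, 'n) alg" and \<Gamma> :: "'f gpair set" and r1 r2 :: "'f gpair \<Rightarrow> 'f trm" +
  fixes ss :: "('g, 'r) ssgn" and NT :: "('g, 'r, 'n) tstruct"
  assumes AE: "alter_ego Sg N ss NT"
begin

lemma prod_red:
  assumes F: "\<And>i. i \<in> I \<Longrightarrow> algebra Sg (F i)" and \<gamma>: "\<gamma> \<in> \<Gamma>"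
    and xs: "xs \<in> tuples (fst \<gamma>) (carrier (prod_alg I F))"
  shows "oper (prod_alg I (\<lambda>i. red s (F i))) \<gamma> xs = teval (prod_alg I F) xs (\<rho> s \<gamma>)"
proof
  fix i
  note r = rho_trms[OF \<gamma>, of s]
  show "oper (prod_alg I (\<lambda>i. red s (F i))) \<gamma> xs i = teval (prod_alg I F) xs (\<rho> s \<gamma>) i"
    using teval_prod[OF F _ xs r] teval_mem[OF algebra_prod[OF F] xs r] PiE_arb[of _ I _ i]
    by (cases "i \<in> I") (auto simp: oper_prod_alg)
qed

lemma subuniverse_red: "subuniverse Sg A S \<Longrightarrow> subuniverse GS (red s A) S"
  using subuniverse_teval[of Sg A S] rho_trms by (auto simp: subuniverse_def)

lemma continuous_teval:
  assumes "t \<in> trms Sg n"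
  shows "continuous_map (product_topology (\<lambda>_. stop NT) {..<n}) (stop NT) (\<lambda>x. teval N (map x [0..<n]) t)"
  using assms
proof induction
  case (1 i)
  then show ?case
    using continuous_map_product_projection[of i "{..<n}" "\<lambda>_. stop NT"] by simp
next
  case (2 f ts)
  have "continuous_map (product_topology (\<lambda>_. stop NT) {..<n}) (stop NT)
      (\<lambda>x. oper N f (map (\<lambda>\<alpha>. \<alpha> x) (map (\<lambda>t x. teval N (map x [0..<n]) t) ts)))"
    using 2 by (intro continuous_map_oper[OF alter_egoD(5)[OF AE]]) auto
  then show ?case by (simp add: o_def)
qed

text \<open>An alter ego of \<open>\<^bold>N\<close> is one of its reducts too, because continuity, homomorphisms and subalgebras pass from
basic operations to term operations.\<close>

lemma alter_ego_red: "alter_ego GS (red s N) ss NT"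
proof -
  have homs: "h \<in> hom GS (prod_alg {..<n} (\<lambda>_. red s N)) (red s N)"
    if "h \<in> hom Sg (prod_alg {..<n} (\<lambda>_. N)) N" for h and n :: nat
  proof (rule homI)
    fix \<gamma> xs assume \<gamma>: "\<gamma> \<in> syms GS" and xs: "xs \<in> tuples (ar GS \<gamma>) (carrier (prod_alg {..<n} (\<lambda>_. red s N)))"
    then show "h (oper (prod_alg {..<n} (\<lambda>_. red s N)) \<gamma> xs) = oper (red s N) \<gamma> (map h xs)"
      using prod_red[of "{..<n}" "\<lambda>_. N" \<gamma> xs s] N teval_hom[OF algebra_prod that, of xs "fst \<gamma>" "\<rho> s \<gamma>"] rho_trms[of \<gamma> s]
      by simp
  qed (use that in \<open>auto simp: hom_def\<close>)
  have subs: "subuniverse GS (prod_alg {..<n} (\<lambda>_. red s N)) R"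
    if "subuniverse Sg (prod_alg {..<n} (\<lambda>_. N)) R" for R and n :: nat
    unfolding subuniverse_def
  proof (intro conjI ballI)
    show "R \<subseteq> carrier (prod_alg {..<n} (\<lambda>_. red s N))" "R \<noteq> {}" using that by (auto simp: subuniverse_def)
    fix \<gamma> xs assume \<gamma>: "\<gamma> \<in> syms GS" and xs: "xs \<in> tuples (ar GS \<gamma>) R"
    have "xs \<in> tuples (fst \<gamma>) (carrier (prod_alg {..<n} (\<lambda>_. N)))"
      using xs that by (auto simp: subuniverse_def tuples_def)
    then show "oper (prod_alg {..<n} (\<lambda>_. red s N)) \<gamma> xs \<in> R"
      using prod_red[of "{..<n}" "\<lambda>_. N" \<gamma> xs s] N \<gamma> xs subuniverse_teval[OF that _ rho_trms, of xs \<gamma> s] by simp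
  qed
  show ?thesis
    unfolding alter_ego_def Let_def carrier_reduct
    using alter_egoD[OF AE] homs subs subuniverse_red[OF alter_egoD(6)[OF AE]] continuous_teval rho_trms
    by auto
qed

text \<open>The two sorts of the structure \<open>Mstr T NT\<close>.\<close>

abbreviation TT :: "srt \<Rightarrow> ('g, 'r, 'n \<times> 'n) tstruct" where
  "TT s \<equiv> transport (emb s) NT"

lemmas NT_struct = alter_egoD(1)[OF AE] and NT_carrier = alter_egoD(2)[OF AE]
lemma emb_inv: "\<forall>a \<in> scar NT. pr s (emb s a) = a"
  by simp

lemma TT_struct: "is_struct ss (TT s)"
  by (rule is_struct_transport[where h = "emb s" and k = "pr s", OF NT_struct emb_inv])

lemmas TT_mor = mor_transport[where h = "emb s" and k = "pr s" for s, OF NT_struct emb_inv]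

lemma alter_ego_TT: "alter_ego GS (MM s) ss (TT s)"
  by (rule alter_ego_transport[OF algebra_red[OF N] algebra_MM alter_ego_red _ pr_hom])
    (simp_all add: emb_hom carrier_MM)

lemma Mstr_union2: "Mstr T NT = union2 TT"
proof -
  have "TT = case_srt (transport (\<lambda>a. (a, pt)) NT) (transport (\<lambda>a. (pt, a)) NT)"
    by (auto simp: fun_eq_iff emb_simps[abs_def] split: srt.split)
  then show ?thesis by (simp add: Mstr_def Let_def uplus_def pt_def)
qed

lemma sort_of_Mstr: "sort_of (Mstr T NT) s = TT s"
  unfolding Mstr_union2 by (rule sort_of_union2) (rule is_struct_topspace[OF TT_struct])

lemma Mstr_struct: "is_struct2 ss (Mstr T NT)"
  unfolding is_struct2_def sort_of_Mstr using TT_struct by (simp add: Mstr_union2 union2_def)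

lemma alter_ego2_Mstr: "alter_ego2 GS MM ss (Mstr T NT)"
  unfolding alter_ego2_def sort_of_Mstr using Mstr_struct alter_ego_TT by simp

section \<open>Dual spaces of decomposed algebras\<close>

text \<open>The two sorts of the dual space of \<open>A\<close>.\<close>

abbreviation DD :: "('f gpair, 'a) alg \<Rightarrow> srt \<Rightarrow> ('g, 'r, 'a \<Rightarrow> 'n \<times> 'n) tstruct" where
  "DD A s \<equiv> restr (power_str (carrier A) (TT s)) (hom GS A (MM s))"

lemma DD_subpower: "algebra GS A \<Longrightarrow> subpower ss (carrier A) (TT s) (hom GS A (MM s))"
  by (rule hom_subpower[OF algebra_MM alter_ego_TT])

lemma DD_struct: "algebra GS A \<Longrightarrow> is_struct ss (DD A s)"
  by (rule is_struct_subpower[OF TT_struct DD_subpower])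

lemma D2_union2: "D2 GS MM (Mstr T NT) A = union2 (DD A)"
  by (simp add: D2_def power_str2_def restr2_union2 sort_of_Mstr)

lemma D1_subpower: "algebra Sg P \<Longrightarrow> subpower ss (carrier P) NT (hom Sg P N)"
  by (rule hom_subpower[OF N AE])

lemma D1_struct: "algebra Sg P \<Longrightarrow> is_struct ss (D1 Sg N NT P)"
  unfolding D1_def by (rule is_struct_subpower[OF NT_struct D1_subpower])

lemma scar_D1: "scar (D1 Sg N NT P) = hom Sg P N"
  by (simp add: D1_def power_str_simps)

text \<open>Lifting is bijective by \<open>hom_eq_lift\<close>. It and its inverse are morphisms because each of their components is
an evaluation map, followed by a transport between \<open>N\<close> and its copy.\<close>

lemma lift_iso:
  fixes A :: "('f gpair, 'a) alg"
  assumes d: "decomposition A P q"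
  shows "str_iso ss (D1 Sg N NT (P s)) (DD A s) (\<lambda>x\<in>hom Sg (P s) N. lift A q s x)"
proof -
  note A = decompositionD(1)[OF d] and P = HSP_algebra[OF decompositionD(2)[OF d, of s]]
  note q = decompositionD(4)[OF d] and D1s = D1_struct[OF P]
  \<comment> \<open>The inverse of lifting evaluates at an arbitrary element of each fibre of \<open>q s\<close>.\<close>
  define sec where "sec = inv_into (carrier A) (q s)"
  have sec: "sec p \<in> carrier A" "q s (sec p) = p" if "p \<in> carrier (P s)" for p
    using that unfolding sec_def decomposition_surj[OF d, symmetric] by (auto simp: inv_into_into f_inv_into_f)
  define low where "low = (\<lambda>(y :: 'a \<Rightarrow> 'n \<times> 'n). \<lambda>p\<in>carrier (P s). pr s (y (sec p)))"
  have low: "low (lift A q s x) = x" if x: "x \<in> hom Sg (P s) N" for x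
  proof
    show "low (lift A q s x) p = x p" for p
      using x sec by (cases "p \<in> carrier (P s)") (auto simp: low_def lift_def hom_def)
  qed
  have low_hom: "low y \<in> hom Sg (P s) N \<and> lift A q s (low y) = y" if y: "y \<in> hom GS A (MM s)" for y
    using hom_eq_lift[OF d y] low by metis
  have m1: "(\<lambda>x\<in>scar (D1 Sg N NT (P s)). lift A q s x) \<in> mor ss (D1 Sg N NT (P s)) (DD A s)"
  proof (rule mor_into_power[OF D1s DD_subpower[OF A]])
    show "lift A q s x \<in> hom GS A (MM s)" if "x \<in> scar (D1 Sg N NT (P s))" for x
      using that lift_hom[OF d] by (simp add: scar_D1)
    fix a assume a: "a \<in> carrier A"
    have "(\<lambda>x\<in>hom Sg (P s) N. x (q s a)) \<in> mor ss (D1 Sg N NT (P s)) NT"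
      unfolding D1_def by (rule proj_mor[OF NT_struct D1_subpower[OF P] q[OF a]])
    from mor_transport(1)[where k = "pr s" and h = "emb s", OF NT_struct emb_inv D1s this]
    have "(\<lambda>x\<in>hom Sg (P s) N. emb s ((\<lambda>x\<in>hom Sg (P s) N. x (q s a)) x)) \<in> mor ss (D1 Sg N NT (P s)) (TT s)"
      by (simp only: scar_D1)
    moreover have "(\<lambda>x\<in>hom Sg (P s) N. emb s ((\<lambda>x\<in>hom Sg (P s) N. x (q s a)) x)) = (\<lambda>x\<in>hom Sg (P s) N. lift A q s x a)"
      using a by (intro restrict_ext) (simp add: lift_def)
    ultimately show "(\<lambda>x\<in>scar (D1 Sg N NT (P s)). lift A q s x a) \<in> mor ss (D1 Sg N NT (P s)) (TT s)"
      by (simp add: scar_D1)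
  qed
  have m2: "(\<lambda>y\<in>scar (DD A s). low y) \<in> mor ss (DD A s) (D1 Sg N NT (P s))"
    unfolding D1_def
  proof (rule mor_into_power[OF DD_struct[OF A] D1_subpower[OF P]])
    show "low y \<in> hom Sg (P s) N" if "y \<in> scar (DD A s)" for y
      using that low_hom by (simp add: power_str_simps)
    fix p assume p: "p \<in> carrier (P s)"
    from mor_transport(2)[where k = "pr s" and h = "emb s", OF NT_struct emb_inv DD_struct[OF A] proj_mor[OF TT_struct DD_subpower[OF A] sec(1)[OF p]]]
    have "(\<lambda>y\<in>hom GS A (MM s). pr s ((\<lambda>y\<in>hom GS A (MM s). y (sec p)) y)) \<in> mor ss (DD A s) NT"
      by (simp only: power_str_simps)
    moreover have "(\<lambda>y\<in>hom GS A (MM s). pr s ((\<lambda>y\<in>hom GS A (MM s). y (sec p)) y)) = (\<lambda>y\<in>hom GS A (MM s). low y p)"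
      using p by (intro restrict_ext) (simp add: low_def)
    ultimately show "(\<lambda>y\<in>scar (DD A s). low y p) \<in> mor ss (DD A s) NT"
      by (simp add: power_str_simps)
  qed
  show ?thesis
    unfolding str_iso_def
    using m1 m2 low low_hom lift_hom[OF d]
    by (auto simp: scar_D1 power_str_simps intro!: bexI[of _ "\<lambda>y\<in>hom GS A (MM s). low y"])
qed

end

section \<open>The duality\<close>

lemma eval1_separates:
  assumes "alg_iso Sg P E (eval1 Sg N P)" "p \<in> carrier P" "p' \<in> carrier P" "p \<noteq> p'"
  shows "\<exists>x \<in> hom Sg P N. x p \<noteq> x p'"
proof (rule ccontr)
  assume "\<not> ?thesis"
  then have "(\<lambda>x\<in>hom Sg P N. x p) = (\<lambda>x\<in>hom Sg P N. x p')" by (intro restrict_ext) simp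
  then have "eval1 Sg N P p = eval1 Sg N P p'" using assms by (simp add: eval1_def)
  then show False using assms by (auto simp: alg_iso_def bij_betw_def inj_on_def)
qed

context gamma_alter_ego
begin

abbreviation MT :: "('g, 'r, 'n \<times> 'n) tstruct2" where
  "MT \<equiv> Mstr T NT"

lemma univ2_D2: "univ2 (D2 GS MM MT A) = (SIGMA s:UNIV. hom GS A (MM s))"
  by (simp add: D2_union2 univ2_union2 power_str_simps)

lemma scar_TT: "scar (TT s) = carrier (MM s)"
  using alter_egoD(2)[OF alter_ego_TT] .

lemma eval2_mor:
  assumes A: "algebra GS A" and a: "a \<in> carrier A"
  shows "eval2 GS MM A a \<in> mor2 ss (D2 GS MM MT A) MT"
proof -
  have "(\<lambda>y\<in>hom GS A (MM s). y a) \<in> mor ss (DD A s) (TT s)" for s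
    by (rule proj_mor[OF TT_struct DD_subpower[OF A] a])
  from mor2_glue[where X = "DD A" and Y = TT, OF DD_struct[OF A] TT_struct this]
  have "(\<lambda>(s, x)\<in>univ2 (D2 GS MM MT A). (s, (\<lambda>y\<in>hom GS A (MM s). y a) x)) \<in> mor2 ss (D2 GS MM MT A) MT"
    by (simp only: D2_union2 flip: Mstr_union2)
  moreover have "(\<lambda>(s, x)\<in>univ2 (D2 GS MM MT A). (s, (\<lambda>y\<in>hom GS A (MM s). y a) x)) = eval2 GS MM A a"
    using a by (auto simp: fun_eq_iff eval2_def univ2_D2)
  ultimately show ?thesis by simp
qed

lemma eval2_hom:
  assumes A: "algebra GS A"
  shows "eval2 GS MM A \<in> hom GS A (E2 MM ss MT (D2 GS MM MT A))"
  unfolding eval2_def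
proof (rule hom_restrictI[OF A])
  fix a assume a: "a \<in> carrier A"
  then show "(\<lambda>(s, x)\<in>SIGMA s:UNIV. hom GS A (MM s). (s, x a)) \<in> carrier (E2 MM ss MT (D2 GS MM MT A))"
    using eval2_mor[OF A a] by (simp add: E2_def eval2_def)
next
  fix \<gamma> as assume \<gamma>: "\<gamma> \<in> syms GS" and as: "as \<in> tuples (ar GS \<gamma>) (carrier A)"
  show "(\<lambda>(s, x)\<in>SIGMA s:UNIV. hom GS A (MM s). (s, x (oper A \<gamma> as))) =
      oper (E2 MM ss MT (D2 GS MM MT A)) \<gamma> (map (\<lambda>a. \<lambda>(s, x)\<in>SIGMA s:UNIV. hom GS A (MM s). (s, x a)) as)"
    using hom_oper[OF _ \<gamma> as] by (auto simp: E2_def univ2_D2 fun_eq_iff o_def)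
qed

text \<open>A morphism \<open>\<alpha>\<close> on the dual space of \<open>A\<close> restricts on sort \<open>s\<close> to a morphism on the dual space of \<open>P s\<close>,
which is evaluation at some \<open>p s\<close>. Then \<open>\<alpha>\<close> is evaluation at the element of \<open>A\<close> with coordinates \<open>p S1\<close> and
\<open>p S2\<close>.\<close>

lemma duality_decomposed:
  fixes A :: "('f gpair, 'a) alg" and P :: "srt \<Rightarrow> ('f, 'b) alg"
  assumes d: "decomposition A P q"
    and dual: "\<And>s. alg_iso Sg (P s) (E1 N ss NT (D1 Sg N NT (P s))) (eval1 Sg N (P s))"
  shows "alg_iso GS A (E2 MM ss MT (D2 GS MM MT A)) (eval2 GS MM A)"
proof -
  note A = decompositionD(1)[OF d] and P = HSP_algebra[OF decompositionD(2)[OF d]]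
  let ?E = "eval2 GS MM A"
  have val: "?E a (s, y) = (s, y a)" if "a \<in> carrier A" "y \<in> hom GS A (MM s)" for a s y
    using that by (simp add: eval2_def)
  have inj: "inj_on ?E (carrier A)"
  proof (rule inj_onI, rule ccontr)
    fix a b assume ab: "a \<in> carrier A" "b \<in> carrier A" "?E a = ?E b" "a \<noteq> b"
    then obtain s where "q s a \<noteq> q s b" using decomposition_eqI[OF d] by blast
    then obtain x where x: "x \<in> hom Sg (P s) N" "x (q s a) \<noteq> x (q s b)"
      using eval1_separates[OF dual decompositionD(4)[OF d ab(1)] decompositionD(4)[OF d ab(2)]] by blast
    have "lift A q s x a = lift A q s x b"
      using ab(3) val[OF ab(1) lift_hom[OF d x(1)]] val[OF ab(2) lift_hom[OF d x(1)]] by simp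
    then show False using x(2) ab(1,2) by (simp add: lift_def)
  qed
  have "\<exists>a\<in>carrier A. ?E a = \<alpha>" if \<alpha>: "\<alpha> \<in> mor2 ss (D2 GS MM MT A) MT" for \<alpha>
  proof -
    have \<alpha>': "\<alpha> \<in> mor2 ss (union2 (DD A)) (union2 TT)" using \<alpha> by (simp only: D2_union2 flip: Mstr_union2)
    define \<alpha>s where "\<alpha>s = (\<lambda>s. \<lambda>y\<in>scar (DD A s). snd (\<alpha> (s, y)))"
    define \<beta> where "\<beta> = (\<lambda>s. \<lambda>x\<in>hom Sg (P s) N. pr s (snd (\<alpha> (s, lift A q s x))))"
    have \<alpha>s: "\<alpha>s s \<in> mor ss (DD A s) (TT s)" for s
      unfolding \<alpha>s_def by (rule mor2_component[OF DD_struct[OF A] TT_struct \<alpha>'])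
    have "\<beta> s \<in> mor ss (D1 Sg N NT (P s)) NT" for s
    proof -
      note L = str_iso_morD[OF lift_iso[OF d, of s]]
      from TT_mor(2)[OF D1_struct[OF P]
          mor_comp[OF D1_struct[OF P] L \<alpha>s]]
      have m: "(\<lambda>x\<in>hom Sg (P s) N. pr s ((\<lambda>x\<in>hom Sg (P s) N. \<alpha>s s ((\<lambda>x\<in>hom Sg (P s) N. lift A q s x) x)) x))
          \<in> mor ss (D1 Sg N NT (P s)) NT"
        by (simp only: scar_D1)
      have "(\<lambda>x\<in>hom Sg (P s) N. pr s ((\<lambda>x\<in>hom Sg (P s) N. \<alpha>s s ((\<lambda>x\<in>hom Sg (P s) N. lift A q s x) x)) x)) = \<beta> s"
        unfolding \<beta>_def by (intro restrict_ext) (simp add: \<alpha>s_def power_str_simps lift_hom[OF d])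
      with m show ?thesis by simp
    qed
    then have "\<beta> s \<in> carrier (E1 N ss NT (D1 Sg N NT (P s)))" for s by (simp add: E1_def)
    then have "\<forall>s. \<exists>p. p \<in> carrier (P s) \<and> eval1 Sg N (P s) p = \<beta> s"
      using dual unfolding alg_iso_def bij_betw_def by (metis imageE)
    then obtain p where p: "\<And>s. p s \<in> carrier (P s)" "\<And>s. eval1 Sg N (P s) (p s) = \<beta> s" by metis
    obtain a where a: "a \<in> carrier A" "\<And>s. q s a = p s"
      using decomposition_ex[OF d, of p] p(1) by blast
    have "?E a u = \<alpha> u" for u
    proof (cases "u \<in> univ2 (D2 GS MM MT A)")
      case True
      then obtain s y where u: "u = (s, y)" and y: "y \<in> hom GS A (MM s)" by (auto simp: univ2_D2)
      obtain x where x: "x \<in> hom Sg (P s) N" "y = lift A q s x" by (rule hom_eq_lift[OF d y])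
      have c: "y \<in> car2 (D2 GS MM MT A) s" using y by (simp add: D2_def restr2_def)
      have "snd (\<alpha> (s, y)) \<in> carrier (MM s)"
        using mor2D(2)[OF \<alpha> c] by (simp add: Mstr_union2 union2_def scar_TT)
      then have "snd (\<alpha> (s, y)) = emb s (pr s (snd (\<alpha> (s, y))))" by (rule emb_pr[symmetric])
      also have "pr s (snd (\<alpha> (s, y))) = \<beta> s x" using x by (simp add: \<beta>_def)
      also have "\<beta> s x = x (q s a)" using p(1) x(1) a(2) by (simp add: p(2)[symmetric] eval1_def)
      also have "emb s (x (q s a)) = y a" using a x by (simp add: lift_def)
      finally have "snd (\<alpha> (s, y)) = y a" .
      then show ?thesis using mor2D(1)[OF \<alpha> c] val[OF a(1) y] u by simp
    qed (use mor2_outside[OF \<alpha>] mor2_outside[OF eval2_mor[OF A a(1)]] in simp)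
    then have "?E a = \<alpha>" ..
    with a show ?thesis by blast
  qed
  moreover have "carrier (E2 MM ss MT (D2 GS MM MT A)) = mor2 ss (D2 GS MM MT A) MT" by (simp add: E2_def)
  ultimately have "?E ` carrier A = carrier (E2 MM ss MT (D2 GS MM MT A))"
    using eval2_mor[OF A] by blast
  then show ?thesis using eval2_hom[OF A] inj by (simp add: alg_iso_def bij_betw_def)
qed

section \<open>Full and strong dualities\<close>

lemma E1_HSP:
  assumes "is_struct ss X" "mor ss X NT \<noteq> {}"
  shows "E1 N ss NT X \<in> HSP Sg {N}"
  unfolding E1_def by (rule HSP_subalg[OF HSP_prod mor_subuniverse[OF N AE assms]]) (rule HSP_N)

text \<open>A two-sorted morphism is a pair of morphisms, one on each sort. Both sorts have to admit morphisms:
otherwise there would be no two-sorted morphism at all, even if one of the sorts had some.\<close>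

lemma E2_decomposition:
  fixes X :: "srt \<Rightarrow> ('g, 'r, 'x) tstruct"
  assumes X: "\<And>s. is_struct ss (X s)" and ne: "\<And>s. mor ss (X s) NT \<noteq> {}"
  shows "decomposition (E2 MM ss MT (union2 X)) (\<lambda>s. E1 N ss NT (X s))
     (\<lambda>s. \<lambda>\<alpha>\<in>mor2 ss (union2 X) MT. \<lambda>x\<in>scar (X s). pr s (snd (\<alpha> (s, x))))"
    (is "decomposition ?A ?P ?q")
proof -
  let ?m2 = "mor2 ss (union2 X) MT"
  have carrA: "carrier ?A = ?m2" by (simp add: E2_def)
  have comp: "(\<lambda>x\<in>scar (X s). snd (\<alpha> (s, x))) \<in> mor ss (X s) (TT s)" if "\<alpha> \<in> ?m2" for s \<alpha>
    using mor2_component[where X = X and Y = TT, OF X TT_struct] that by (simp only: Mstr_union2)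
  have glue: "(\<lambda>(s, x)\<in>univ2 (union2 X). (s, f s x)) \<in> ?m2" if "\<And>s. f s \<in> mor ss (X s) (TT s)" for f
    using mor2_glue[where X = X and Y = TT, OF X TT_struct that] by (simp only: Mstr_union2)
  have TTne: "mor ss (X s) (TT s) \<noteq> {}" for s
    using ne[of s] TT_mor(1)[OF X] by blast
  have A: "algebra GS ?A"
    unfolding algebra_def
  proof (intro conjI ballI)
    have "\<forall>s. \<exists>f. f \<in> mor ss (X s) (TT s)" using TTne by blast
    then obtain f where "\<And>s. f s \<in> mor ss (X s) (TT s)" by metis
    then show "carrier ?A \<noteq> {}" using glue carrA by blast
    fix \<gamma> \<alpha>s assume \<gamma>: "\<gamma> \<in> syms GS" and \<alpha>s: "\<alpha>s \<in> tuples (ar GS \<gamma>) (carrier ?A)"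
    let ?c = "\<lambda>s \<alpha>. \<lambda>x\<in>scar (X s). snd (\<alpha> (s, x))"
    have "map (?c s) \<alpha>s \<in> tuples (ar GS \<gamma>) (mor ss (X s) (TT s))" for s
      using \<alpha>s unfolding carrA by (rule tuples_map) (rule comp)
    then have "oper (prod_alg (scar (X s)) (\<lambda>_. MM s)) \<gamma> (map (?c s) \<alpha>s) \<in> mor ss (X s) (TT s)" for s
      using mor_subuniverse[OF algebra_MM alter_ego_TT X TTne] \<gamma> unfolding subuniverse_def by blast
    from glue[OF this]
    have "(\<lambda>(s, x)\<in>univ2 (union2 X). (s, oper (prod_alg (scar (X s)) (\<lambda>_. MM s)) \<gamma> (map (?c s) \<alpha>s) x)) \<in> ?m2" .
    moreover have "(\<lambda>(s, x)\<in>univ2 (union2 X). (s, oper (prod_alg (scar (X s)) (\<lambda>_. MM s)) \<gamma> (map (?c s) \<alpha>s) x)) =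
        oper ?A \<gamma> \<alpha>s"
      by (auto simp: E2_def fun_eq_iff univ2_union2 oper_prod_alg o_def)
    ultimately show "oper ?A \<gamma> \<alpha>s \<in> carrier ?A" by (simp add: carrA)
  qed
  have qm: "?q s \<alpha> \<in> mor ss (X s) NT" if \<alpha>: "\<alpha> \<in> ?m2" for s \<alpha>
  proof -
    from TT_mor(2)[OF X comp[OF \<alpha>]]
    have "(\<lambda>x\<in>scar (X s). pr s ((\<lambda>x\<in>scar (X s). snd (\<alpha> (s, x))) x)) \<in> mor ss (X s) NT" .
    moreover have "(\<lambda>x\<in>scar (X s). pr s ((\<lambda>x\<in>scar (X s). snd (\<alpha> (s, x))) x)) = ?q s \<alpha>"
      using \<alpha> by (auto simp: fun_eq_iff)
    ultimately show ?thesis by simp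
  qed
  have MMval: "snd (\<alpha> (s, x)) \<in> carrier (MM s)" if "\<alpha> \<in> ?m2" "x \<in> scar (X s)" for \<alpha> s x
    using morD(1)[OF comp[OF that(1)] that(2)] that(2) by (simp add: scar_TT)
  have q: "?q s \<in> hom GS ?A (red s (?P s))" for s
  proof -
    have "(\<lambda>\<alpha>\<in>carrier ?A. \<lambda>x\<in>scar (X s). pr s (snd (\<alpha> (s, x)))) \<in> hom GS ?A (red s (?P s))"
    proof (rule hom_restrictI[OF A])
      show "(\<lambda>x\<in>scar (X s). pr s (snd (\<alpha> (s, x)))) \<in> carrier (red s (?P s))" if "\<alpha> \<in> carrier ?A" for \<alpha>
        using qm[of \<alpha> s] that by (simp add: carrA E1_def)
      fix \<gamma> \<alpha>s assume \<gamma>: "\<gamma> \<in> syms GS" and \<alpha>s: "\<alpha>s \<in> tuples (ar GS \<gamma>) (carrier ?A)"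
      let ?k = "\<lambda>\<alpha>. \<lambda>x\<in>scar (X s). pr s (snd (\<alpha> (s, x)))" and ?B = "prod_alg (scar (X s)) (\<lambda>_. N)"
      have r: "\<rho> s \<gamma> \<in> trms Sg (fst \<gamma>)" using \<gamma> rho_trms by simp
      have k: "map ?k \<alpha>s \<in> tuples (fst \<gamma>) (mor ss (X s) NT)"
        by (rule tuples_map[OF \<alpha>s[unfolded carrA gsgn_simps]]) (use qm in simp)
      have mor_sub: "mor ss (X s) NT \<subseteq> carrier ?B" by (auto simp: mor_def NT_carrier)
      have k': "map ?k \<alpha>s \<in> tuples (fst \<gamma>) (carrier ?B)"
        using k mor_sub by (auto simp: tuples_def)
      have "teval ?B (map ?k \<alpha>s) (\<rho> s \<gamma>) x = pr s (snd (oper ?A \<gamma> \<alpha>s (s, x)))" if x: "x \<in> scar (X s)" for x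
      proof -
        have ts: "map (\<lambda>\<alpha>. snd (\<alpha> (s, x))) \<alpha>s \<in> tuples (ar GS \<gamma>) (carrier (MM s))"
          using \<alpha>s unfolding carrA by (rule tuples_map) (rule MMval[OF _ x])
        have "teval ?B (map ?k \<alpha>s) (\<rho> s \<gamma>) x = teval N (map (\<lambda>\<beta>. \<beta> x) (map ?k \<alpha>s)) (\<rho> s \<gamma>)"
          by (rule teval_prod[OF N x k' r])
        also have "map (\<lambda>\<beta>. \<beta> x) (map ?k \<alpha>s) = map (pr s) (map (\<lambda>\<alpha>. snd (\<alpha> (s, x))) \<alpha>s)"
          using x by simp
        also have "teval N \<dots> (\<rho> s \<gamma>) = pr s (oper (MM s) \<gamma> (map (\<lambda>\<alpha>. snd (\<alpha> (s, x))) \<alpha>s))"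
          using hom_oper[OF pr_hom \<gamma> ts] algebra_operD[OF algebra_MM \<gamma> ts]
          unfolding map_restrict[OF ts] by simp
        also have "oper (MM s) \<gamma> (map (\<lambda>\<alpha>. snd (\<alpha> (s, x))) \<alpha>s) = snd (oper ?A \<gamma> \<alpha>s (s, x))"
          using x by (simp add: E2_def univ2_union2)
        finally show ?thesis .
      qed
      moreover have "teval ?B (map ?k \<alpha>s) (\<rho> s \<gamma>) \<in> carrier ?B"
        by (rule teval_mem[OF algebra_prod[OF N] k' r])
      ultimately have "?k (oper ?A \<gamma> \<alpha>s) x = teval ?B (map ?k \<alpha>s) (\<rho> s \<gamma>) x" for x
        using PiE_arb[of _ "scar (X s)" _ x] by (cases "x \<in> scar (X s)") auto
      then show "?k (oper ?A \<gamma> \<alpha>s) = oper (red s (?P s)) \<gamma> (map ?k \<alpha>s)"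
        by (simp add: E1_def fun_eq_iff)
    qed
    then show ?thesis by (simp add: carrA)
  qed
  have eq: "\<alpha> = \<alpha>'" if \<alpha>: "\<alpha> \<in> ?m2" "\<alpha>' \<in> ?m2" and e: "\<And>s. ?q s \<alpha> = ?q s \<alpha>'" for \<alpha> \<alpha>'
  proof
    fix u show "\<alpha> u = \<alpha>' u"
    proof (cases "u \<in> univ2 (union2 X)")
      case True
      then obtain s x where u: "u = (s, x)" and x: "x \<in> scar (X s)" by (auto simp: univ2_union2)
      have "pr s (snd (\<alpha> (s, x))) = pr s (snd (\<alpha>' (s, x)))"
        using fun_cong[OF e[of s], of x] \<alpha> x by simp
      then have "snd (\<alpha> (s, x)) = snd (\<alpha>' (s, x))"
        using MMval[OF \<alpha>(1) x] MMval[OF \<alpha>(2) x] emb_pr by metis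
      moreover have "x \<in> car2 (union2 X) s" using x by (simp add: union2_def)
      ultimately show ?thesis using mor2D(1)[OF \<alpha>(1)] mor2D(1)[OF \<alpha>(2)] u by metis
    qed (use mor2_outside \<alpha> in metis)
  qed
  have "inj_on (\<lambda>\<alpha>. (?q S1 \<alpha>, ?q S2 \<alpha>)) ?m2"
  proof (rule inj_onI)
    fix \<alpha> \<alpha>' assume *: "\<alpha> \<in> ?m2" "\<alpha>' \<in> ?m2" "(?q S1 \<alpha>, ?q S2 \<alpha>) = (?q S1 \<alpha>', ?q S2 \<alpha>')"
    have "\<forall>s. ?q s \<alpha> = ?q s \<alpha>'" unfolding forall_srt using *(3) by blast
    then show "\<alpha> = \<alpha>'" using eq[OF *(1,2)] by blast
  qed
  moreover have "(\<lambda>\<alpha>. (?q S1 \<alpha>, ?q S2 \<alpha>)) ` ?m2 = carrier (?P S1) \<times> carrier (?P S2)"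
  proof
    show "(\<lambda>\<alpha>. (?q S1 \<alpha>, ?q S2 \<alpha>)) ` ?m2 \<subseteq> carrier (?P S1) \<times> carrier (?P S2)"
      using qm by (auto simp only: E1_def carrier_subalg)
    show "carrier (?P S1) \<times> carrier (?P S2) \<subseteq> (\<lambda>\<alpha>. (?q S1 \<alpha>, ?q S2 \<alpha>)) ` ?m2"
    proof
      fix b assume b: "b \<in> carrier (?P S1) \<times> carrier (?P S2)"
      have \<beta>: "pr s b \<in> mor ss (X s) NT" for s using b by (cases s) (auto simp: E1_def)
      let ?\<alpha> = "\<lambda>(s, x)\<in>univ2 (union2 X). (s, (\<lambda>x\<in>scar (X s). emb s (pr s b x)) x)"
      have \<alpha>: "?\<alpha> \<in> ?m2"
        by (rule glue) (rule TT_mor(1)[OF X \<beta>])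
      have "?q s ?\<alpha> = pr s b" for s
      proof
        show "?q s ?\<alpha> x = pr s b x" for x
          using \<alpha> morD(5)[OF \<beta>[of s], of x] by (cases "x \<in> scar (X s)") (simp_all add: univ2_union2)
      qed
      from this[of S1] this[of S2] have b: "b = (?q S1 ?\<alpha>, ?q S2 ?\<alpha>)" by (simp only: pr_simps prod.collapse)
      show "b \<in> (\<lambda>\<alpha>. (?q S1 \<alpha>, ?q S2 \<alpha>)) ` ?m2" by (rule image_eqI[OF _ \<alpha>]) (rule b)
    qed
  qed
  ultimately have "bij_betw (\<lambda>\<alpha>. (?q S1 \<alpha>, ?q S2 \<alpha>)) (carrier ?A) (carrier (?P S1) \<times> carrier (?P S2))"
    unfolding carrA by (rule bij_betw_imageI)
  then show ?thesis
    unfolding decomposition_def using A q E1_HSP[OF X ne] by blast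
qed

lemma IScP_rep: "X \<in> IScP ss NT \<longleftrightarrow> representable ss NT X"
  by (rule IScP_iff_representable[OF alter_egoD(1,3,4)[OF AE]])

lemma IScP2_sorts: "X \<in> IScP2 ss MT \<longleftrightarrow> is_struct2 ss X \<and> (\<forall>s. sort_of X s \<in> IScP ss NT)"
proof -
  have "X \<in> IScP2 ss MT \<longleftrightarrow> is_struct2 ss X \<and> (\<forall>s. representable ss (TT s) (sort_of X s))"
    using IScP2_iff_representable[OF Mstr_struct, of X] alter_egoD(3,4)[OF alter_ego_TT] by (simp only: sort_of_Mstr)
  then show ?thesis
    unfolding IScP_rep representable_transport[where h = "emb s" and k = "pr s" for s, OF NT_struct emb_inv] .
qed

lemma IScP_struct: "X \<in> IScP ss NT \<Longrightarrow> is_struct ss X"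
  by (simp add: IScP_rep representable_def)

lemma IScP_mor: "X \<in> IScP ss NT \<Longrightarrow> mor ss X NT \<noteq> {}"
  by (simp add: IScP_rep representable_def)

text \<open>On sort \<open>s\<close> the map \<open>coeval2\<close> is the composite of the isomorphism \<open>coeval1\<close> for that sort and the isomorphism
\<open>lift\<close> for the decomposition of the algebra of morphisms.\<close>

lemma full_two_sorted:
  fixes X :: "('g, 'r, 'x) tstruct2"
  assumes X: "X \<in> IScP2 ss MT"
    and full: "\<And>s. str_iso ss (sort_of X s) (D1 Sg N NT (E1 N ss NT (sort_of X s))) (coeval1 ss NT (sort_of X s))"
  shows "str_iso2 ss X (D2 GS MM MT (E2 MM ss MT X)) (coeval2 ss MT X)"
proof -
  let ?X = "sort_of X"
  have X2: "is_struct2 ss X" and "\<And>s. ?X s \<in> IScP ss NT" using X by (simp_all add: IScP2_sorts)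
  note Xs = IScP_struct[OF this(2)] and ne = IScP_mor[OF this(2)]
  note u = is_struct2_sorts(1)[OF X2]
  define q where "q = (\<lambda>s. \<lambda>\<alpha>\<in>mor2 ss (union2 ?X) MT. \<lambda>x\<in>scar (?X s). pr s (snd (\<alpha> (s, x))))"
  let ?A = "E2 MM ss MT X" and ?P = "\<lambda>s. E1 N ss NT (?X s)"
  have d: "decomposition ?A ?P q"
    using E2_decomposition[where X = ?X, OF Xs ne] unfolding q_def[symmetric] by (simp only: u)
  note A = decompositionD(1)[OF d]
  define f where "f = (\<lambda>s. \<lambda>x\<in>scar (?X s). (\<lambda>x\<in>hom Sg (?P s) N. lift ?A q s x) (coeval1 ss NT (?X s) x))"
  have f: "str_iso ss (?X s) (DD ?A s) (f s)" for s
    unfolding f_def by (rule str_iso_comp[OF Xs DD_struct[OF A] full lift_iso[OF d]])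
  have "str_iso2 ss X (D2 GS MM MT ?A) (\<lambda>(s, x)\<in>univ2 X. (s, f s x))"
    using str_iso2_glue[where X = ?X and f = f, OF Xs DD_struct[OF A] f] by (simp only: u D2_union2)
  moreover have "(\<lambda>(s, x)\<in>univ2 X. (s, f s x)) = coeval2 ss MT X"
  proof
    fix p show "(\<lambda>(s, x)\<in>univ2 X. (s, f s x)) p = coeval2 ss MT X p"
    proof (cases "p \<in> univ2 X")
      case True
      then obtain s x where p: "p = (s, x)" and x: "x \<in> scar (?X s)"
        by (auto simp: univ2_def sort_of_def)
      have c: "coeval1 ss NT (?X s) x \<in> hom Sg (?P s) N"
        using morD(1)[OF str_iso_morD[OF full] x] by (simp add: scar_D1)
      have "f s x = lift ?A q s (coeval1 ss NT (?X s) x)" using x c by (simp add: f_def)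
      also have "\<dots> = (\<lambda>\<alpha>\<in>mor2 ss X MT. snd (\<alpha> (s, x)))"
        unfolding lift_def E2_def alg.simps
      proof (rule restrict_ext)
        fix \<alpha> assume \<alpha>: "\<alpha> \<in> mor2 ss X MT"
        have "q s \<alpha> \<in> mor ss (?X s) NT"
          using decompositionD(4)[OF d, of \<alpha> s] \<alpha> by (simp add: E2_def E1_def)
        then have "coeval1 ss NT (?X s) x (q s \<alpha>) = pr s (snd (\<alpha> (s, x)))"
          using x \<alpha> by (simp add: coeval1_def) (simp add: q_def u)
        moreover have "x \<in> car2 X s" using x by (simp add: sort_of_def)
        then have "snd (\<alpha> (s, x)) \<in> carrier (MM s)"
          using mor2D(2)[OF \<alpha>] by (simp add: Mstr_union2 union2_def scar_TT[symmetric])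
        ultimately show "emb s (coeval1 ss NT (?X s) x (q s \<alpha>)) = snd (\<alpha> (s, x))" by (simp add: emb_pr)
      qed
      finally show ?thesis using True p by (simp add: coeval2_def)
    qed (simp add: coeval2_def)
  qed
  ultimately show ?thesis by simp
qed

text \<open>Embeddings, morphisms and extensions of morphisms are pairs of such, one on each sort.\<close>

lemma injective_two_sorted:
  assumes inj: "injective_in ss NT (IScP ss NT :: ('g, 'r, 'x) tstruct set)"
  shows "injective_in2 ss MT (IScP2 ss MT :: ('g, 'r, 'x) tstruct2 set)"
  unfolding injective_in2_def
proof (intro ballI allI impI)
  fix X Y :: "('g, 'r, 'x) tstruct2" and \<phi> \<psi>
  assume X: "X \<in> IScP2 ss MT" and Y: "Y \<in> IScP2 ss MT"
    and "str_embedding2 ss X Y \<phi> \<and> \<psi> \<in> mor2 ss X MT"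
  then have \<phi>: "str_embedding2 ss X Y \<phi>" and \<psi>: "\<psi> \<in> mor2 ss X MT" by blast+
  let ?X = "sort_of X" and ?Y = "sort_of Y"
  have X2: "is_struct2 ss X" "\<And>s. ?X s \<in> IScP ss NT" and Y2: "is_struct2 ss Y" "\<And>s. ?Y s \<in> IScP ss NT"
    using X Y by (simp_all add: IScP2_sorts)
  note Xs = IScP_struct[OF X2(2)] and Ys = IScP_struct[OF Y2(2)]
  note uX = is_struct2_sorts(1)[OF X2(1)] and uY = is_struct2_sorts(1)[OF Y2(1)]
  define Z where "Z = (\<lambda>s. {y. (s, y) \<in> \<phi> ` univ2 X})"
  have Z: "closed_sub2 ss Y Z" and iso: "str_iso2 ss X (restr2 Y Z) \<phi>"
    using \<phi> unfolding str_embedding2_def Let_def Z_def by blast+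
  have Zs: "closed_sub ss (?Y s) (Z s)" for s
    using Z closed_sub2_union2[of ss ?Y Z] unfolding uY by blast
  have Rs: "is_struct ss (restr (?Y s) (Z s))" for s
  proof -
    have "Z s \<subseteq> scar (?Y s)"
      using closedin_subset[of "stop (?Y s)" "Z s"] Zs[of s] is_struct_topspace[OF Ys] by (simp add: closed_sub_def)
    moreover have "xs \<in> tuples (rar ss r) (scar (?Y s))" if "r \<in> rsyms ss" "xs \<in> srel (?Y s) r" for xs r
      by (rule is_structD(2)[OF Ys that])
    ultimately show ?thesis
      using Zs[of s] is_struct_topspace[OF Ys] by (fastforce simp: is_struct_def restr_def closed_sub_def tuples_def)
  qed
  define \<phi>s where "\<phi>s = (\<lambda>s. \<lambda>x\<in>scar (?X s). snd (\<phi> (s, x)))"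
  have R: "restr2 Y Z = union2 (\<lambda>s. restr (?Y s) (Z s))"
    using restr2_union2[of ?Y Z] by (simp only: uY)
  have isos: "str_iso ss (?X s) (restr (?Y s) (Z s)) (\<phi>s s)" for s
    unfolding \<phi>s_def
    by (rule str_iso2_component[OF Xs Rs]) (use iso in \<open>simp only: uX R\<close>)
  have \<phi>m: "\<phi> \<in> mor2 ss X (restr2 Y Z)" using iso by (simp add: str_iso2_def)
  have tag: "\<phi> (s, x) = (s, \<phi>s s x)" if "x \<in> scar (?X s)" for s x
    using mor2D(1)[OF \<phi>m, of x s] that by (simp add: \<phi>s_def sort_of_def)
  have "\<phi>s s ` scar (?X s) = Z s" for s
  proof -
    have "univ2 X = (SIGMA s:UNIV. scar (?X s))" using univ2_union2[of ?X] by (simp only: uX)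
    then show ?thesis using tag by (force simp: Z_def)
  qed
  then have emb: "str_embedding ss (?X s) (?Y s) (\<phi>s s)" for s
    using Zs isos by (simp add: str_embedding_def)
  define \<psi>s where "\<psi>s = (\<lambda>s. \<lambda>x\<in>scar (?X s). pr s ((\<lambda>x\<in>scar (?X s). snd (\<psi> (s, x))) x))"
  have "(\<lambda>x\<in>scar (?X s). snd (\<psi> (s, x))) \<in> mor ss (?X s) (TT s)" for s
    by (rule mor2_component[OF Xs TT_struct]) (use \<psi> in \<open>simp only: uX Mstr_union2\<close>)
  then have "\<psi>s s \<in> mor ss (?X s) NT" for s
    unfolding \<psi>s_def by (rule TT_mor(2)[OF Xs])
  then have "\<forall>s. \<exists>\<theta>. \<theta> \<in> mor ss (?Y s) NT \<and> (\<forall>x\<in>scar (?X s). \<theta> (\<phi>s s x) = \<psi>s s x)"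
    using inj[unfolded injective_in_def] X2(2) Y2(2) emb by blast
  then obtain \<theta> where \<theta>: "\<And>s. \<theta> s \<in> mor ss (?Y s) NT" "\<And>s x. x \<in> scar (?X s) \<Longrightarrow> \<theta> s (\<phi>s s x) = \<psi>s s x"
    by metis
  define \<Theta> where "\<Theta> = (\<lambda>(s, y)\<in>univ2 Y. (s, (\<lambda>y\<in>scar (?Y s). emb s (\<theta> s y)) y))"
  have "(\<lambda>y\<in>scar (?Y s). emb s (\<theta> s y)) \<in> mor ss (?Y s) (TT s)" for s
    by (rule TT_mor(1)[OF Ys \<theta>(1)])
  from mor2_glue[where X = ?Y and Y = TT, OF Ys TT_struct this]
  have "\<Theta> \<in> mor2 ss Y MT" unfolding \<Theta>_def by (simp only: uY Mstr_union2)
  moreover have "\<Theta> (\<phi> p) = \<psi> p" if "p \<in> univ2 X" for p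
  proof -
    from that obtain s x where p: "p = (s, x)" and x: "x \<in> scar (?X s)" by (auto simp: univ2_def sort_of_def)
    have x': "x \<in> car2 X s" using x by (simp add: sort_of_def)
    have "\<phi>s s x \<in> Z s" using morD(1)[OF str_iso_morD[OF isos] x] by (simp add: restr_def)
    then have y: "\<phi>s s x \<in> scar (?Y s)"
      using closedin_subset[of "stop (?Y s)" "Z s"] Zs[of s] is_struct_topspace[OF Ys] by (auto simp: closed_sub_def)
    then have "\<Theta> (\<phi> p) = (s, emb s (\<psi>s s x))"
      using tag[OF x] \<theta>(2)[OF x] p by (simp add: \<Theta>_def univ2_def sort_of_def)
    also have "snd (\<psi> (s, x)) \<in> carrier (MM s)"
      using mor2D(2)[OF \<psi> x'] by (simp add: Mstr_union2 union2_def scar_TT[symmetric])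
    then have "emb s (\<psi>s s x) = snd (\<psi> (s, x))" using x by (simp add: \<psi>s_def emb_pr)
    finally show ?thesis using mor2D(1)[OF \<psi> x'] p by simp
  qed
  ultimately show "\<exists>\<theta>\<in>mor2 ss Y MT. \<forall>p\<in>univ2 X. \<theta> (\<phi> p) = \<psi> p" by blast
qed

end

section \<open>The dual category\<close>

text \<open>Bijections on objects and arrows that respect identities and composition transfer the category laws from
\<open>C\<close> to \<open>D\<close>, and are an equivalence with identities as natural isomorphisms.\<close>

lemma cat_equivalence_if_iso:
  fixes C :: "('o, 'm) cat" and D :: "('p, 'n) cat"
  assumes C: "category C"
    and F: "\<And>X. X \<in> Ob C \<Longrightarrow> F X \<in> Ob D" "\<And>X. X \<in> Ob C \<Longrightarrow> G (F X) = X"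
    and G: "\<And>Y. Y \<in> Ob D \<Longrightarrow> G Y \<in> Ob C" "\<And>Y. Y \<in> Ob D \<Longrightarrow> F (G Y) = Y"
    and \<Phi>: "\<And>X Y f. X \<in> Ob C \<Longrightarrow> Y \<in> Ob C \<Longrightarrow> f \<in> Ar C X Y \<Longrightarrow> \<Phi> X Y f \<in> Ar D (F X) (F Y)"
      "\<And>X Y f. X \<in> Ob C \<Longrightarrow> Y \<in> Ob C \<Longrightarrow> f \<in> Ar C X Y \<Longrightarrow> \<Psi> (F X) (F Y) (\<Phi> X Y f) = f"
    and \<Psi>: "\<And>X Y g. X \<in> Ob C \<Longrightarrow> Y \<in> Ob C \<Longrightarrow> g \<in> Ar D (F X) (F Y) \<Longrightarrow> \<Psi> (F X) (F Y) g \<in> Ar C X Y"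
      "\<And>X Y g. X \<in> Ob C \<Longrightarrow> Y \<in> Ob C \<Longrightarrow> g \<in> Ar D (F X) (F Y) \<Longrightarrow> \<Phi> X Y (\<Psi> (F X) (F Y) g) = g"
    and Idn: "\<And>X. X \<in> Ob C \<Longrightarrow> \<Phi> X X (Idn C X) = Idn D (F X)"
    and Cmp: "\<And>X Y Z f g. X \<in> Ob C \<Longrightarrow> Y \<in> Ob C \<Longrightarrow> Z \<in> Ob C \<Longrightarrow> f \<in> Ar C X Y \<Longrightarrow> g \<in> Ar C Y Z \<Longrightarrow>
      \<Phi> X Z (Cmp C X Y Z g f) = Cmp D (F X) (F Y) (F Z) (\<Phi> Y Z g) (\<Phi> X Y f)"
  shows "cat_equivalence C D F \<Phi>"
proof -
  have c1: "Idn C X \<in> Ar C X X" if "X \<in> Ob C" for X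
    using C that unfolding category_def by blast
  have c2: "Cmp C X Y Z g f \<in> Ar C X Z"
    if "X \<in> Ob C" "Y \<in> Ob C" "Z \<in> Ob C" "f \<in> Ar C X Y" "g \<in> Ar C Y Z" for X Y Z f g
    using C that unfolding category_def by blast
  have c3: "Cmp C X X Y f (Idn C X) = f" "Cmp C X Y Y (Idn C Y) f = f"
    if "X \<in> Ob C" "Y \<in> Ob C" "f \<in> Ar C X Y" for X Y f
    using C that unfolding category_def by blast+
  have c4: "Cmp C W Y Z h (Cmp C W X Y g f) = Cmp C W X Z (Cmp C X Y Z h g) f"
    if "W \<in> Ob C" "X \<in> Ob C" "Y \<in> Ob C" "Z \<in> Ob C" "f \<in> Ar C W X" "g \<in> Ar C X Y" "h \<in> Ar C Y Z" for W X Y Z f g h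
    using C that unfolding category_def by blast
  have ob: "\<exists>X\<in>Ob C. Y = F X" if "Y \<in> Ob D" for Y using G that by metis
  have ar: "\<exists>f\<in>Ar C X Y. g = \<Phi> X Y f" if "X \<in> Ob C" "Y \<in> Ob C" "g \<in> Ar D (F X) (F Y)" for X Y g
    using \<Psi> that by metis
  have d1: "Idn D X \<in> Ar D X X" if "X \<in> Ob D" for X
    using ob[OF that] c1 \<Phi>(1) Idn by metis
  have d2: "Cmp D X Y Z g f \<in> Ar D X Z"
    if o: "X \<in> Ob D" "Y \<in> Ob D" "Z \<in> Ob D" and fg: "f \<in> Ar D X Y" "g \<in> Ar D Y Z" for X Y Z f g
  proof -
    obtain X' Y' Z' where o': "X' \<in> Ob C" "Y' \<in> Ob C" "Z' \<in> Ob C" "X = F X'" "Y = F Y'" "Z = F Z'"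
      using o ob by metis
    moreover obtain f' g' where "f' \<in> Ar C X' Y'" "g' \<in> Ar C Y' Z'" "f = \<Phi> X' Y' f'" "g = \<Phi> Y' Z' g'"
      using fg o' ar by metis
    ultimately show ?thesis by (simp add: Cmp[symmetric] \<Phi>(1) c2)
  qed
  have d3: "Cmp D X X Y f (Idn D X) = f \<and> Cmp D X Y Y (Idn D Y) f = f"
    if o: "X \<in> Ob D" "Y \<in> Ob D" and f: "f \<in> Ar D X Y" for X Y f
  proof -
    obtain X' Y' where o': "X' \<in> Ob C" "Y' \<in> Ob C" "X = F X'" "Y = F Y'" using o ob by metis
    moreover obtain f' where "f' \<in> Ar C X' Y'" "f = \<Phi> X' Y' f'" using f o' ar by metis
    ultimately show ?thesis by (simp add: Idn[symmetric] Cmp[symmetric] c1 c3)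
  qed
  have d4: "Cmp D W Y Z h (Cmp D W X Y g f) = Cmp D W X Z (Cmp D X Y Z h g) f"
    if o: "W \<in> Ob D" "X \<in> Ob D" "Y \<in> Ob D" "Z \<in> Ob D" and fgh: "f \<in> Ar D W X" "g \<in> Ar D X Y" "h \<in> Ar D Y Z"
    for W X Y Z f g h
  proof -
    obtain W' X' Y' Z' where o': "W' \<in> Ob C" "X' \<in> Ob C" "Y' \<in> Ob C" "Z' \<in> Ob C"
      "W = F W'" "X = F X'" "Y = F Y'" "Z = F Z'"
      using o ob by metis
    moreover obtain f' g' h' where "f' \<in> Ar C W' X'" "g' \<in> Ar C X' Y'" "h' \<in> Ar C Y' Z'"
      "f = \<Phi> W' X' f'" "g = \<Phi> X' Y' g'" "h = \<Phi> Y' Z' h'"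
      using fgh o' ar by metis
    ultimately show ?thesis by (simp add: Cmp[symmetric] c2 c4)
  qed
  have D: "category D"
    unfolding category_def using d1 d2 d3 d4 by simp
  have fF: "functor_between C D F \<Phi>"
    unfolding functor_between_def using F(1) Idn \<Phi>(1) Cmp by simp
  have fG: "functor_between D C G \<Psi>"
    unfolding functor_between_def
  proof (intro conjI ballI)
    fix X assume X: "X \<in> Ob D"
    then show "G X \<in> Ob C" by (rule G)
    obtain X' where "X' \<in> Ob C" "X = F X'" using ob X by blast
    then show "\<Psi> X X (Idn D X) = Idn C (G X)" by (simp add: Idn[symmetric] \<Phi>(2) c1 F(2))
  next
    fix X Y f assume "X \<in> Ob D" "Y \<in> Ob D" "f \<in> Ar D X Y"
    then show "\<Psi> X Y f \<in> Ar C (G X) (G Y)" using ob \<Psi>(1) F(2) by metis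
  next
    fix X Y Z f g assume o: "X \<in> Ob D" "Y \<in> Ob D" "Z \<in> Ob D" and fg: "f \<in> Ar D X Y" "g \<in> Ar D Y Z"
    obtain X' Y' Z' where o': "X' \<in> Ob C" "Y' \<in> Ob C" "Z' \<in> Ob C" "X = F X'" "Y = F Y'" "Z = F Z'"
      using o ob by metis
    moreover obtain f' g' where "f' \<in> Ar C X' Y'" "g' \<in> Ar C Y' Z'" "f = \<Phi> X' Y' f'" "g = \<Phi> Y' Z' g'"
      using fg o' ar by metis
    ultimately show "\<Psi> X Z (Cmp D X Y Z g f) = Cmp C (G X) (G Y) (G Z) (\<Psi> Y Z g) (\<Psi> X Y f)"
      by (simp add: Cmp[symmetric] \<Phi>(2) c2 F(2))
  qed
  have idC: "Idn C X \<in> iso_arrows C X X" if "X \<in> Ob C" for X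
    using that c1 c3 unfolding iso_arrows_def by blast
  have idD: "Idn D X \<in> iso_arrows D X X" if "X \<in> Ob D" for X
    using that d1 d3 unfolding iso_arrows_def by blast
  have "natural_iso C C (\<lambda>X. X) (\<lambda>X Y f. f) (\<lambda>X. G (F X)) (\<lambda>X Y f. \<Psi> (F X) (F Y) (\<Phi> X Y f)) (Idn C)"
    unfolding natural_iso_def using idC c3 F(2) \<Phi>(2) by simp
  moreover have "\<Phi> (G X) (G Y) (\<Psi> X Y f) = f" if "X \<in> Ob D" "Y \<in> Ob D" "f \<in> Ar D X Y" for X Y f
    using \<Psi>(2)[OF G(1)[OF that(1)] G(1)[OF that(2)], of f] G(2) that by simp
  then have "natural_iso D D (\<lambda>X. F (G X)) (\<lambda>X Y f. \<Phi> (G X) (G Y) (\<Psi> X Y f)) (\<lambda>X. X) (\<lambda>X Y f. f) (Idn D)"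
    unfolding natural_iso_def using idD d3 G(2) by simp
  ultimately show ?thesis
    unfolding cat_equivalence_def using C D fF fG by blast
qed

lemma category_prod:
  assumes "category C" "category D"
  shows "category (prod_cat C D)"
  using assms unfolding category_def by (simp add: prod_cat_def split_paired_all)

lemma category_str_cat:
  assumes \<Y>: "\<And>X. X \<in> \<Y> \<Longrightarrow> is_struct ss X"
  shows "category (str_cat ss \<Y>)"
  unfolding category_def str_cat_def cat.simps
proof (intro conjI ballI)
  fix X assume X: "X \<in> \<Y>"
  show "(\<lambda>x\<in>scar X. x) \<in> mor ss X X" by (rule mor_id[OF \<Y>[OF X]])
next
  fix X Y Z f g assume "X \<in> \<Y>" "f \<in> mor ss X Y" "g \<in> mor ss Y Z"
  then show "compose (scar X) g f \<in> mor ss X Z" unfolding compose_def using mor_comp \<Y> by blast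
next
  fix X Y f assume f: "f \<in> mor ss X Y"
  show "compose (scar X) f (\<lambda>x\<in>scar X. x) = f" "compose (scar X) (\<lambda>x\<in>scar Y. x) f = f"
    using morD(1,5)[OF f] by (auto simp: compose_def fun_eq_iff)
next
  fix W X Y Z f g h assume "f \<in> mor ss W X"
  then show "compose (scar W) h (compose (scar W) g f) = compose (scar W) (compose (scar X) h g) f"
    using morD(1) by (fastforce simp: compose_def fun_eq_iff)
qed

context gamma_alter_ego
begin

text \<open>Taking the two sorts apart is inverse to \<open>\<uplus>\<close>, on objects and on morphisms.\<close>

lemma uplus_equivalence:
  "cat_equivalence
     (prod_cat (str_cat ss (IScP ss NT)) (str_cat ss (IScP ss NT)))
     (str_cat2 ss (IScP2 ss MT) :: (('g, 'r, 'x) tstruct2, srt \<times> 'x \<Rightarrow> srt \<times> 'x) cat)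
     (\<lambda>(X1, X2). X1 \<uplus> X2) uplus_map"
proof -
  let ?\<Y> = "IScP ss NT :: ('g, 'r, 'x) tstruct set"
  let ?C = "prod_cat (str_cat ss ?\<Y>) (str_cat ss ?\<Y>)"
    and ?D = "str_cat2 ss (IScP2 ss MT) :: (('g, 'r, 'x) tstruct2, srt \<times> 'x \<Rightarrow> srt \<times> 'x) cat"
  define cs where "cs = (\<lambda>X :: ('g, 'r, 'x) tstruct \<times> ('g, 'r, 'x) tstruct. case_srt (fst X) (snd X))"
  define G where "G = (\<lambda>X :: ('g, 'r, 'x) tstruct2. (sort_of X S1, sort_of X S2))"
  define c where "c = (\<lambda>s (X :: ('g, 'r, 'x) tstruct2) (\<phi> :: srt \<times> 'x \<Rightarrow> srt \<times> 'x). \<lambda>x\<in>scar (sort_of X s). snd (\<phi> (s, x)))"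
  let ?U = "\<lambda>X. union2 (cs X)"
  define \<Psi> where "\<Psi> = (\<lambda>X (Y :: ('g, 'r, 'x) tstruct2) \<phi>. (c S1 X \<phi>, c S2 X \<phi>))"
  have cs: "is_struct ss (cs X s)" "cs X s \<in> ?\<Y>" if "X \<in> ?\<Y> \<times> ?\<Y>" for X s
    using that IScP_struct by (cases s; auto simp: cs_def)+
  have F: "(case X of (X1, X2) \<Rightarrow> X1 \<uplus> X2) = ?U X" for X
    by (cases X) (simp add: uplus_def cs_def)
  have F': "fst X \<uplus> snd X = ?U X" for X by (simp add: uplus_def cs_def)
  have sort: "sort_of (?U X) s = cs X s" if "X \<in> ?\<Y> \<times> ?\<Y>" for X s
    by (rule sort_of_union2) (rule is_struct_topspace[OF cs(1)[OF that]])
  have st: "is_struct2 ss (?U X)" if X: "X \<in> ?\<Y> \<times> ?\<Y>" for X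
    unfolding is_struct2_def sort[OF X] using cs(1)[OF X] by (simp add: union2_def)
  have upm: "uplus_map X Y f = (\<lambda>(s, x)\<in>univ2 (?U X). (s, pr s f x))" for X Y f
    unfolding uplus_map_def F' by (auto simp: fun_eq_iff pr_def split: srt.split)
  have cu: "car2 (?U X) s = scar (cs X s)" for X s by (simp add: union2_def)
  show ?thesis
  proof (rule cat_equivalence_if_iso[where G = G and \<Psi> = \<Psi>], unfold F)
    show "category ?C"
      by (intro category_prod category_str_cat IScP_struct)
  next
    fix X assume "X \<in> Ob ?C"
    then have X: "X \<in> ?\<Y> \<times> ?\<Y>" by (simp add: prod_cat_def str_cat_def)
    show "?U X \<in> Ob ?D"
      using st[OF X] cs(2)[OF X] by (simp add: str_cat2_def IScP2_sorts sort[OF X])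
    show "G (?U X) = X" by (simp add: G_def sort[OF X]) (simp add: cs_def)
    show "uplus_map X X (Idn ?C X) = Idn ?D (?U X)"
      unfolding upm by (cases X) (auto simp: fun_eq_iff str_cat2_def prod_cat_def str_cat_def univ2_union2 cs_def pr_def split: srt.split)
  next
    fix Y :: "('g, 'r, 'x) tstruct2" assume "Y \<in> Ob ?D"
    then have Y: "is_struct2 ss Y" "\<And>s. sort_of Y s \<in> ?\<Y>" by (simp_all add: str_cat2_def IScP2_sorts)
    show "G Y \<in> Ob ?C"
      using Y(2) by (simp add: G_def prod_cat_def str_cat_def)
    have "cs (G Y) = sort_of Y" by (auto simp: cs_def G_def fun_eq_iff split: srt.split)
    then show "union2 (cs (G Y)) = Y" using is_struct2_sorts(1)[OF Y(1)] by simp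
  next
    fix X Y f
    assume "X \<in> Ob ?C" "Y \<in> Ob ?C"
      and f: "f \<in> Ar ?C X Y"
    then have X: "X \<in> ?\<Y> \<times> ?\<Y>" and Y: "Y \<in> ?\<Y> \<times> ?\<Y>" by (simp_all add: prod_cat_def str_cat_def)
    have fm: "pr s f \<in> mor ss (cs X s) (cs Y s)" for s
      using f by (cases X; cases Y; cases s) (auto simp: prod_cat_def str_cat_def cs_def)
    show "uplus_map X Y f \<in> Ar ?D (?U X) (?U Y)"
      using mor2_glue[where f = "\<lambda>s. pr s f", OF cs(1)[OF X] cs(1)[OF Y] fm]
      by (simp add: str_cat2_def upm)
    have "c s (?U X) (uplus_map X Y f) = pr s f" for s
    proof
      show "c s (?U X) (uplus_map X Y f) x = pr s f x" for x
        using morD(5)[OF fm[of s], of x]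
        by (cases "x \<in> scar (cs X s)") (simp_all add: c_def sort[OF X] upm univ2_union2)
    qed
    then show "\<Psi> (?U X) (?U Y) (uplus_map X Y f) = f" by (simp add: \<Psi>_def)
  next
    fix X Y g
    assume "X \<in> Ob ?C" "Y \<in> Ob ?C"
      and g: "g \<in> Ar ?D (?U X) (?U Y)"
    then have X: "X \<in> ?\<Y> \<times> ?\<Y>" and Y: "Y \<in> ?\<Y> \<times> ?\<Y>" and g': "g \<in> mor2 ss (?U X) (?U Y)"
      by (simp_all add: prod_cat_def str_cat_def str_cat2_def)
    have "c s (?U X) g \<in> mor ss (cs X s) (cs Y s)" for s
      using mor2_component[OF cs(1)[OF X] cs(1)[OF Y] g'] by (simp add: c_def sort[OF X])
    from this[of S1] this[of S2]
    show "\<Psi> (?U X) (?U Y) g \<in> Ar ?C X Y"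
      by (cases X; cases Y) (simp add: \<Psi>_def prod_cat_def str_cat_def cs_def)
    have pr\<Psi>: "pr s (\<Psi> (?U X) (?U Y) g) = c s (?U X) g" for s
      by (cases s) (simp_all add: \<Psi>_def)
    show "uplus_map X Y (\<Psi> (?U X) (?U Y) g) = g"
    proof
      fix p show "uplus_map X Y (\<Psi> (?U X) (?U Y) g) p = g p"
      proof (cases "p \<in> univ2 (?U X)")
        case True
        then obtain s x where p: "p = (s, x)" and x: "x \<in> scar (cs X s)" by (auto simp: univ2_union2)
        show ?thesis
          using True mor2D(1)[OF g', of x s] x unfolding upm pr\<Psi> by (simp add: p c_def sort[OF X] cu)
      qed (use mor2_outside[OF g'] in \<open>simp add: upm\<close>)
    qed
  next
    fix X Y Z f g
    assume "X \<in> Ob ?C" "Y \<in> Ob ?C"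
      and f: "f \<in> Ar ?C X Y"
    have fm: "pr s f \<in> mor ss (cs X s) (cs Y s)" for s
      using f by (cases X; cases Y; cases s) (auto simp: prod_cat_def str_cat_def cs_def)
    have "pr s (Cmp ?C X Y Z g f) = compose (scar (cs X s)) (pr s g) (pr s f)" for s
      by (cases X; cases Y; cases Z; cases f; cases g; cases s) (simp_all add: prod_cat_def str_cat_def cs_def)
    then show "uplus_map X Z (Cmp ?C X Y Z g f) =
        Cmp ?D (?U X) (?U Y) (?U Z) (uplus_map Y Z g) (uplus_map X Y f)"
      using morD(1)[OF fm] unfolding upm by (auto simp: str_cat2_def fun_eq_iff compose_def univ2_union2)
  qed
qed

end

theorem theorem6p3:
  fixes Sg :: "'f sgn" and N T :: "('f, 'n) alg" and \<Gamma> :: "'f gpair set"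
    and r1 r2 :: "'f gpair \<Rightarrow> 'f trm"
    and ss :: "('g, 'r) ssgn" and NT :: "('g, 'r, 'n) tstruct"
  assumes "algebra Sg N" and "trivial_algebra Sg T" and "gamma_wf Sg \<Gamma>"
    and "cond_L Sg N \<Gamma>" and "cond_M N \<Gamma>" and "cond_D Sg N \<Gamma> r1 r2"
    and "(ISP Sg {N} :: ('f, 'a) alg set) = HSP Sg {N}"
    and "yields_duality Sg N ss NT (ISP Sg {N} :: ('f, 'a) alg set)"
  shows
    "(ISP (gsgn \<Gamma>) {odot r1 r2 N T, odot r1 r2 T N} :: ('f gpair, 'a) alg set) =
       HSP (gsgn \<Gamma>) {odot r1 r2 P Q | (P :: ('f, 'a) alg) (Q :: ('f, 'a) alg). P \<in> HSP Sg {N} \<and> Q \<in> HSP Sg {N}} \<and>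
     (HSP (gsgn \<Gamma>) {odot r1 r2 P Q | (P :: ('f, 'p) alg) (Q :: ('f, 'q) alg).
          P \<in> HSP Sg {N} \<and> Q \<in> HSP Sg {N}} :: ('f gpair, 'a) alg set) \<subseteq>
       ISP (gsgn \<Gamma>) {odot r1 r2 N T, odot r1 r2 T N} \<and>
     yields_duality2 (gsgn \<Gamma>) (Malg r1 r2 N T) ss (Mstr T NT)
       (ISP (gsgn \<Gamma>) {odot r1 r2 N T, odot r1 r2 T N} :: ('f gpair, 'a) alg set) \<and>
     cat_equivalence
       (prod_cat (str_cat ss (IScP ss NT)) (str_cat ss (IScP ss NT)))
       (str_cat2 ss (IScP2 ss (Mstr T NT)) :: (('g, 'r, 'x) tstruct2, srt \<times> 'x \<Rightarrow> srt \<times> 'x) cat)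
       (\<lambda>(X1, X2). X1 \<uplus> X2) uplus_map \<and>
     (full_duality Sg N ss NT (ISP Sg {N} :: ('f, 'a) alg set) (IScP ss NT :: ('g, 'r, 'x) tstruct set) \<longrightarrow>
       full_duality2 (gsgn \<Gamma>) (Malg r1 r2 N T) ss (Mstr T NT)
         (ISP (gsgn \<Gamma>) {odot r1 r2 N T, odot r1 r2 T N} :: ('f gpair, 'a) alg set)
         (IScP2 ss (Mstr T NT) :: ('g, 'r, 'x) tstruct2 set)) \<and>
     (strong_duality Sg N ss NT (ISP Sg {N} :: ('f, 'a) alg set) (IScP ss NT :: ('g, 'r, 'x) tstruct set) \<longrightarrow>
       strong_duality2 (gsgn \<Gamma>) (Malg r1 r2 N T) ss (Mstr T NT)
         (ISP (gsgn \<Gamma>) {odot r1 r2 N T, odot r1 r2 T N} :: ('f gpair, 'a) alg set)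
         (IScP2 ss (Mstr T NT) :: ('g, 'r, 'x) tstruct2 set))"
proof -
  have AE: "alter_ego Sg N ss NT" using assms(8) by (simp add: yields_duality_def)
  interpret gamma_alter_ego Sg N T \<Gamma> r1 r2 ss NT
    using assms(1,2,4-6) AE by unfold_locales
  let ?K = "{odot r1 r2 N T, odot r1 r2 T N}"
  have dual: "alg_iso Sg P (E1 N ss NT (D1 Sg N NT P)) (eval1 Sg N P)"
    if "P \<in> HSP Sg {N}" for P :: "('f, 'a) alg"
    using that assms(7,8) by (auto simp: yields_duality_def)
  have sub: "(HSP GS {odot r1 r2 P Q | (P :: ('f, 's) alg) (Q :: ('f, 't) alg).
          P \<in> HSP Sg {N} \<and> Q \<in> HSP Sg {N}} :: ('f gpair, 'a) alg set) \<subseteq> ISP GS ?K"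
  proof
    fix A :: "('f gpair, 'a) alg"
    assume "A \<in> HSP GS {odot r1 r2 P Q | (P :: ('f, 's) alg) (Q :: ('f, 't) alg). P \<in> HSP Sg {N} \<and> Q \<in> HSP Sg {N}}"
    then obtain P :: "srt \<Rightarrow> ('f, 'a) alg" and q where d: "decomposition A P q" by (rule HSP_odot_decomposes)
    show "A \<in> ISP GS ?K"
      by (rule decomposed_ISP[OF d]) (rule eval1_separates[OF dual[OF decompositionD(2)[OF d]]])
  qed
  have decomp: "\<exists>(P :: srt \<Rightarrow> ('f, 'a) alg) q. decomposition A P q" if A: "A \<in> ISP GS ?K" for A :: "('f gpair, 'a) alg"
  proof -
    let ?L = "{odot r1 r2 P Q | (P :: ('f, 'n) alg) (Q :: ('f, 'n) alg). P \<in> HSP Sg {N} \<and> Q \<in> HSP Sg {N}}"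
    \<comment> \<open>\<open>\<^bold>T\<close> is a quotient of \<open>\<^bold>N\<close>, so both generators are themselves of the form \<open>\<^bold>P \<odot> \<^bold>Q\<close>.\<close>
    have "?K \<subseteq> ?L"
      using HSP_N HSP_T by blast
    then have "A \<in> HSP GS ?L"
      using A ISP_subset_HSP HSP_mono by blast
    then obtain P :: "srt \<Rightarrow> ('f, 'a) alg" and q where "decomposition A P q" by (rule HSP_odot_decomposes)
    then show ?thesis by blast
  qed
  have "ISP GS ?K \<subseteq> (HSP GS {odot r1 r2 P Q | (P :: ('f, 'a) alg) (Q :: ('f, 'a) alg).
      P \<in> HSP Sg {N} \<and> Q \<in> HSP Sg {N}} :: ('f gpair, 'a) alg set)" (is "_ \<subseteq> HSP GS ?L")
  proof
    fix A :: "('f gpair, 'a) alg" assume "A \<in> ISP GS ?K"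
    then obtain P :: "srt \<Rightarrow> ('f, 'a) alg" and q where d: "decomposition A P q" using decomp by blast
    note P = decompositionD(2)[OF d]
    have "odot r1 r2 (P S1) (P S2) \<in> ?L" using P by blast
    then have "odot r1 r2 (P S1) (P S2) \<in> HSP GS ?L"
      by (rule HSP_base) (rule algebra_odot[OF HSP_algebra[OF P] HSP_algebra[OF P]])
    then show "A \<in> HSP GS ?L"
      by (rule HSP_iso[OF _ decompositionD(1)[OF d] odot_decomposition[OF d]])
  qed
  then have eq: "(ISP GS ?K :: ('f gpair, 'a) alg set) = HSP GS ?L" using sub by blast
  have yd: "yields_duality2 GS MM ss MT (ISP GS ?K :: ('f gpair, 'a) alg set)"
    unfolding yields_duality2_def
  proof (intro conjI ballI)
    show "alter_ego2 GS MM ss MT" by (rule alter_ego2_Mstr)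
    fix A :: "('f gpair, 'a) alg" assume "A \<in> ISP GS ?K"
    then obtain P :: "srt \<Rightarrow> ('f, 'a) alg" and q where d: "decomposition A P q" using decomp by blast
    show "alg_iso GS A (E2 MM ss MT (D2 GS MM MT A)) (eval2 GS MM A)"
      by (rule duality_decomposed[OF d dual[OF decompositionD(2)[OF d]]])
  qed
  have full: "full_duality2 GS MM ss MT (ISP GS ?K :: ('f gpair, 'a) alg set) (IScP2 ss MT :: ('g, 'r, 'x) tstruct2 set)"
    if "full_duality Sg N ss NT (ISP Sg {N} :: ('f, 'a) alg set) (IScP ss NT :: ('g, 'r, 'x) tstruct set)"
    unfolding full_duality2_def
  proof (intro conjI ballI yd)
    fix X :: "('g, 'r, 'x) tstruct2" assume X: "X \<in> IScP2 ss MT"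
    show "str_iso2 ss X (D2 GS MM MT (E2 MM ss MT X)) (coeval2 ss MT X)"
      by (rule full_two_sorted[OF X]) (use X that in \<open>simp add: IScP2_sorts full_duality_def\<close>)
  qed
  show ?thesis
  proof (intro conjI impI)
    assume "strong_duality Sg N ss NT (ISP Sg {N} :: ('f, 'a) alg set) (IScP ss NT :: ('g, 'r, 'x) tstruct set)"
    then have "full_duality Sg N ss NT (ISP Sg {N} :: ('f, 'a) alg set) (IScP ss NT :: ('g, 'r, 'x) tstruct set)"
      and "injective_in ss NT (IScP ss NT :: ('g, 'r, 'x) tstruct set)"
      by (simp_all add: strong_duality_def)
    then show "strong_duality2 GS MM ss MT (ISP GS ?K :: ('f gpair, 'a) alg set) (IScP2 ss MT :: ('g, 'r, 'x) tstruct2 set)"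
      unfolding strong_duality2_def by (intro conjI full injective_two_sorted)
  qed (fact eq sub yd uplus_equivalence full)+
qed

end
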